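(* Let $(G,A,\varphi)$ be a finitely generated marked group and let $X=\ker(\varphi)\backslash\overrightarrow{T}_A$, where $\overrightarrow{T}_A$ is the directed Cayley graph of the free group $F_A$ with respect to $A$. Let $$\mathcal{C}_1^X(G)=\mathrm{Comm}_{\mathrm{Aut}(X)}(G)\cap\mathrm{Aut}_1(X)$$ be the subgroup of automorphisms of $X$ fixing the vertex corresponding to the identity in $G$ and commensurating $G$, and let $B_X$ be the set of bireversible automorphisms of $X$. Then $\mathcal{C}_1^X(G)=B_X$.
   Context: Marked groups and graphs. A finitely generated marked group is a triple $(G,A,\varphi)$ with $G$ a group, $A$ a finite set and $\varphi\colon F_A\to G$ an epimorphism from the free group on $A$. $\overrightarrow{T}_A$ is the directed graph with vertex set $F_A$ and edges $(g,ga)$, $g\in F_A$, $a\in A$; $F_A$ acts on it by left multiplication. Hence $X=\ker(\varphi)\backslash\overrightarrow{T}_A$ is the directed graph (possibly with multiple edges and loops) with vertex set $G$ and, for each $g\in G$, $a\in A$, one edge from $g$ to $g\varphi(a)$; its automorphisms act on vertices and edges. $G$ is regarded as a subgroup of $\mathrm{Aut}(X)$ by left multiplication, and likewise $F_A\le\mathrm{Aut}(\overrightarrow{T}_A)$. $\mathrm{Aut}_1$ denotes the stabiliser of the identity vertex. For $H\leq K$, $\mathrm{Comm}_K(H)=\{k\in K\mid [H:H\cap kHk^{-1}]<\infty,\ [kHk^{-1}:H\cap kHk^{-1}]<\infty\}$. The map $\zeta_\varphi$. Let $p_\varphi\colon\overrightarrow{T}_A\to X$ be the quotient map and $N_\varphi$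 the normaliser of $\ker(\varphi)$ in $\mathrm{Aut}(\overrightarrow{T}_A)$. $\zeta_\varphi\colon N_\varphi\to\mathrm{Aut}(X)$ is the unique homomorphism with $p_\varphi\circ g=\zeta_\varphi(g)\circ p_\varphi$ for all $g\in N_\varphi$. Bireversible automata. A Mealy automaton $\mathcal{M}=(A,Q,\lambda,\rho)$ consists of finite sets $A$ (alphabet), $Q$ (states) and maps $\lambda\colon Q\times A\to A$, $\rho\colon Q\times A\to Q$. It is bireversible if $a\mapsto\lambda(q,a)$ is a bijection of $A$ for every $q$, $q\mapsto\rho(q,a)$ is a bijection of $Q$ for every $a$, and $(q,a)\mapsto(\lambda(q,a),\rho(q,a))$ is a bijection $Q\times A\to A\times Q$. Its fundamental group is $\pi_1(\mathcal{M})=\langle Q,A\mid qa=\lambda(q,a)\rho(q,a)\ \forall q\in Q,a\in A\rangle$. It is known that the subgroups generated by $Q$ and by $A$ are free with bases $Q$ and $A$ (denoted $F_Q$, $F_A$), and that every $p\in\pi_1(\mathcal{M})$ can be written uniquely as $p=gv$ and uniquely as $p=wh$ with $g,h\in F_Q$, $v,w\in F_A$. Let $N_Q$ be the largest normal subgroup of $\pi_1(\mathcal{M})$ contained in $F_Q$; the group generated by $\mathcal{M}$ is $G_{\mathcal{M}}=F_Q/N_Q\leq\pi_1(\mathcal{M})/N_Q$. The group $\pi_1(\mathcal{M})$ acts on $F_A$ by $p\cdot v=w$, where $pv=wh$ with $w\in F_A$, $h\in F_Q$; this action is by automorphisms of $\overrightarrow{T}_A$, has kernel $N_Q$, and so induces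 an injective homomorphism $\psi_{\mathcal{M}}\colon\pi_1(\mathcal{M})/N_Q\to\mathrm{Aut}(\overrightarrow{T}_A)$ with $\psi_{\mathcal{M}}(G_{\mathcal{M}})\leq\mathrm{Aut}_1(\overrightarrow{T}_A)$. Compatibility and bireversible automorphisms. A bireversible automaton $\mathcal{M}=(A,Q,\lambda,\rho)$ is compatible with $(G,A,\varphi)$ if $\ker(\varphi)\leq F_A$ (viewed inside $\pi_1(\mathcal{M})/N_Q$, into which $F_A$ embeds) is normal in $\pi_1(\mathcal{M})/N_Q$; then $\psi_{\mathcal{M}}$ takes values in $N_\varphi$. An automorphism $f\in\mathrm{Aut}_1(X)$ is bireversible if there is a bireversible automaton $\mathcal{M}=(A,Q,\lambda,\rho)$ compatible with $(G,A,\varphi)$ such that $f\in\zeta_\varphi(\psi_{\mathcal{M}}(G_{\mathcal{M}}))$. *)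

theory Defs
  imports "HOL-Algebra.Algebra" "Graph_Theory.Digraph"
begin

section \<open>Free groups and presentations\<close>

text \<open>
  The letter \<open>(x, True)\<close> is the generator \<open>x\<close> and \<open>(x, False)\<close> is its inverse.
\<close>

type_synonym 'a fword = "('a \<times> bool) list"

definition inv_letter :: "'a \<times> bool \<Rightarrow> 'a \<times> bool" where
  "inv_letter l = (fst l, \<not> snd l)"

definition fcons :: "'a \<times> bool \<Rightarrow> 'a fword \<Rightarrow> 'a fword" where
  "fcons l w = (case w of [] \<Rightarrow> [l] | m # ms \<Rightarrow> if m = inv_letter l then ms else l # w)"

definition free_reduce :: "'a fword \<Rightarrow> 'a fword" where
  "free_reduce w = foldr fcons w []"

definition reduced_words :: "'a set \<Rightarrow> 'a fword set" where
  "reduced_words S = {w. set w \<subseteq> S \<times> UNIV \<and> successively (\<lambda>l m. m \<noteq> inv_letter l) w}"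

definition free_group :: "'a set \<Rightarrow> 'a fword monoid" where
  "free_group S = \<lparr>carrier = reduced_words S, monoid.mult = (\<lambda>u v. free_reduce (u @ v)), one = []\<rparr>"

definition free_gen :: "'a \<Rightarrow> 'a fword" where
  "free_gen x = [(x, True)]"

text \<open>The homomorphism from the free group to \<open>G\<close> that extends \<open>f\<close>:\<close>

definition free_lift :: "('g, 'm) monoid_scheme \<Rightarrow> ('a \<Rightarrow> 'g) \<Rightarrow> 'a fword \<Rightarrow> 'g" where
  "free_lift G f w =
     foldr (\<lambda>(x, b) g. (if b then f x else inv\<^bsub>G\<^esub> f x) \<otimes>\<^bsub>G\<^esub> g) w \<one>\<^bsub>G\<^esub>"

definition normal_closure :: "('g, 'm) monoid_scheme \<Rightarrow> 'g set \<Rightarrow> 'g set" where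
  "normal_closure G R = \<Inter>{N. N \<lhd> G \<and> R \<subseteq> N}"

definition presented_group :: "'a set \<Rightarrow> 'a fword set \<Rightarrow> 'a fword set monoid" where
  "presented_group S R = free_group S Mod normal_closure (free_group S) R"

definition presented_gen :: "'a set \<Rightarrow> 'a fword set \<Rightarrow> 'a \<Rightarrow> 'a fword set" where
  "presented_gen S R x = normal_closure (free_group S) R #>\<^bsub>free_group S\<^esub> free_gen x"

subsection \<open>Basic facts\<close>

lemma inv_letter_simps [simp]:
  "inv_letter (x, b) = (x, \<not> b)" "inv_letter (inv_letter l) = l"
  "fst (inv_letter l) = fst l" "inv_letter l \<noteq> l" "l \<noteq> inv_letter l"
  by (cases l; auto simp: inv_letter_def)+

lemma fcons_closed:
  assumes "w \<in> reduced_words S" "fst l \<in> S"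
  shows "fcons l w \<in> reduced_words S"
  using assms
  by (cases w; cases l)
     (auto simp: fcons_def reduced_words_def successively_Cons split: if_splits)

lemma fcons_cancel:
  assumes "w \<in> reduced_words S"
  shows "fcons (inv_letter l) (fcons l w) = w"
  using assms
  by (auto simp: fcons_def reduced_words_def successively_Cons split: list.splits)

lemma foldr_fcons_closed:
  assumes "w \<in> reduced_words S" "set u \<subseteq> S \<times> UNIV"
  shows "foldr fcons u w \<in> reduced_words S"
  using assms(2) by (induction u) (auto intro!: fcons_closed[of _ S] assms(1))

lemma free_reduce_id: "w \<in> reduced_words S \<Longrightarrow> free_reduce w = w"
proof (induction w)
  case (Cons l w)
  then have "free_reduce w = w"
    by (auto simp: reduced_words_def successively_Cons)
  then have "free_reduce (l # w) = fcons l w"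
    by (simp add: free_reduce_def)
  also have "\<dots> = l # w"
    using Cons.prems by (cases w) (auto simp: fcons_def reduced_words_def)
  finally show ?case .
qed (simp add: free_reduce_def)

lemma free_mult:
  assumes "v \<in> reduced_words S"
  shows "free_reduce (u @ v) = foldr fcons u v"
  using free_reduce_id[OF assms] by (simp add: free_reduce_def)

lemma foldr_fcons_fcons:
  assumes "w \<in> reduced_words S" "v \<in> reduced_words S" "fst l \<in> S"
  shows "foldr fcons (fcons l v) w = fcons l (foldr fcons v w)"
proof (cases "\<exists>ms. v = inv_letter l # ms")
  case True
  then obtain ms where ms: "v = inv_letter l # ms" by blast
  have "foldr fcons ms w \<in> reduced_words S"
    using assms ms by (intro foldr_fcons_closed) (auto simp: reduced_words_def)
  from fcons_cancel[OF this, of "inv_letter l"] show ?thesis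
    using ms by (simp add: fcons_def)
next
  case False
  then have "fcons l v = l # v" by (cases v) (auto simp: fcons_def)
  then show ?thesis by simp
qed

lemma reduced_words_Nil [simp]: "[] \<in> reduced_words S"
  by (simp add: reduced_words_def)

lemma reduced_words_ConsD: "l # w \<in> reduced_words S \<Longrightarrow> fst l \<in> S \<and> w \<in> reduced_words S"
  by (cases l) (auto simp: reduced_words_def successively_Cons)

lemma reduced_words_setD: "w \<in> reduced_words S \<Longrightarrow> set w \<subseteq> S \<times> UNIV"
  by (simp add: reduced_words_def)

lemma foldr_fcons_assoc:
  assumes "w \<in> reduced_words S" "v \<in> reduced_words S"
  shows "u \<in> reduced_words S \<Longrightarrow>
    foldr fcons (foldr fcons u v) w = foldr fcons u (foldr fcons v w)"
proof (induction u)
  case (Cons l u)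
  from reduced_words_ConsD[OF Cons.prems]
  have l: "fst l \<in> S" and u: "u \<in> reduced_words S" by auto
  have "foldr fcons u v \<in> reduced_words S"
    using foldr_fcons_closed[OF assms(2) reduced_words_setD[OF u]] .
  from foldr_fcons_fcons[OF assms(1) this l] show ?case
    using Cons.IH[OF u] by simp
qed simp

lemma free_group_inv:
  "u \<in> reduced_words S \<Longrightarrow> \<exists>v \<in> reduced_words S. foldr fcons v u = []"
proof (induction u)
  case (Cons l u)
  from reduced_words_ConsD[OF Cons.prems]
  have l: "fst l \<in> S" and u: "u \<in> reduced_words S" by auto
  from Cons.IH[OF u] obtain v where v: "v \<in> reduced_words S" "foldr fcons v u = []" by blast
  have lu: "fcons (inv_letter l) (l # u) = u" by (simp add: fcons_def)
  have s: "[inv_letter l] \<in> reduced_words S"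
    using l by (cases l) (simp add: reduced_words_def)
  have "foldr fcons (foldr fcons v [inv_letter l]) (l # u) = []"
    using foldr_fcons_assoc[OF Cons.prems s v(1)] lu v(2) by simp
  moreover have "foldr fcons v [inv_letter l] \<in> reduced_words S"
    using foldr_fcons_closed[OF s reduced_words_setD[OF v(1)]] .
  ultimately show ?case by blast
qed (auto intro!: bexI[of _ "[]"])

lemma group_free_group: "group (free_group S)"
proof (rule groupI; unfold free_group_def; simp)
  fix x y z assume xyz: "x \<in> reduced_words S" "y \<in> reduced_words S" "z \<in> reduced_words S"
  have xy: "foldr fcons x y \<in> reduced_words S" and yz: "foldr fcons y z \<in> reduced_words S"
    using xyz foldr_fcons_closed reduced_words_setD by blast+
  show "free_reduce (free_reduce (x @ y) @ z) = free_reduce (x @ free_reduce (y @ z))"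
    unfolding free_mult[OF xyz(2)] free_mult[OF xyz(3)] free_mult[OF yz]
    using foldr_fcons_assoc[OF xyz(3,2,1)] .
next
  fix x y assume "x \<in> reduced_words S" "y \<in> reduced_words S"
  then show "free_reduce (x @ y) \<in> reduced_words S"
    using foldr_fcons_closed reduced_words_setD by (simp add: free_mult) blast
next
  fix x assume x: "x \<in> reduced_words S"
  then show "free_reduce x = x" by (rule free_reduce_id)
  show "\<exists>y\<in>reduced_words S. free_reduce (y @ x) = []"
    using free_group_inv[OF x] by (simp add: free_mult[OF x])
qed

lemma free_gen_closed: "x \<in> S \<Longrightarrow> free_gen x \<in> carrier (free_group S)"
  by (simp add: free_gen_def free_group_def reduced_words_def)

lemma free_lift_gen:
  assumes "group G" "f x \<in> carrier G"
  shows "free_lift G f (free_gen x) = f x"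
proof -
  interpret group G by fact
  show ?thesis using assms(2) by (simp add: free_lift_def free_gen_def)
qed

lemma free_lift_hom:
  assumes "group G" "f \<in> S \<rightarrow> carrier G"
  shows "free_lift G f \<in> hom (free_group S) G"
proof -
  interpret group G by fact
  have cl: "free_lift G f w \<in> carrier G" if "w \<in> reduced_words S" for w
    using that
  proof (induction w)
    case (Cons l w)
    from reduced_words_ConsD[OF Cons.prems] Cons.IH assms(2) show ?case
      by (cases l) (auto simp: free_lift_def)
  qed (simp add: free_lift_def)
  have fc: "free_lift G f (fcons l w) = free_lift G f (l # w)"
    if "w \<in> reduced_words S" "fst l \<in> S" for l w
  proof (cases "\<exists>ms. w = inv_letter l # ms")
    case True
    then obtain ms where ms: "w = inv_letter l # ms" by blast
    obtain x b where l: "l = (x, b)" by (cases l)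
    have c: "f x \<in> carrier G" "free_lift G f ms \<in> carrier G"
      using that l ms assms(2) cl reduced_words_ConsD[of "inv_letter l" ms S] by auto
    have f: "fcons l w = ms" using ms by (simp add: fcons_def)
    have "free_lift G f (l # w) = (if b then f x else inv\<^bsub>G\<^esub> f x) \<otimes>\<^bsub>G\<^esub>
        ((if \<not> b then f x else inv\<^bsub>G\<^esub> f x) \<otimes>\<^bsub>G\<^esub> free_lift G f ms)"
      using ms l by (simp add: free_lift_def)
    also have "\<dots> = free_lift G f ms"
      using c by (simp add: m_assoc[symmetric])
    finally show ?thesis using f by simp
  next
    case False
    then have "fcons l w = l # w" by (cases w) (auto simp: fcons_def)
    then show ?thesis by simp
  qed
  have m: "free_lift G f (foldr fcons u v) = free_lift G f u \<otimes>\<^bsub>G\<^esub> free_lift G f v"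
    if "u \<in> reduced_words S" "v \<in> reduced_words S" for u v
    using that(1)
  proof (induction u)
    case Nil
    then show ?case using cl[OF that(2)] by (simp add: free_lift_def)
  next
    case (Cons l u)
    from reduced_words_ConsD[OF Cons.prems]
    have l: "fst l \<in> S" and u: "u \<in> reduced_words S" by auto
    have uv: "foldr fcons u v \<in> reduced_words S"
      using foldr_fcons_closed[OF that(2) reduced_words_setD[OF u]] .
    obtain x b where xb: "l = (x, b)" by (cases l)
    have c: "f x \<in> carrier G" using l xb assms(2) by auto
    have "free_lift G f (foldr fcons (l # u) v) = free_lift G f (l # foldr fcons u v)"
      using fc[OF uv l] by simp
    also have "\<dots> = (if b then f x else inv\<^bsub>G\<^esub> f x) \<otimes>\<^bsub>G\<^esub> (free_lift G f u \<otimes>\<^bsub>G\<^esub> free_lift G f v)"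
      using Cons.IH[OF u] xb by (simp add: free_lift_def)
    also have "\<dots> = free_lift G f (l # u) \<otimes>\<^bsub>G\<^esub> free_lift G f v"
      using c xb cl[OF u] cl[OF that(2)] by (simp add: free_lift_def m_assoc)
    finally show ?case .
  qed
  show ?thesis
    using cl m by (intro homI) (auto simp: free_group_def free_mult)
qed


section \<open>Directed graphs and their automorphisms\<close>

text \<open>
  Loops and multiple edges are allowed, so an automorphism is a pair of a vertex map and
  an edge map.
\<close>

definition aut_group :: "('v, 'e) pre_digraph \<Rightarrow> (('v \<Rightarrow> 'v) \<times> ('e \<Rightarrow> 'e)) monoid" where
  "aut_group D = (BijGroup (verts D) \<times>\<times> BijGroup (arcs D))
     \<lparr>carrier := {(f, h). f \<in> Bij (verts D) \<and> h \<in> Bij (arcs D) \<and>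
        (\<forall>e \<in> arcs D. tail D (h e) = f (tail D e) \<and> head D (h e) = f (head D e))}\<rparr>"

definition aut_fixing :: "('v, 'e) pre_digraph \<Rightarrow> 'v \<Rightarrow> (('v \<Rightarrow> 'v) \<times> ('e \<Rightarrow> 'e)) set" where
  "aut_fixing D x = {k \<in> carrier (aut_group D). fst k x = x}"

text \<open>The arc \<open>(g, b)\<close> is the edge from \<open>g\<close> to \<open>g \<otimes> s b\<close> belonging to the generator \<open>b\<close>.\<close>

definition cayley_graph ::
    "('g, 'm) monoid_scheme \<Rightarrow> 'a set \<Rightarrow> ('a \<Rightarrow> 'g) \<Rightarrow> ('g, 'g \<times> 'a) pre_digraph" where
  "cayley_graph G B s = \<lparr>verts = carrier G, arcs = carrier G \<times> B,
     tail = fst, head = (\<lambda>(g, b). g \<otimes>\<^bsub>G\<^esub> s b)\<rparr>"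

definition left_translation ::
    "('g, 'm) monoid_scheme \<Rightarrow> 'a set \<Rightarrow> 'g \<Rightarrow> ('g \<Rightarrow> 'g) \<times> ('g \<times> 'a \<Rightarrow> 'g \<times> 'a)" where
  "left_translation G B g =
     (\<lambda>x \<in> carrier G. g \<otimes>\<^bsub>G\<^esub> x,
      restrict (\<lambda>(x, b). (g \<otimes>\<^bsub>G\<^esub> x, b)) (carrier G \<times> B))"

definition finite_index :: "('g, 'm) monoid_scheme \<Rightarrow> 'g set \<Rightarrow> 'g set \<Rightarrow> bool" where
  "finite_index K H L \<longleftrightarrow> finite (rcosets\<^bsub>K\<lparr>carrier := H\<rparr>\<^esub> L)"

definition commensurator :: "('g, 'm) monoid_scheme \<Rightarrow> 'g set \<Rightarrow> 'g set" where
  "commensurator K H = {k \<in> carrier K.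
     (let H' = k <#\<^bsub>K\<^esub> H #>\<^bsub>K\<^esub> inv\<^bsub>K\<^esub> k
      in finite_index K H (H \<inter> H') \<and> finite_index K H' (H \<inter> H'))}"

subsection \<open>Basic facts\<close>

lemma BijGroup_mult: "f \<in> Bij S \<Longrightarrow> h \<in> Bij S \<Longrightarrow> f \<otimes>\<^bsub>BijGroup S\<^esub> h = compose S f h"
  by (simp add: BijGroup_def)

lemma aut_group_mult:
  assumes "k \<in> carrier (aut_group D)" "l \<in> carrier (aut_group D)"
  shows "k \<otimes>\<^bsub>aut_group D\<^esub> l =
    (compose (verts D) (fst k) (fst l), compose (arcs D) (snd k) (snd l))"
  using assms by (auto simp: aut_group_def DirProd_def BijGroup_mult)

lemma group_aut_group:
  assumes "wf_digraph D"
  shows "group (aut_group D)"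
proof -
  interpret wf_digraph D by fact
  let ?P = "BijGroup (verts D) \<times>\<times> BijGroup (arcs D)"
  interpret V: group "BijGroup (verts D)" by (rule group_BijGroup)
  interpret E: group "BijGroup (arcs D)" by (rule group_BijGroup)
  interpret P: group ?P by (intro DirProd_group V.group_axioms E.group_axioms)
  have "subgroup (carrier (aut_group D)) ?P"
  proof (rule P.subgroupI)
    show "carrier (aut_group D) \<subseteq> carrier ?P"
      by (auto simp: aut_group_def DirProd_def BijGroup_def)
    have "\<one>\<^bsub>?P\<^esub> \<in> carrier (aut_group D)"
      by (auto simp: aut_group_def DirProd_def BijGroup_def id_Bij)
    then show "carrier (aut_group D) \<noteq> {}" by blast
  next
    fix k assume "k \<in> carrier (aut_group D)"
    then obtain f h where k: "k = (f, h)" "f \<in> Bij (verts D)" "h \<in> Bij (arcs D)"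
      and c: "\<And>e. e \<in> arcs D \<Longrightarrow> tail D (h e) = f (tail D e) \<and> head D (h e) = f (head D e)"
      by (auto simp: aut_group_def)
    have fh: "f \<in> carrier (BijGroup (verts D))" "h \<in> carrier (BijGroup (arcs D))"
      using k by (simp_all add: BijGroup_def)
    have i: "inv\<^bsub>?P\<^esub> k =
        (restrict (inv_into (verts D) f) (verts D), restrict (inv_into (arcs D) h) (arcs D))"
      unfolding k(1) inv_DirProd[OF V.group_axioms E.group_axioms fh]
      using k by (simp add: inv_BijGroup)
    have f: "bij_betw f (verts D) (verts D)" and h: "bij_betw h (arcs D) (arcs D)"
      using k by (auto simp: Bij_def)
    have "tail D (inv_into (arcs D) h e) = inv_into (verts D) f (tail D e) \<and>
          head D (inv_into (arcs D) h e) = inv_into (verts D) f (head D e)"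
      if e: "e \<in> arcs D" for e
    proof -
      let ?d = "inv_into (arcs D) h e"
      have d: "?d \<in> arcs D" "h ?d = e"
        using h e by (auto simp: bij_betw_def inv_into_into f_inv_into_f)
      show ?thesis
        using c[OF d(1)] d f tail_in_verts[OF d(1)] head_in_verts[OF d(1)]
        by (metis bij_betw_inv_into_left)
    qed
    then show "inv\<^bsub>?P\<^esub> k \<in> carrier (aut_group D)"
      using k i by (auto simp: aut_group_def restrict_inv_into_Bij)
  next
    fix k l assume "k \<in> carrier (aut_group D)" "l \<in> carrier (aut_group D)"
    then show "k \<otimes>\<^bsub>?P\<^esub> l \<in> carrier (aut_group D)"
      by (auto simp: aut_group_def DirProd_def BijGroup_mult compose_Bij)
         (auto simp: compose_def Pi_iff dest!: Bij_imp_funcset)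
  qed
  from P.subgroup_imp_group[OF this] show ?thesis
    by (simp add: aut_group_def)
qed

lemma wf_cayley_graph:
  assumes "group G" "s \<in> B \<rightarrow> carrier G"
  shows "wf_digraph (cayley_graph G B s)"
proof -
  interpret group G by fact
  show ?thesis using assms(2) by unfold_locales (auto simp: cayley_graph_def)
qed


section \<open>Marked groups\<close>

locale marked_group = group G
  for G :: "('g, 'm) monoid_scheme" (structure)
  and A :: "'a set"
  and \<phi> :: "'a fword \<Rightarrow> 'g" +
  assumes finite_A: "finite A"
    and epi: "\<phi> \<in> epi (free_group A) G"

definition free_tree :: "'a set \<Rightarrow> ('a fword, 'a fword \<times> 'a) pre_digraph" where
  "free_tree A = cayley_graph (free_group A) A free_gen"

definition marked_graph ::
    "('g, 'm) monoid_scheme \<Rightarrow> 'a set \<Rightarrow> ('a fword \<Rightarrow> 'g) \<Rightarrow> ('g, 'g \<times> 'a) pre_digraph" where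
  "marked_graph G A \<phi> = cayley_graph G A (\<lambda>a. \<phi> (free_gen a))"

definition proj_verts :: "('a fword \<Rightarrow> 'g) \<Rightarrow> 'a fword \<Rightarrow> 'g" where
  "proj_verts \<phi> = \<phi>"

definition proj_arcs :: "('a fword \<Rightarrow> 'g) \<Rightarrow> 'a fword \<times> 'a \<Rightarrow> 'g \<times> 'a" where
  "proj_arcs \<phi> = (\<lambda>(w, a). (\<phi> w, a))"

text \<open>
  The fibres of the projection are the orbits of the kernel acting by left translation, so
  \<^const>\<open>marked_graph\<close> is the quotient of \<^const>\<open>free_tree\<close> by the kernel:
\<close>

lemma (in marked_group) phi_hom: "\<phi> \<in> hom (free_group A) G"
  using epi by (simp add: epi_def)

lemma (in marked_group) phi_fibre:
  assumes "v \<in> carrier (free_group A)" "w \<in> carrier (free_group A)"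
  shows "\<phi> v = \<phi> w \<longleftrightarrow> (\<exists>k \<in> kernel (free_group A) G \<phi>. w = k \<otimes>\<^bsub>free_group A\<^esub> v)"
proof -
  interpret F: group "free_group A" by (rule group_free_group)
  interpret group_hom "free_group A" G \<phi> by unfold_locales (rule phi_hom)
  show ?thesis
  proof
    assume e: "\<phi> v = \<phi> w"
    let ?k = "w \<otimes>\<^bsub>free_group A\<^esub> inv\<^bsub>free_group A\<^esub> v"
    have "?k \<in> kernel (free_group A) G \<phi>" using assms e by (simp add: kernel_def)
    moreover have "w = ?k \<otimes>\<^bsub>free_group A\<^esub> v" using assms by (simp add: F.m_assoc)
    ultimately show "\<exists>k \<in> kernel (free_group A) G \<phi>. w = k \<otimes>\<^bsub>free_group A\<^esub> v" by blast
  next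
    assume "\<exists>k \<in> kernel (free_group A) G \<phi>. w = k \<otimes>\<^bsub>free_group A\<^esub> v"
    then show "\<phi> v = \<phi> w" using assms by (auto simp: kernel_def)
  qed
qed

lemma (in marked_group) proj_quotient:
  shows proj_verts_surj:
      "proj_verts \<phi> ` verts (free_tree A) = verts (marked_graph G A \<phi>)"
    and proj_arcs_surj:
      "proj_arcs \<phi> ` arcs (free_tree A) = arcs (marked_graph G A \<phi>)"
    and proj_tail: "e \<in> arcs (free_tree A) \<Longrightarrow>
      tail (marked_graph G A \<phi>) (proj_arcs \<phi> e) = proj_verts \<phi> (tail (free_tree A) e)"
    and proj_head: "e \<in> arcs (free_tree A) \<Longrightarrow>
      head (marked_graph G A \<phi>) (proj_arcs \<phi> e) = proj_verts \<phi> (head (free_tree A) e)"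
    and proj_verts_fibre: "v \<in> verts (free_tree A) \<Longrightarrow> w \<in> verts (free_tree A) \<Longrightarrow>
      proj_verts \<phi> v = proj_verts \<phi> w \<longleftrightarrow>
        (\<exists>k \<in> kernel (free_group A) G \<phi>. w = fst (left_translation (free_group A) A k) v)"
    and proj_arcs_fibre: "d \<in> arcs (free_tree A) \<Longrightarrow> e \<in> arcs (free_tree A) \<Longrightarrow>
      proj_arcs \<phi> d = proj_arcs \<phi> e \<longleftrightarrow>
        (\<exists>k \<in> kernel (free_group A) G \<phi>. e = snd (left_translation (free_group A) A k) d)"
proof -
  have im: "\<phi> ` carrier (free_group A) = carrier G" using epi by (simp add: epi_def)
  note defs = free_tree_def marked_graph_def cayley_graph_def proj_verts_def proj_arcs_def
    left_translation_def
  show "proj_verts \<phi> ` verts (free_tree A) = verts (marked_graph G A \<phi>)"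
    using im by (simp add: defs)
  show "proj_arcs \<phi> ` arcs (free_tree A) = arcs (marked_graph G A \<phi>)"
    using im by (force simp: defs)
  show "tail (marked_graph G A \<phi>) (proj_arcs \<phi> e) = proj_verts \<phi> (tail (free_tree A) e)"
    "head (marked_graph G A \<phi>) (proj_arcs \<phi> e) = proj_verts \<phi> (head (free_tree A) e)"
    if "e \<in> arcs (free_tree A)"
    using that hom_mult[OF phi_hom] free_gen_closed[of _ A] by (auto simp: defs)
  show "proj_verts \<phi> v = proj_verts \<phi> w \<longleftrightarrow>
      (\<exists>k \<in> kernel (free_group A) G \<phi>. w = fst (left_translation (free_group A) A k) v)"
    if "v \<in> verts (free_tree A)" "w \<in> verts (free_tree A)"
    using that phi_fibre[of v w] by (simp add: defs)
  show "proj_arcs \<phi> d = proj_arcs \<phi> e \<longleftrightarrow>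
      (\<exists>k \<in> kernel (free_group A) G \<phi>. e = snd (left_translation (free_group A) A k) d)"
    if "d \<in> arcs (free_tree A)" "e \<in> arcs (free_tree A)"
    using that phi_fibre[of "fst d" "fst e"] by (auto simp: defs)
qed

definition kernel_normalizer ::
    "('g, 'm) monoid_scheme \<Rightarrow> 'a set \<Rightarrow> ('a fword \<Rightarrow> 'g) \<Rightarrow>
     (('a fword \<Rightarrow> 'a fword) \<times> ('a fword \<times> 'a \<Rightarrow> 'a fword \<times> 'a)) set" where
  "kernel_normalizer G A \<phi> =
     normalizer (aut_group (free_tree A))
       (left_translation (free_group A) A ` kernel (free_group A) G \<phi>)"

text \<open>
  The unique homomorphism intertwined with the projection; it is made unique as a HOL
  function by requiring it to be \<^const>\<open>extensional\<close>.
\<close>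

definition zeta ::
    "('g, 'm) monoid_scheme \<Rightarrow> 'a set \<Rightarrow> ('a fword \<Rightarrow> 'g) \<Rightarrow>
     ('a fword \<Rightarrow> 'a fword) \<times> ('a fword \<times> 'a \<Rightarrow> 'a fword \<times> 'a) \<Rightarrow>
     ('g \<Rightarrow> 'g) \<times> ('g \<times> 'a \<Rightarrow> 'g \<times> 'a)" where
  "zeta G A \<phi> = (THE z.
     z \<in> extensional (kernel_normalizer G A \<phi>) \<and>
     z \<in> hom (aut_group (free_tree A)\<lparr>carrier := kernel_normalizer G A \<phi>\<rparr>)
             (aut_group (marked_graph G A \<phi>)) \<and>
     (\<forall>k \<in> kernel_normalizer G A \<phi>.
       (\<forall>v \<in> verts (free_tree A). proj_verts \<phi> (fst k v) = fst (z k) (proj_verts \<phi> v)) \<and>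
       (\<forall>e \<in> arcs (free_tree A). proj_arcs \<phi> (snd k e) = snd (z k) (proj_arcs \<phi> e))))"


section \<open>Bireversible automata\<close>

text \<open>The fields \<open>outp\<close> and \<open>trans\<close> are the maps \<open>\<lambda>\<close> and \<open>\<rho>\<close>.\<close>

record ('a, 'q) mealy =
  alphabet :: "'a set"
  states :: "'q set"
  outp :: "'q \<Rightarrow> 'a \<Rightarrow> 'a"
  trans :: "'q \<Rightarrow> 'a \<Rightarrow> 'q"

definition mealy_automaton :: "('a, 'q) mealy \<Rightarrow> bool" where
  "mealy_automaton M \<longleftrightarrow> finite (alphabet M) \<and> finite (states M) \<and>
     (\<forall>q \<in> states M. \<forall>a \<in> alphabet M.
        outp M q a \<in> alphabet M \<and> trans M q a \<in> states M)"

definition bireversible :: "('a, 'q) mealy \<Rightarrow> bool" where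
  "bireversible M \<longleftrightarrow> mealy_automaton M \<and>
     (\<forall>q \<in> states M. bij_betw (outp M q) (alphabet M) (alphabet M)) \<and>
     (\<forall>a \<in> alphabet M. bij_betw (\<lambda>q. trans M q a) (states M) (states M)) \<and>
     bij_betw (\<lambda>(q, a). (outp M q a, trans M q a))
       (states M \<times> alphabet M) (alphabet M \<times> states M)"

definition mealy_gens :: "('a, 'q) mealy \<Rightarrow> ('q + 'a) set" where
  "mealy_gens M = states M <+> alphabet M"

definition mealy_relators :: "('a, 'q) mealy \<Rightarrow> ('q + 'a) fword set" where
  "mealy_relators M =
     (let F = free_group (mealy_gens M) in
      {free_gen (Inl q) \<otimes>\<^bsub>F\<^esub> free_gen (Inr a) \<otimes>\<^bsub>F\<^esub>
         inv\<^bsub>F\<^esub> (free_gen (Inr (outp M q a)) \<otimes>\<^bsub>F\<^esub> free_gen (Inl (trans M q a)))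
       | q a. q \<in> states M \<and> a \<in> alphabet M})"

definition pi1 :: "('a, 'q) mealy \<Rightarrow> ('q + 'a) fword set monoid" where
  "pi1 M = presented_group (mealy_gens M) (mealy_relators M)"

definition pi1_gen :: "('a, 'q) mealy \<Rightarrow> 'q + 'a \<Rightarrow> ('q + 'a) fword set" where
  "pi1_gen M = presented_gen (mealy_gens M) (mealy_relators M)"

definition FQ :: "('a, 'q) mealy \<Rightarrow> ('q + 'a) fword set set" where
  "FQ M = generate (pi1 M) ((\<lambda>q. pi1_gen M (Inl q)) ` states M)"

text \<open>The embedding of the free group on the alphabet into \<open>pi1 M\<close>:\<close>

definition embA :: "('a, 'q) mealy \<Rightarrow> 'a fword \<Rightarrow> ('q + 'a) fword set" where
  "embA M = free_lift (pi1 M) (\<lambda>a. pi1_gen M (Inr a))"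

definition NQ :: "('a, 'q) mealy \<Rightarrow> ('q + 'a) fword set set" where
  "NQ M = (GREATEST N. N \<lhd> pi1 M \<and> N \<subseteq> FQ M)"

definition automaton_group :: "('a, 'q) mealy \<Rightarrow> ('q + 'a) fword set set set" where
  "automaton_group M = (\<lambda>g. NQ M #>\<^bsub>pi1 M\<^esub> g) ` FQ M"

definition pi1_act :: "('a, 'q) mealy \<Rightarrow> ('q + 'a) fword set \<Rightarrow> 'a fword \<Rightarrow> 'a fword" where
  "pi1_act M p v = (THE w. w \<in> carrier (free_group (alphabet M)) \<and>
     (\<exists>h \<in> FQ M. p \<otimes>\<^bsub>pi1 M\<^esub> embA M v = embA M w \<otimes>\<^bsub>pi1 M\<^esub> h))"

text \<open>
  An automorphism of the tree is determined by its vertex map, and all representatives of a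
  coset of \<open>NQ M\<close> act in the same way.
\<close>

definition psi ::
    "('a, 'q) mealy \<Rightarrow> ('q + 'a) fword set set \<Rightarrow>
     ('a fword \<Rightarrow> 'a fword) \<times> ('a fword \<times> 'a \<Rightarrow> 'a fword \<times> 'a)" where
  "psi M P = (THE k. k \<in> carrier (aut_group (free_tree (alphabet M))) \<and>
     (\<forall>p \<in> P. \<forall>v \<in> verts (free_tree (alphabet M)). fst k v = pi1_act M p v))"

definition compatible ::
    "('a, 'q) mealy \<Rightarrow> ('g, 'm) monoid_scheme \<Rightarrow> ('a fword \<Rightarrow> 'g) \<Rightarrow> bool" where
  "compatible M G \<phi> \<longleftrightarrow>
     (\<lambda>w. NQ M #>\<^bsub>pi1 M\<^esub> embA M w) ` kernel (free_group (alphabet M)) G \<phi>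
       \<lhd> (pi1 M Mod NQ M)"

text \<open>
  HOL cannot quantify over the type of states. Natural numbers suffice, since every finite
  set of states can be relabelled by natural numbers.
\<close>

definition bireversible_auts ::
    "('g, 'm) monoid_scheme \<Rightarrow> 'a set \<Rightarrow> ('a fword \<Rightarrow> 'g) \<Rightarrow>
     (('g \<Rightarrow> 'g) \<times> ('g \<times> 'a \<Rightarrow> 'g \<times> 'a)) set" where
  "bireversible_auts G A \<phi> = {f \<in> aut_fixing (marked_graph G A \<phi>) \<one>\<^bsub>G\<^esub>.
     \<exists>M :: ('a, nat) mealy. alphabet M = A \<and> bireversible M \<and> compatible M G \<phi> \<and>
       f \<in> zeta G A \<phi> ` psi M ` automaton_group M}"

end

theory Submission
  imports Defs
begin

text \<open>
  Let \<open>X\<close> be the graph of the marked group \<open>G\<close>, and write \<open>x\<close> also for the translation of \<open>X\<close> by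
  \<open>x \<in> G\<close>. The translations are simply transitive on the vertices. Hence for an automorphism
  \<open>k\<close> fixing the identity and \<open>x \<in> G\<close> there is exactly one automorphism \<open>k|x\<close> fixing the
  identity with \<open>k x = k(x) (k|x)\<close>; it is the section of \<open>k\<close> at \<open>x\<close>. The double coset \<open>G k G\<close>
  is the union of the cosets of the sections of \<open>k\<close>, on either side, and so \<open>k\<close> commensurates
  \<open>G\<close> if and only if it has finitely many sections (\<open>commensurator_iff_finite_sections\<close>). The
  theorem therefore says that an automorphism fixing the identity has finitely many sections
  if and only if a compatible bireversible automaton generates it.

  Suppose that \<open>k\<close> has finitely many sections. They are the states of an automaton: \<open>q\<close> sends
  the letter \<open>a\<close> to the label \<open>b\<close> of the image of the arc \<open>(1, a)\<close>, and moves to the section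
  \<open>r\<close> of \<open>q\<close> at \<open>\<phi> a\<close>. The defining relation \<open>q a = b r\<close> then holds in the automorphism group
  of \<open>X\<close>. It determines all four terms from two neighbouring ones, which is bireversibility
  (\<open>section_automaton_bireversible\<close>). Moving states past words with this relation shows that
  the automorphism of the tree defined by \<open>q\<close> lies over \<open>q\<close> itself, and that each \<open>q\<close>
  maps the kernel of \<open>\<phi>\<close> onto itself and is its own section along it; this gives
  compatibility (\<open>finite_sections_imp_bireversible\<close>).

  Conversely, let \<open>g\<close> be in the group generated by the states of a compatible automaton. For every
  word \<open>w\<close> there are a word \<open>w'\<close> and some \<open>h\<close> in that group with \<open>g w = w' h\<close>, and \<open>h\<close> can be
  chosen from a finite set that depends on \<open>g\<close> only (\<open>FQ_past_words\<close>). Projecting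
  this equation to \<open>X\<close> shows that the section at \<open>\<phi> w\<close> of the automorphism induced by \<open>g\<close>
  is the automorphism induced by \<open>h\<close> (\<open>finite_sections_of_generated\<close>).

  Both directions need an explicit form of the action on the tree. It is obtained by
  letting the automaton act on reduced words and extending this to the fundamental group by the
  universal property of its presentation (\<open>tree_action\<close>). An element \<open>w h\<close>, with \<open>w\<close> a word
  and \<open>h\<close> in the group generated by the states, sends the root to \<open>w\<close>; so the uniqueness
  of normal forms, on which \<open>pi1_act\<close> and \<open>psi\<close> depend, can be read off from the action.
\<close>

section \<open>Free groups and presentations\<close>

lemma carrier_free_group [simp]: "carrier (free_group S) = reduced_words S"
  by (simp add: free_group_def)

lemma one_free_group [simp]: "\<one>\<^bsub>free_group S\<^esub> = []"
  by (simp add: free_group_def)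

lemma mult_free_group:
  "v \<in> reduced_words S \<Longrightarrow> u \<otimes>\<^bsub>free_group S\<^esub> v = foldr fcons u v"
  by (simp add: free_group_def free_mult)

lemma free_group_closed [simp]:
  "u \<in> reduced_words S \<Longrightarrow> v \<in> reduced_words S \<Longrightarrow> u \<otimes>\<^bsub>free_group S\<^esub> v \<in> reduced_words S"
  "u \<in> reduced_words S \<Longrightarrow> inv\<^bsub>free_group S\<^esub> u \<in> reduced_words S"
  using group.subgroup_self[OF group_free_group, of S]
  by (auto dest: subgroup.m_closed subgroup.m_inv_closed)

lemma letter_reduced: "fst l \<in> S \<Longrightarrow> [l] \<in> reduced_words S"
  by (cases l) (simp add: reduced_words_def)

lemma fcons_reduced: "l # w \<in> reduced_words S \<Longrightarrow> fcons l w = l # w"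
  by (cases w) (auto simp: fcons_def reduced_words_def)

lemma reduced_Cons_mult:
  "l # w \<in> reduced_words S \<Longrightarrow> l # w = [l] \<otimes>\<^bsub>free_group S\<^esub> w"
  using fcons_reduced[of l w S] reduced_words_ConsD[of l w S] by (simp add: mult_free_group)

lemma inv_free_letter:
  assumes "fst l \<in> S"
  shows "inv\<^bsub>free_group S\<^esub> [l] = [inv_letter l]"
proof -
  interpret F: group "free_group S" by (rule group_free_group)
  have "[inv_letter l] \<otimes>\<^bsub>free_group S\<^esub> [l] = []"
    using letter_reduced[OF assms] by (simp add: mult_free_group fcons_def)
  then show ?thesis
    using assms by (intro F.inv_equality) (simp_all add: letter_reduced)
qed

text \<open>
  Every element is reached from the identity by left multiplication with generators and
  their inverses, so a property that survives these multiplications holds everywhere.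
\<close>

lemma free_group_induct [consumes 1, case_names one gen inv]:
  assumes "w \<in> reduced_words S" and "P []"
    and "\<And>a w. a \<in> S \<Longrightarrow> w \<in> reduced_words S \<Longrightarrow> P w \<Longrightarrow> P (free_gen a \<otimes>\<^bsub>free_group S\<^esub> w)"
    and "\<And>a w. a \<in> S \<Longrightarrow> w \<in> reduced_words S \<Longrightarrow> P w \<Longrightarrow>
           P (inv\<^bsub>free_group S\<^esub> free_gen a \<otimes>\<^bsub>free_group S\<^esub> w)"
  shows "P w"
  using assms(1)
proof (induction w)
  case (Cons l w)
  obtain a b where l: "l = (a, b)" by (cases l)
  from reduced_words_ConsD[OF Cons.prems] l have a: "a \<in> S" and w: "w \<in> reduced_words S" by auto
  have "inv\<^bsub>free_group S\<^esub> free_gen a = [(a, False)]"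
    using inv_free_letter[of "(a, True)" S] a by (simp add: free_gen_def)
  then show ?case
    using reduced_Cons_mult[OF Cons.prems] assms(3,4)[OF a w Cons.IH[OF w]] l
    by (cases b) (simp_all add: free_gen_def)
qed (rule assms(2))

lemma free_lift_unique:
  assumes "group K" "h \<in> hom (free_group S) K" "\<And>a. a \<in> S \<Longrightarrow> h (free_gen a) = f a"
    "w \<in> reduced_words S"
  shows "h w = free_lift K f w"
proof -
  interpret K: group K by fact
  interpret F: group "free_group S" by (rule group_free_group)
  interpret h: group_hom "free_group S" K h by unfold_locales fact
  have f: "f \<in> S \<rightarrow> carrier K"
    using assms(3) h.hom_closed free_gen_closed by (metis Pi_I)
  interpret l: group_hom "free_group S" K "free_lift K f"
    by unfold_locales (rule free_lift_hom[OF assms(1) f])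
  have g: "free_lift K f (free_gen a) = h (free_gen a)" if "a \<in> S" for a
    using that f assms(3) by (simp add: free_lift_gen[OF assms(1)] Pi_iff)
  show ?thesis
    using assms(4)
  proof (induction rule: free_group_induct)
    case one
    show ?case using h.hom_one by (simp add: free_lift_def)
  next
    case (gen a w)
    then show ?case
      using g[OF gen(1)] free_gen_closed[OF gen(1)] by simp
  next
    case (inv a w)
    have "h (inv\<^bsub>free_group S\<^esub> free_gen a) = free_lift K f (inv\<^bsub>free_group S\<^esub> free_gen a)"
      using g[OF inv(1)] free_gen_closed[OF inv(1)] by simp
    then show ?case
      using inv free_gen_closed[OF inv(1)] by simp
  qed
qed

lemma normal_closure_normal:
  assumes "group G" "R \<subseteq> carrier G"
  shows "normal_closure G R \<lhd> G"
proof -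
  interpret group G by fact
  have "carrier G \<lhd> G"
    by (intro normal_invI subgroup_self) auto
  then have ne: "{N. N \<lhd> G \<and> R \<subseteq> N} \<noteq> {}" using assms(2) by blast
  show ?thesis
    unfolding normal_closure_def
  proof (rule normal_invI)
    show "subgroup (\<Inter>{N. N \<lhd> G \<and> R \<subseteq> N}) G"
      by (rule subgroups_Inter[OF _ ne]) (auto dest: normal_imp_subgroup)
  qed (auto simp: normal_inv_iff)
qed

locale presentation =
  fixes S :: "'a set" and R :: "'a fword set"
  assumes relators: "R \<subseteq> reduced_words S"
begin

abbreviation "F \<equiv> free_group S"
abbreviation "N \<equiv> normal_closure F R"

lemma normal_N: "N \<lhd> F"
  using normal_closure_normal[OF group_free_group] relators by simp

sublocale N: normal N F
  by (rule normal_N)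

lemma group_presented: "group (presented_group S R)"
  unfolding presented_group_def by (rule N.factorgroup_is_group)

lemma quotient_hom: "(\<lambda>w. N #>\<^bsub>F\<^esub> w) \<in> hom F (presented_group S R)"
  unfolding presented_group_def by (rule N.r_coset_hom_Mod)

lemma quotient_surj:
  "p \<in> carrier (presented_group S R) \<Longrightarrow> \<exists>w \<in> reduced_words S. p = N #>\<^bsub>F\<^esub> w"
  by (auto simp: presented_group_def carrier_FactGroup)

lemma presented_gen_closed: "x \<in> S \<Longrightarrow> presented_gen S R x \<in> carrier (presented_group S R)"
  unfolding presented_gen_def using hom_in_carrier[OF quotient_hom free_gen_closed] .

lemma relator_trivial:
  assumes "r \<in> R" shows "N #>\<^bsub>F\<^esub> r = \<one>\<^bsub>presented_group S R\<^esub>"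
proof -
  have "r \<in> N" using assms by (auto simp: normal_closure_def)
  then show ?thesis
    by (simp add: presented_group_def N.rcos_const)
qed

lemma presented_induct [consumes 1, case_names one gen inv]:
  assumes "p \<in> carrier (presented_group S R)" and "P \<one>\<^bsub>presented_group S R\<^esub>"
    and g: "\<And>x p. x \<in> S \<Longrightarrow> p \<in> carrier (presented_group S R) \<Longrightarrow> P p \<Longrightarrow>
           P (presented_gen S R x \<otimes>\<^bsub>presented_group S R\<^esub> p)"
    and i: "\<And>x p. x \<in> S \<Longrightarrow> p \<in> carrier (presented_group S R) \<Longrightarrow> P p \<Longrightarrow>
           P (inv\<^bsub>presented_group S R\<^esub> presented_gen S R x \<otimes>\<^bsub>presented_group S R\<^esub> p)"
  shows "P p"
proof -
  interpret P: group "presented_group S R" by (rule group_presented)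
  interpret q: group_hom F "presented_group S R" "\<lambda>w. N #>\<^bsub>F\<^esub> w"
    by unfold_locales (rule quotient_hom)
  obtain w where w: "w \<in> reduced_words S" and p: "p = N #>\<^bsub>F\<^esub> w"
    using quotient_surj[OF assms(1)] by blast
  from w have "P (N #>\<^bsub>F\<^esub> w)"
  proof (induction rule: free_group_induct)
    case one
    then show ?case using assms(2) q.hom_one by simp
  next
    case (gen a w)
    then show ?case
      using g[of a "N #>\<^bsub>F\<^esub> w"] q.hom_closed[of w] q.hom_mult[of "free_gen a" w]
        free_gen_closed[of a S] by (simp add: presented_gen_def)
  next
    case (inv a w)
    then show ?case
      using i[of a "N #>\<^bsub>F\<^esub> w"] q.hom_closed[of w] q.hom_mult[of "inv\<^bsub>F\<^esub> free_gen a" w]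
        q.hom_inv[of "free_gen a"] free_gen_closed[of a S]
      by (simp add: presented_gen_def)
  qed
  then show ?thesis using p by simp
qed

text \<open>
  A map of the generators that sends the relators to the identity factors through the
  quotient: the kernel of its extension to the free group is normal, so it contains the normal
  closure of the relators.
\<close>

lemma presented_lift:
  assumes "group K" "f \<in> S \<rightarrow> carrier K" "\<And>r. r \<in> R \<Longrightarrow> free_lift K f r = \<one>\<^bsub>K\<^esub>"
  obtains h where "h \<in> hom (presented_group S R) K"
    "\<And>x. x \<in> S \<Longrightarrow> h (presented_gen S R x) = f x"
proof -
  interpret K: group K by fact
  interpret l: group_hom F K "free_lift K f"
    by unfold_locales (rule free_lift_hom[OF assms(1,2)])
  have "R \<subseteq> kernel F K (free_lift K f)"
    using assms(3) relators by (auto simp: kernel_def)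
  then have "N \<subseteq> kernel F K (free_lift K f)"
    using l.normal_kernel by (auto simp: normal_closure_def)
  from l.FactGroup_universal_kernel[OF normal_N this]
  obtain h where h: "h \<in> hom (F Mod N) K"
    "\<And>w. w \<in> carrier F \<Longrightarrow> h (N #>\<^bsub>F\<^esub> w) = free_lift K f w" by blast
  show ?thesis
  proof
    show "h \<in> hom (presented_group S R) K" using h(1) by (simp add: presented_group_def)
    show "h (presented_gen S R x) = f x" if "x \<in> S" for x
      using h(2)[OF free_gen_closed[OF that]] assms(2) that free_lift_gen[OF assms(1), of f x]
      by (auto simp: presented_gen_def)
  qed
qed

end

section \<open>Automorphisms of Cayley graphs\<close>

context wf_digraph
begin

abbreviation "Aut \<equiv> aut_group G"

lemma aut_group_closed:
  assumes "k \<in> carrier Aut"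
  shows "x \<in> verts G \<Longrightarrow> fst k x \<in> verts G" and "e \<in> arcs G \<Longrightarrow> snd k e \<in> arcs G"
    and "e \<in> arcs G \<Longrightarrow> tail G (snd k e) = fst k (tail G e)"
    and "e \<in> arcs G \<Longrightarrow> head G (snd k e) = fst k (head G e)"
  using assms by (auto simp: aut_group_def dest!: Bij_imp_funcset)

lemma aut_group_inj:
  assumes "k \<in> carrier Aut"
  shows "inj_on (fst k) (verts G)" and "inj_on (snd k) (arcs G)"
  using assms by (auto simp: aut_group_def Bij_def bij_betw_def)

lemma aut_group_surj:
  assumes "k \<in> carrier Aut"
  shows "fst k ` verts G = verts G" and "snd k ` arcs G = arcs G"
  using assms by (auto simp: aut_group_def Bij_def bij_betw_def)

lemma aut_group_mult_apply [simp]: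
  assumes "k \<in> carrier Aut" "l \<in> carrier Aut"
  shows "x \<in> verts G \<Longrightarrow> fst (k \<otimes>\<^bsub>Aut\<^esub> l) x = fst k (fst l x)"
    and "e \<in> arcs G \<Longrightarrow> snd (k \<otimes>\<^bsub>Aut\<^esub> l) e = snd k (snd l e)"
  using aut_group_mult[OF assms] by (auto simp: compose_def)

lemma aut_group_one_apply [simp]:
  shows "x \<in> verts G \<Longrightarrow> fst \<one>\<^bsub>Aut\<^esub> x = x" and "e \<in> arcs G \<Longrightarrow> snd \<one>\<^bsub>Aut\<^esub> e = e"
  by (auto simp: aut_group_def DirProd_def BijGroup_def)

lemma aut_group_eqI:
  assumes "k \<in> carrier Aut" "l \<in> carrier Aut"
    and "\<And>x. x \<in> verts G \<Longrightarrow> fst k x = fst l x" "\<And>e. e \<in> arcs G \<Longrightarrow> snd k e = snd l e"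
  shows "k = l"
proof (rule prod_eqI)
  have "fst k \<in> extensional (verts G)" "fst l \<in> extensional (verts G)"
    "snd k \<in> extensional (arcs G)" "snd l \<in> extensional (arcs G)"
    using assms(1,2) by (auto simp: aut_group_def Bij_def)
  then show "fst k = fst l" "snd k = snd l"
    using assms(3,4) by (blast intro: extensionalityI)+
qed

lemma aut_group_inv_apply:
  assumes "k \<in> carrier Aut"
  shows "x \<in> verts G \<Longrightarrow> fst (inv\<^bsub>Aut\<^esub> k) (fst k x) = x"
    and "e \<in> arcs G \<Longrightarrow> snd (inv\<^bsub>Aut\<^esub> k) (snd k e) = e"
proof -
  interpret Aut: group Aut by (rule group_aut_group[OF wf_digraph_axioms])
  have "inv\<^bsub>Aut\<^esub> k \<otimes>\<^bsub>Aut\<^esub> k = \<one>\<^bsub>Aut\<^esub>" "inv\<^bsub>Aut\<^esub> k \<in> carrier Aut" using assms by simp_all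
  then show "x \<in> verts G \<Longrightarrow> fst (inv\<^bsub>Aut\<^esub> k) (fst k x) = x"
    "e \<in> arcs G \<Longrightarrow> snd (inv\<^bsub>Aut\<^esub> k) (snd k e) = e"
    using aut_group_mult_apply[OF _ assms, of "inv\<^bsub>Aut\<^esub> k"] by auto
qed

end

lemma aut_groupI:
  assumes "bij_betw f (verts D) (verts D)" "bij_betw h (arcs D) (arcs D)"
    and "\<And>e. e \<in> arcs D \<Longrightarrow> tail D e \<in> verts D \<and> head D e \<in> verts D"
    and "\<And>e. e \<in> arcs D \<Longrightarrow> tail D (h e) = f (tail D e) \<and> head D (h e) = f (head D e)"
  shows "(restrict f (verts D), restrict h (arcs D)) \<in> carrier (aut_group D)"
  using assms by (auto simp: aut_group_def Bij_def)

locale cayley = group \<Gamma> for \<Gamma> :: "('g, 'm) monoid_scheme" (structure) +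
  fixes B :: "'b set" and s :: "'b \<Rightarrow> 'g"
  assumes gens: "s \<in> B \<rightarrow> carrier \<Gamma>"
begin

abbreviation "Cay \<equiv> cayley_graph \<Gamma> B s"
abbreviation "T \<equiv> left_translation \<Gamma> B"

lemma gen_closed [simp]: "b \<in> B \<Longrightarrow> s b \<in> carrier \<Gamma>"
  using gens by auto

lemma cayley_simps [simp]:
  "verts Cay = carrier \<Gamma>" "arcs Cay = carrier \<Gamma> \<times> B" "tail Cay e = fst e"
  "head Cay (x, b) = x \<otimes> s b"
  by (simp_all add: cayley_graph_def)

sublocale Cay: wf_digraph Cay
  by (rule wf_cayley_graph[OF is_group gens])

sublocale Aut: group "aut_group Cay"
  by (rule group_aut_group[OF Cay.wf_digraph_axioms])

lemma translation_simps [simp]: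
  "x \<in> carrier \<Gamma> \<Longrightarrow> fst (T g) x = g \<otimes> x"
  "x \<in> carrier \<Gamma> \<Longrightarrow> b \<in> B \<Longrightarrow> snd (T g) (x, b) = (g \<otimes> x, b)"
  by (simp_all add: left_translation_def)

lemma translation_closed [simp]:
  assumes g: "g \<in> carrier \<Gamma>"
  shows "T g \<in> carrier (aut_group Cay)"
proof -
  let ?f = "\<lambda>x. g \<otimes> x" and ?h = "\<lambda>(x, b). (g \<otimes> x, b)"
  let ?f' = "\<lambda>x. inv g \<otimes> x" and ?h' = "\<lambda>(x, b). (inv g \<otimes> x, b)"
  have "(restrict ?f (verts Cay), restrict ?h (arcs Cay)) \<in> carrier (aut_group Cay)"
  proof (rule aut_groupI)
    show "bij_betw ?f (verts Cay) (verts Cay)"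
      by (rule bij_betw_byWitness[where f' = ?f']) (use g in \<open>auto simp: m_assoc[symmetric]\<close>)
    show "bij_betw ?h (arcs Cay) (arcs Cay)"
      by (rule bij_betw_byWitness[where f' = ?h']) (use g in \<open>auto simp: m_assoc[symmetric]\<close>)
  qed (use g in \<open>auto simp: m_assoc\<close>)
  then show ?thesis by (simp add: left_translation_def)
qed

lemma translation_hom: "T \<in> hom \<Gamma> (aut_group Cay)"
proof (rule homI)
  fix g h assume gh: "g \<in> carrier \<Gamma>" "h \<in> carrier \<Gamma>"
  show "T (g \<otimes> h) = T g \<otimes>\<^bsub>aut_group Cay\<^esub> T h"
    by (rule Cay.aut_group_eqI) (use gh in \<open>auto simp: m_assoc\<close>)
qed simp

sublocale T: group_hom \<Gamma> "aut_group Cay" T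
  by unfold_locales (rule translation_hom)

lemma translations_subgroup: "subgroup (T ` carrier \<Gamma>) (aut_group Cay)"
  by (rule T.img_is_subgroup)

lemma stabilizer_subgroup: "subgroup (aut_fixing Cay \<one>) (aut_group Cay)"
proof (rule Aut.subgroupI)
  have "\<one>\<^bsub>aut_group Cay\<^esub> \<in> aut_fixing Cay \<one>" by (simp add: aut_fixing_def)
  then show "aut_fixing Cay \<one> \<noteq> {}" by blast
  show "inv\<^bsub>aut_group Cay\<^esub> k \<in> aut_fixing Cay \<one>" if "k \<in> aut_fixing Cay \<one>" for k
  proof -
    have k: "k \<in> carrier (aut_group Cay)" "fst k \<one> = \<one>" using that by (auto simp: aut_fixing_def)
    from Cay.aut_group_inv_apply(1)[OF k(1), of \<one>] have "fst (inv\<^bsub>aut_group Cay\<^esub> k) \<one> = \<one>"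
      unfolding k(2) by simp
    then show ?thesis using k(1) by (simp add: aut_fixing_def)
  qed
qed (auto simp: aut_fixing_def)

lemma aut_fixingD:
  "k \<in> aut_fixing Cay x \<Longrightarrow> k \<in> carrier (aut_group Cay)" "k \<in> aut_fixing Cay x \<Longrightarrow> fst k x = x"
  by (auto simp: aut_fixing_def)

text \<open>
  The image of the identity vertex determines the translation, because translations act simply
  transitively on the vertices.
\<close>

lemma translation_times_fixing_unique:
  assumes "g \<in> carrier \<Gamma>" "h \<in> carrier \<Gamma>" "k \<in> aut_fixing Cay \<one>" "l \<in> aut_fixing Cay \<one>"
    and eq: "T g \<otimes>\<^bsub>aut_group Cay\<^esub> k = T h \<otimes>\<^bsub>aut_group Cay\<^esub> l"
  shows "g = h" and "k = l"
proof -
  note kl = aut_fixingD[OF assms(3)] aut_fixingD[OF assms(4)]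
  have "fst (T g \<otimes>\<^bsub>aut_group Cay\<^esub> k) \<one> = fst (T h \<otimes>\<^bsub>aut_group Cay\<^esub> l) \<one>" using eq by simp
  then show "g = h" using assms(1,2) kl by simp
  then show "k = l" using eq Aut.l_cancel[OF _ kl(1) kl(3)] translation_closed[OF assms(1)] by simp
qed

lemma aut_fixing_head:
  assumes "k \<in> aut_fixing Cay \<one>" "b \<in> B"
  obtains c where "c \<in> B" "snd k (\<one>, b) = (\<one>, c)" "fst k (s b) = s c"
proof -
  note k = aut_fixingD[OF assms(1)]
  have e: "(\<one>, b) \<in> arcs Cay" using assms(2) by simp
  obtain x c where xc: "snd k (\<one>, b) = (x, c)" by fastforce
  from Cay.aut_group_closed(2,3)[OF k(1) e] have c: "x = \<one>" "c \<in> B"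
    unfolding xc cayley_simps using k by simp_all
  from Cay.aut_group_closed(4)[OF k(1) e] have h: "x \<otimes> s c = fst k (\<one> \<otimes> s b)"
    unfolding xc cayley_simps .
  have "fst k (s b) = s c" using h c assms(2) by (metis gen_closed l_one)
  then show thesis using that xc c by simp
qed

end

section \<open>The action of a bireversible automaton on words\<close>

definition prev_state :: "('a, 'q) mealy \<Rightarrow> 'q \<Rightarrow> 'a \<Rightarrow> 'q" where
  "prev_state M q a = (THE r. r \<in> states M \<and> trans M r a = q)"

text \<open>
  Reading an inverse letter means traversing a transition backwards: \<open>q a = b r\<close> is the
  same as \<open>r a\<inverse> = b\<inverse> q\<close>.
\<close>

fun letter_out :: "('a, 'q) mealy \<Rightarrow> 'q \<Rightarrow> 'a \<times> bool \<Rightarrow> 'a \<times> bool" where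
  "letter_out M q (a, True) = (outp M q a, True)"
| "letter_out M q (a, False) = (outp M (prev_state M q a) a, False)"

fun letter_next :: "('a, 'q) mealy \<Rightarrow> 'q \<Rightarrow> 'a \<times> bool \<Rightarrow> 'q" where
  "letter_next M q (a, True) = trans M q a"
| "letter_next M q (a, False) = prev_state M q a"

fun word_out :: "('a, 'q) mealy \<Rightarrow> 'q \<Rightarrow> 'a fword \<Rightarrow> 'a fword" where
  "word_out M q [] = []"
| "word_out M q (l # w) = letter_out M q l # word_out M (letter_next M q l) w"

fun word_next :: "('a, 'q) mealy \<Rightarrow> 'q \<Rightarrow> 'a fword \<Rightarrow> 'q" where
  "word_next M q [] = q"
| "word_next M q (l # w) = word_next M (letter_next M q l) w"

locale birev =
  fixes M :: "('a, 'q) mealy"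
  assumes birev: "bireversible M"
begin

abbreviation "A \<equiv> alphabet M"
abbreviation "Q \<equiv> states M"

lemma finite_Q: "finite Q"
  using birev by (simp add: bireversible_def mealy_automaton_def)

lemma automaton_closed [simp]:
  "q \<in> Q \<Longrightarrow> a \<in> A \<Longrightarrow> outp M q a \<in> A" "q \<in> Q \<Longrightarrow> a \<in> A \<Longrightarrow> trans M q a \<in> Q"
  using birev by (auto simp: bireversible_def mealy_automaton_def)

lemma bij_outp: "q \<in> Q \<Longrightarrow> bij_betw (outp M q) A A"
  and bij_trans: "a \<in> A \<Longrightarrow> bij_betw (\<lambda>q. trans M q a) Q Q"
  and bij_square: "bij_betw (\<lambda>(q, a). (outp M q a, trans M q a)) (Q \<times> A) (A \<times> Q)"
  using birev by (simp_all add: bireversible_def)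

lemma prev_state_trans [simp]:
  assumes "q \<in> Q" "a \<in> A" shows "prev_state M (trans M q a) a = q"
  unfolding prev_state_def
  using assms bij_trans[of a] by (auto simp: bij_betw_def inj_on_def intro!: the_equality)

lemma prev_state:
  assumes "q \<in> Q" "a \<in> A"
  shows prev_state_closed [simp]: "prev_state M q a \<in> Q"
    and trans_prev_state [simp]: "trans M (prev_state M q a) a = q"
proof -
  have "q \<in> (\<lambda>q. trans M q a) ` Q" using bij_trans[OF assms(2)] assms(1) by (simp add: bij_betw_def)
  then obtain r where "r \<in> Q" "q = trans M r a" by blast
  then show "prev_state M q a \<in> Q" "trans M (prev_state M q a) a = q" using assms(2) by simp_all
qed

lemma letter_closed [simp]:
  assumes "q \<in> Q" "fst l \<in> A"
  shows "fst (letter_out M q l) \<in> A" "letter_next M q l \<in> Q"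
  using assms by (cases l; cases "snd l"; auto)+

lemma letter_inverse [simp]:
  assumes "q \<in> Q" "fst l \<in> A"
  shows "letter_next M (letter_next M q l) (inv_letter l) = q"
    and "letter_out M (letter_next M q l) (inv_letter l) = inv_letter (letter_out M q l)"
  using assms by (cases l; cases "snd l"; auto)+

text \<open>
  On positive letters a state acts as a permutation because the automaton is invertible; on
  inverse letters this is the bijectivity of the square \<open>(q, a) \<mapsto> (\<lambda>(q, a), \<rho>(q, a))\<close>.
\<close>

lemma letter_out_inj:
  assumes "q \<in> Q" "fst l \<in> A" "fst m \<in> A" "letter_out M q l = letter_out M q m"
  shows "l = m"
proof -
  obtain a b where l: "l = (a, b)" by (cases l)
  obtain c d where m: "m = (c, d)" by (cases m)
  show ?thesis
  proof (cases b)
    case True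
    then show ?thesis
      using assms l m bij_outp[of q] by (cases d) (auto simp: bij_betw_def inj_on_def)
  next
    case False
    let ?r = "prev_state M q a" and ?t = "prev_state M q c"
    have d: "\<not> d" "outp M ?r a = outp M ?t c"
      using assms(4) l m False by (cases d; simp)+
    have "(?r, a) = (?t, c)"
      by (rule inj_onD[OF bij_betw_imp_inj_on[OF bij_square]])
         (use assms l m d in auto)
    then show ?thesis using l m False d by simp
  qed
qed

lemma letter_out_surj:
  assumes "q \<in> Q" "fst m \<in> A"
  obtains l where "fst l \<in> A" "letter_out M q l = m"
proof -
  obtain c d where m: "m = (c, d)" by (cases m)
  show ?thesis
  proof (cases d)
    case True
    have "c \<in> outp M q ` A" using bij_outp[OF assms(1)] assms(2) m by (simp add: bij_betw_def)
    then obtain a where "a \<in> A" "c = outp M q a" by blast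
    then show ?thesis using that[of "(a, True)"] m True by simp
  next
    case False
    have "(c, q) \<in> (\<lambda>(q, a). (outp M q a, trans M q a)) ` (Q \<times> A)"
      using bij_square assms m by (simp add: bij_betw_def)
    then obtain r a where "r \<in> Q" "a \<in> A" "c = outp M r a" "q = trans M r a" by auto
    then show ?thesis using that[of "(a, False)"] m False by simp
  qed
qed

lemma word_next_closed [simp]: "q \<in> Q \<Longrightarrow> set w \<subseteq> A \<times> UNIV \<Longrightarrow> word_next M q w \<in> Q"
proof (induction w arbitrary: q)
  case (Cons l w)
  then have "fst l \<in> A" by (cases l) auto
  with Cons show ?case by simp
qed simp

text \<open>
  Reading \<open>l\<close> and then its inverse returns to the old state and outputs mutually inverse letters,
  and no letter other than the inverse of \<open>l\<close> does so. Hence the automaton respects free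
  cancellation: a cancellation occurs in the output exactly where one occurs in the input.
\<close>

lemma word_fcons:
  assumes "q \<in> Q" "fst l \<in> A" "set w \<subseteq> A \<times> UNIV"
  shows "word_out M q (fcons l w) = fcons (letter_out M q l) (word_out M (letter_next M q l) w)"
    and "word_next M q (fcons l w) = word_next M (letter_next M q l) w"
proof -
  have "word_out M q (fcons l w) = fcons (letter_out M q l) (word_out M (letter_next M q l) w)
      \<and> word_next M q (fcons l w) = word_next M (letter_next M q l) w"
  proof (cases w)
    case (Cons m v)
    have m: "fst m \<in> A" using assms(3) Cons by (cases m) auto
    show ?thesis
    proof (cases "m = inv_letter l")
      case True
      then show ?thesis using Cons assms by (simp add: fcons_def)
    next
      case False
      then have "letter_out M (letter_next M q l) m \<noteq> inv_letter (letter_out M q l)"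
        using letter_out_inj[of "letter_next M q l" m "inv_letter l"] assms m by auto
      then show ?thesis using Cons False by (simp add: fcons_def)
    qed
  qed (simp add: fcons_def)
  then show "word_out M q (fcons l w) = fcons (letter_out M q l) (word_out M (letter_next M q l) w)"
    and "word_next M q (fcons l w) = word_next M (letter_next M q l) w" by auto
qed

lemma word_out_closed [simp]:
  "q \<in> Q \<Longrightarrow> w \<in> reduced_words A \<Longrightarrow> word_out M q w \<in> reduced_words A"
proof (induction w arbitrary: q)
  case (Cons l w)
  from reduced_words_ConsD[OF Cons.prems(2)] have lw: "fst l \<in> A" "w \<in> reduced_words A" by auto
  have "word_out M q (l # w) = fcons (letter_out M q l) (word_out M (letter_next M q l) w)"
    using word_fcons(1)[OF Cons.prems(1) lw(1) reduced_words_setD[OF lw(2)]]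
      fcons_reduced[OF Cons.prems(2)] by simp
  then show ?case
    using fcons_closed[OF Cons.IH[OF _ lw(2)], of "letter_next M q l" "letter_out M q l"]
      Cons.prems lw by simp
qed simp

lemma word_out_mult:
  assumes "q \<in> Q" "set w \<subseteq> A \<times> UNIV" "v \<in> reduced_words A"
  shows "word_out M q (foldr fcons w v) = foldr fcons (word_out M q w) (word_out M (word_next M q w) v)"
    and "word_next M q (foldr fcons w v) = word_next M (word_next M q w) v"
proof -
  have "word_out M q (foldr fcons w v) = foldr fcons (word_out M q w) (word_out M (word_next M q w) v)
      \<and> word_next M q (foldr fcons w v) = word_next M (word_next M q w) v"
    using assms
  proof (induction w arbitrary: q)
    case (Cons l w)
    have l: "fst l \<in> A" and w: "set w \<subseteq> A \<times> UNIV" using Cons.prems(2) by (cases l; auto)+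
    have c: "set (foldr fcons w v) \<subseteq> A \<times> UNIV"
      using foldr_fcons_closed[OF Cons.prems(3) w] by (rule reduced_words_setD)
    from Cons.IH[of "letter_next M q l"] word_fcons[OF Cons.prems(1) l c] show ?case
      using Cons.prems l w by simp
  qed simp
  then show "word_out M q (foldr fcons w v) = foldr fcons (word_out M q w) (word_out M (word_next M q w) v)"
    and "word_next M q (foldr fcons w v) = word_next M (word_next M q w) v" by auto
qed

lemma word_out_inj:
  assumes "q \<in> Q" "set w \<subseteq> A \<times> UNIV" "set v \<subseteq> A \<times> UNIV" "word_out M q w = word_out M q v"
  shows "w = v"
  using assms
proof (induction w arbitrary: q v)
  case Nil
  then show ?case by (cases v) auto
next
  case (Cons l w)
  then obtain m u where v: "v = m # u" by (cases v) auto
  have lm: "fst l \<in> A" "fst m \<in> A" using Cons.prems v by (cases l; cases m; auto)+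
  have "l = m" using letter_out_inj[OF Cons.prems(1) lm] Cons.prems(4) v by simp
  moreover have "w = u"
    using Cons.IH[of "letter_next M q l" u] Cons.prems v lm calculation by simp
  ultimately show ?case using v by simp
qed

lemma word_out_surj:
  assumes "q \<in> Q" "v \<in> reduced_words A"
  shows "\<exists>w \<in> reduced_words A. word_out M q w = v"
  using assms
proof (induction v arbitrary: q)
  case (Cons m v)
  from reduced_words_ConsD[OF Cons.prems(2)] have mv: "fst m \<in> A" "v \<in> reduced_words A" by auto
  obtain l where l: "fst l \<in> A" "letter_out M q l = m"
    using letter_out_surj[OF Cons.prems(1) mv(1)] by blast
  obtain w where w: "w \<in> reduced_words A" "word_out M (letter_next M q l) w = v"
    using Cons.IH[OF _ mv(2)] Cons.prems(1) l(1) by (metis letter_closed(2))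
  have "word_out M q (fcons l w) = m # v"
    using word_fcons(1)[OF Cons.prems(1) l(1) reduced_words_setD[OF w(1)]] l w
      fcons_reduced[OF Cons.prems(2)] by simp
  then show ?case using fcons_closed[OF w(1) l(1)] by blast
qed (auto intro!: bexI[of _ "[]"])

text \<open>
  The relations are assumed for positive letters only; solving \<open>r a = b q\<close> for \<open>q a\<inverse>\<close> gives
  them for inverse letters. The lemma serves both for the fundamental group and for the
  automorphism group of a graph whose automorphisms realise the states.
\<close>

lemma state_past_word:
  assumes "group K" and s: "s \<in> Q \<rightarrow> carrier K" and t: "t \<in> A \<rightarrow> carrier K"
    and rel: "\<And>q a. q \<in> Q \<Longrightarrow> a \<in> A \<Longrightarrow> s q \<otimes>\<^bsub>K\<^esub> t a = t (outp M q a) \<otimes>\<^bsub>K\<^esub> s (trans M q a)"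
    and "q \<in> Q" "w \<in> reduced_words A"
  shows "s q \<otimes>\<^bsub>K\<^esub> free_lift K t w = free_lift K t (word_out M q w) \<otimes>\<^bsub>K\<^esub> s (word_next M q w)"
proof -
  interpret K: group K by fact
  interpret l: group_hom "free_group A" K "free_lift K t"
    by (intro_locales; simp add: group_hom_axioms_def group_free_group group.is_monoid
          group.axioms(2) free_lift_hom[OF assms(1) t])
  note cl = l.hom_closed[simplified]
  have lift_Cons: "free_lift K t (l # w) = free_lift K t [l] \<otimes>\<^bsub>K\<^esub> free_lift K t w"
    if "l # w \<in> reduced_words A" for l w
    using reduced_Cons_mult[OF that] l.hom_mult[of "[l]" w] reduced_words_ConsD[OF that]
    by (simp add: letter_reduced)
  have letter: "s q \<otimes>\<^bsub>K\<^esub> free_lift K t [l] = free_lift K t [letter_out M q l] \<otimes>\<^bsub>K\<^esub> s (letter_next M q l)"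
    if q: "q \<in> Q" and l: "fst l \<in> A" for q l
  proof -
    obtain a b where ab: "l = (a, b)" "a \<in> A" using l by (cases l) auto
    show ?thesis
    proof (cases b)
      case True
      then show ?thesis using ab q s t rel[OF q ab(2)] by (auto simp: free_lift_def Pi_iff)
    next
      case False
      let ?r = "prev_state M q a"
      have c: "s q \<in> carrier K" "s ?r \<in> carrier K" "t a \<in> carrier K" "t (outp M ?r a) \<in> carrier K"
        using s t q ab by auto
      have "s ?r \<otimes>\<^bsub>K\<^esub> t a = t (outp M ?r a) \<otimes>\<^bsub>K\<^esub> s q"
        using rel[of ?r a] q ab by simp
      then have "inv\<^bsub>K\<^esub> t (outp M ?r a) \<otimes>\<^bsub>K\<^esub> (s ?r \<otimes>\<^bsub>K\<^esub> t a) \<otimes>\<^bsub>K\<^esub> inv\<^bsub>K\<^esub> t a = s q \<otimes>\<^bsub>K\<^esub> inv\<^bsub>K\<^esub> t a"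
        using c by (simp add: K.m_assoc[symmetric])
      then have "s q \<otimes>\<^bsub>K\<^esub> inv\<^bsub>K\<^esub> t a = inv\<^bsub>K\<^esub> t (outp M ?r a) \<otimes>\<^bsub>K\<^esub> s ?r"
        using c by (simp add: K.m_assoc)
      then show ?thesis using c ab False by (simp add: free_lift_def)
    qed
  qed
  show ?thesis
    using assms(5,6)
  proof (induction w arbitrary: q)
    case Nil
    then show ?case using s by (auto simp: free_lift_def Pi_iff)
  next
    case (Cons l w)
    from reduced_words_ConsD[OF Cons.prems(2)] have lw: "fst l \<in> A" "w \<in> reduced_words A" by auto
    let ?r = "letter_next M q l" and ?m = "letter_out M q l"
    have r: "?r \<in> Q" "fst ?m \<in> A" using Cons.prems lw by simp_all
    have red: "?m # word_out M ?r w \<in> reduced_words A"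
      using word_out_closed[OF Cons.prems] by simp
    have c: "s q \<in> carrier K" "s ?r \<in> carrier K" "s (word_next M ?r w) \<in> carrier K"
      using s Cons.prems(1) r lw reduced_words_setD[OF lw(2)] by auto
    have "s q \<otimes>\<^bsub>K\<^esub> free_lift K t (l # w) = (s q \<otimes>\<^bsub>K\<^esub> free_lift K t [l]) \<otimes>\<^bsub>K\<^esub> free_lift K t w"
      unfolding lift_Cons[OF Cons.prems(2)]
      using c(1) cl[OF lw(2)] cl[OF letter_reduced[OF lw(1)]] by (simp add: K.m_assoc)
    also have "\<dots> = free_lift K t [?m] \<otimes>\<^bsub>K\<^esub> (s ?r \<otimes>\<^bsub>K\<^esub> free_lift K t w)"
      unfolding letter[OF Cons.prems(1) lw(1)]
      using c(2) cl[OF lw(2)] cl[OF letter_reduced[OF r(2)]] by (simp add: K.m_assoc)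
    also have "\<dots> = free_lift K t [?m] \<otimes>\<^bsub>K\<^esub>
        (free_lift K t (word_out M ?r w) \<otimes>\<^bsub>K\<^esub> s (word_next M ?r w))"
      using Cons.IH[OF r(1) lw(2)] by simp
    also have "\<dots> = free_lift K t (?m # word_out M ?r w) \<otimes>\<^bsub>K\<^esub> s (word_next M ?r w)"
      unfolding lift_Cons[OF red]
      using c(3) cl[OF word_out_closed[OF r(1) lw(2)]] cl[OF letter_reduced[OF r(2)]]
      by (simp add: K.m_assoc)
    finally show ?case by simp
  qed
qed

end

section \<open>The fundamental group of an automaton and its action on the tree\<close>

lemma cayley_free_group: "cayley (free_group S) S free_gen"
  unfolding cayley_def cayley_axioms_def
  using group_free_group free_gen_closed[of _ S] by auto

lemma free_gen_reduced [simp]: "a \<in> S \<Longrightarrow> free_gen a \<in> reduced_words S"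
  using free_gen_closed[of a S] by simp

lemma free_group_times_Nil [simp]: "w \<in> reduced_words S \<Longrightarrow> w \<otimes>\<^bsub>free_group S\<^esub> [] = w"
  using group.is_monoid[OF group_free_group, of S] monoid.r_one[of "free_group S" w] by simp

text \<open>The tree has no multiple edges, so the vertex map of an automorphism determines it.\<close>

lemma tree_aut_eqI:
  assumes k: "k \<in> carrier (aut_group (free_tree S))" and l: "l \<in> carrier (aut_group (free_tree S))"
    and eq: "\<And>w. w \<in> reduced_words S \<Longrightarrow> fst k w = fst l w"
  shows "k = l"
proof -
  interpret T: cayley "free_group S" S free_gen by (rule cayley_free_group)
  note k' = k[unfolded free_tree_def] and l' = l[unfolded free_tree_def]
  show ?thesis
  proof (rule T.Cay.aut_group_eqI[OF k' l'])
    fix e assume e: "e \<in> arcs (cayley_graph (free_group S) S free_gen)"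
    obtain w a where wa: "e = (w, a)" "w \<in> reduced_words S" "a \<in> S" using e by auto
    obtain u b where kb: "snd k e = (u, b)" by fastforce
    obtain v c where lc: "snd l e = (v, c)" by fastforce
    have g: "free_gen a \<in> carrier (free_group S)" using wa(3) by simp
    have hd: "w \<otimes>\<^bsub>free_group S\<^esub> free_gen a \<in> reduced_words S"
      using T.m_closed[of w "free_gen a"] wa g by simp
    note K = T.Cay.aut_group_closed[OF k'] and L = T.Cay.aut_group_closed[OF l']
    have u: "u = fst k w" "b \<in> S" "u \<in> reduced_words S"
      using K(2,3)[OF e] unfolding kb by (auto simp: wa(1))
    have v: "v = fst l w" "c \<in> S"
      using L(2,3)[OF e] unfolding lc by (auto simp: wa(1))
    have uv: "u = v" using u v eq[OF wa(2)] by simp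
    have "u \<otimes>\<^bsub>free_group S\<^esub> free_gen b = v \<otimes>\<^bsub>free_group S\<^esub> free_gen c"
      using K(4)[OF e] L(4)[OF e] eq[OF hd] unfolding kb lc
      unfolding wa(1) T.cayley_simps by simp
    then have "(free_gen b :: 'a fword) = free_gen c"
      using u v uv T.l_cancel[of u "free_gen b" "free_gen c"] by simp
    then show "snd k e = snd l e" using kb lc uv by (simp add: free_gen_def)
  qed (use eq in simp)
qed

text \<open>
  The arc with label \<open>a\<close> at \<open>w\<close> is read by the state that \<open>q\<close> reaches after \<open>w\<close>.
\<close>

definition state_aut ::
    "('a, 'q) mealy \<Rightarrow> 'q \<Rightarrow> ('a fword \<Rightarrow> 'a fword) \<times> ('a fword \<times> 'a \<Rightarrow> 'a fword \<times> 'a)" where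
  "state_aut M q = (restrict (word_out M q) (reduced_words (alphabet M)),
     restrict (\<lambda>(w, a). (word_out M q w, outp M (word_next M q w) a))
       (reduced_words (alphabet M) \<times> alphabet M))"

context birev
begin

sublocale tree: cayley "free_group A" A free_gen
  by (rule cayley_free_group)

abbreviation "Tree \<equiv> cayley_graph (free_group A) A free_gen"
abbreviation "L \<equiv> left_translation (free_group A) A"

lemma state_aut_simps [simp]:
  "w \<in> reduced_words A \<Longrightarrow> fst (state_aut M q) w = word_out M q w"
  "w \<in> reduced_words A \<Longrightarrow> a \<in> A \<Longrightarrow>
     snd (state_aut M q) (w, a) = (word_out M q w, outp M (word_next M q w) a)"
  by (simp_all add: state_aut_def)

lemma word_out_times:
  assumes "q \<in> Q" "u \<in> reduced_words A" "v \<in> reduced_words A"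
  shows "word_out M q (u \<otimes>\<^bsub>free_group A\<^esub> v) =
      word_out M q u \<otimes>\<^bsub>free_group A\<^esub> word_out M (word_next M q u) v"
    and "word_next M q (u \<otimes>\<^bsub>free_group A\<^esub> v) = word_next M (word_next M q u) v"
  using assms word_out_mult[OF assms(1) reduced_words_setD[OF assms(2)] assms(3)]
    word_out_closed[OF word_next_closed[OF assms(1) reduced_words_setD[OF assms(2)]] assms(3)]
  by (simp_all add: mult_free_group)

lemma word_gen [simp]:
  "word_out M q (free_gen a) = free_gen (outp M q a)" "word_next M q (free_gen a) = trans M q a"
  by (simp_all add: free_gen_def)

lemma word_next_reduced [simp]: "q \<in> Q \<Longrightarrow> w \<in> reduced_words A \<Longrightarrow> word_next M q w \<in> Q"
  by (simp add: reduced_words_setD)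

lemma state_aut_closed: 
  assumes q: "q \<in> Q" shows "state_aut M q \<in> carrier (aut_group Tree)"
proof -
  let ?h = "\<lambda>(w, a). (word_out M q w, outp M (word_next M q w) a)"
  have inj: "inj_on (word_out M q) (reduced_words A)"
    using word_out_inj[OF q] by (auto simp: inj_on_def dest!: reduced_words_setD)
  have "(restrict (word_out M q) (verts Tree), restrict ?h (arcs Tree)) \<in> carrier (aut_group Tree)"
  proof (rule aut_groupI)
    show "bij_betw (word_out M q) (verts Tree) (verts Tree)"
      using inj q word_out_surj[OF q] by (force simp: bij_betw_def)
    have "?h ` (reduced_words A \<times> A) = reduced_words A \<times> A"
    proof (intro equalityI subsetI)
      fix e assume "e \<in> reduced_words A \<times> A"
      then obtain v b where e: "e = (v, b)" "v \<in> reduced_words A" "b \<in> A" by blast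
      obtain w where w: "w \<in> reduced_words A" "word_out M q w = v"
        using word_out_surj[OF q e(2)] by blast
      have "b \<in> outp M (word_next M q w) ` A"
        using bij_outp[of "word_next M q w"] q w e by (simp add: bij_betw_def)
      then show "e \<in> ?h ` (reduced_words A \<times> A)" using w e by force
    qed (use q in auto)
    moreover have "inj_on ?h (reduced_words A \<times> A)"
    proof (rule inj_onI, clarify)
      fix w a v b assume w: "w \<in> reduced_words A" "a \<in> A" "v \<in> reduced_words A" "b \<in> A"
        and eq: "word_out M q w = word_out M q v"
          "outp M (word_next M q w) a = outp M (word_next M q v) b"
      have "w = v" using inj_onD[OF inj eq(1)] w by simp
      moreover have "inj_on (outp M (word_next M q w)) A"
        using bij_outp[of "word_next M q w"] q w by (simp add: bij_betw_def)
      ultimately show "w = v \<and> a = b" using eq(2) w by (auto dest: inj_onD)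
    qed
    ultimately show "bij_betw ?h (arcs Tree) (arcs Tree)" by (simp add: bij_betw_def)
  qed (use q in \<open>auto simp: word_out_times\<close>)
  then show ?thesis by (simp add: state_aut_def)
qed

text \<open>
  The cocycle identity \<open>word_out_times\<close>, for a word \<open>u\<close> of one letter, is the defining relation
  of the fundamental group.
\<close>

lemma state_aut_relation:
  assumes "q \<in> Q" "a \<in> A"
  shows "state_aut M q \<otimes>\<^bsub>aut_group Tree\<^esub> L (free_gen a) =
    L (free_gen (outp M q a)) \<otimes>\<^bsub>aut_group Tree\<^esub> state_aut M (trans M q a)"
  using assms
  by (intro tree.Cay.aut_group_eqI tree.Aut.m_closed)
     (auto simp: state_aut_closed word_out_times)

lemma mealy_gens_iff [simp]:
  "Inl q \<in> mealy_gens M \<longleftrightarrow> q \<in> Q" "Inr a \<in> mealy_gens M \<longleftrightarrow> a \<in> A"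
  by (auto simp: mealy_gens_def)

lemma gens_reduced [simp]:
  "q \<in> Q \<Longrightarrow> free_gen (Inl q) \<in> reduced_words (mealy_gens M)"
  "a \<in> A \<Longrightarrow> free_gen (Inr a) \<in> reduced_words (mealy_gens M)"
  by simp_all

sublocale pres: presentation "mealy_gens M" "mealy_relators M"
  by unfold_locales (auto simp: mealy_relators_def Let_def)

abbreviation "\<pi> \<equiv> pi1 M"
abbreviation "S q \<equiv> pi1_gen M (Inl q)"

sublocale pi: group \<pi>
  unfolding pi1_def by (rule pres.group_presented)

lemma pi1_gen_closed [simp]:
  "q \<in> Q \<Longrightarrow> S q \<in> carrier \<pi>" "a \<in> A \<Longrightarrow> pi1_gen M (Inr a) \<in> carrier \<pi>"
  unfolding pi1_def pi1_gen_def by (rule pres.presented_gen_closed, simp)+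

lemma pi1_induct [consumes 1, case_names one state state_inv letter letter_inv]:
  assumes "p \<in> carrier \<pi>" "P \<one>\<^bsub>\<pi>\<^esub>"
    "\<And>q p. q \<in> Q \<Longrightarrow> p \<in> carrier \<pi> \<Longrightarrow> P p \<Longrightarrow> P (S q \<otimes>\<^bsub>\<pi>\<^esub> p)"
    "\<And>q p. q \<in> Q \<Longrightarrow> p \<in> carrier \<pi> \<Longrightarrow> P p \<Longrightarrow> P (inv\<^bsub>\<pi>\<^esub> S q \<otimes>\<^bsub>\<pi>\<^esub> p)"
    "\<And>a p. a \<in> A \<Longrightarrow> p \<in> carrier \<pi> \<Longrightarrow> P p \<Longrightarrow> P (pi1_gen M (Inr a) \<otimes>\<^bsub>\<pi>\<^esub> p)"
    "\<And>a p. a \<in> A \<Longrightarrow> p \<in> carrier \<pi> \<Longrightarrow> P p \<Longrightarrow> P (inv\<^bsub>\<pi>\<^esub> pi1_gen M (Inr a) \<otimes>\<^bsub>\<pi>\<^esub> p)"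
  shows "P p"
  using assms(1)[unfolded pi1_def]
proof (induction rule: pres.presented_induct)
  case one
  then show ?case using assms(2) by (simp add: pi1_def)
next
  case (gen x p)
  then show ?case
    using assms(3,5)[of _ p] by (cases x) (auto simp: mealy_gens_def pi1_def pi1_gen_def)
next
  case (inv x p)
  then show ?case
    using assms(4,6)[of _ p] by (cases x) (auto simp: mealy_gens_def pi1_def pi1_gen_def)
qed

lemma pi1_relation:
  assumes "q \<in> Q" "a \<in> A"
  shows "S q \<otimes>\<^bsub>\<pi>\<^esub> pi1_gen M (Inr a) =
    pi1_gen M (Inr (outp M q a)) \<otimes>\<^bsub>\<pi>\<^esub> S (trans M q a)"
proof -
  let ?F = "free_group (mealy_gens M)"
  let ?h = "\<lambda>w. pres.N #>\<^bsub>?F\<^esub> w"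
  interpret h: group_hom ?F \<pi> ?h
    by unfold_locales (use pres.quotient_hom in \<open>simp add: pi1_def\<close>)
  let ?x = "free_gen (Inl q) \<otimes>\<^bsub>?F\<^esub> free_gen (Inr a)"
  let ?y = "free_gen (Inr (outp M q a)) \<otimes>\<^bsub>?F\<^esub> free_gen (Inl (trans M q a))"
  have g: "free_gen (Inl q) \<in> carrier ?F" "free_gen (Inr a) \<in> carrier ?F"
    "free_gen (Inr (outp M q a)) \<in> carrier ?F" "free_gen (Inl (trans M q a)) \<in> carrier ?F"
    using assms by simp_all
  have xy: "?x \<in> carrier ?F" "?y \<in> carrier ?F" "inv\<^bsub>?F\<^esub> ?y \<in> carrier ?F" using assms by simp_all
  have "?x \<otimes>\<^bsub>?F\<^esub> inv\<^bsub>?F\<^esub> ?y \<in> mealy_relators M"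
    unfolding mealy_relators_def Let_def using assms by blast
  from pres.relator_trivial[OF this]
  have "?h (?x \<otimes>\<^bsub>?F\<^esub> inv\<^bsub>?F\<^esub> ?y) = \<one>\<^bsub>\<pi>\<^esub>" by (simp add: pi1_def)
  moreover have "?h (?x \<otimes>\<^bsub>?F\<^esub> inv\<^bsub>?F\<^esub> ?y) = ?h ?x \<otimes>\<^bsub>\<pi>\<^esub> inv\<^bsub>\<pi>\<^esub> ?h ?y"
    using h.hom_mult[OF xy(1) xy(3)] h.hom_inv[OF xy(2)] by simp
  ultimately have "?h ?x = ?h ?y"
    using h.hom_closed[OF xy(1)] h.hom_closed[OF xy(2)] pi.right_cancel[of "inv\<^bsub>\<pi>\<^esub> ?h ?y" "?h ?x" "?h ?y"]
    by simp
  then have "?h (free_gen (Inl q)) \<otimes>\<^bsub>\<pi>\<^esub> ?h (free_gen (Inr a)) =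
      ?h (free_gen (Inr (outp M q a))) \<otimes>\<^bsub>\<pi>\<^esub> ?h (free_gen (Inl (trans M q a)))"
    using h.hom_mult[OF g(1,2)] h.hom_mult[OF g(3,4)] by simp
  then show ?thesis by (simp add: pi1_gen_def presented_gen_def)
qed

lemma embA_hom: "embA M \<in> hom (free_group A) \<pi>"
  unfolding embA_def by (rule free_lift_hom[OF pi.is_group]) auto

sublocale emb: group_hom "free_group A" \<pi> "embA M"
  by unfold_locales (rule embA_hom)

lemma emb_closed [simp]: "w \<in> reduced_words A \<Longrightarrow> embA M w \<in> carrier \<pi>"
  using emb.hom_closed[of w] by simp

lemma emb_gen [simp]: "a \<in> A \<Longrightarrow> embA M (free_gen a) = pi1_gen M (Inr a)"
  unfolding embA_def by (rule free_lift_gen[OF pi.is_group, of "\<lambda>a. pi1_gen M (Inr a)"]) simp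

lemma state_emb:
  assumes "q \<in> Q" "w \<in> reduced_words A"
  shows "S q \<otimes>\<^bsub>\<pi>\<^esub> embA M w = embA M (word_out M q w) \<otimes>\<^bsub>\<pi>\<^esub> S (word_next M q w)"
  unfolding embA_def
  by (rule state_past_word[OF pi.is_group _ _ pi1_relation assms]) auto

subsection \<open>The action on the tree\<close>

lemma exists_tree_action:
  "\<exists>h. h \<in> hom \<pi> (aut_group Tree) \<and> (\<forall>q \<in> Q. h (S q) = state_aut M q) \<and>
     (\<forall>a \<in> A. h (pi1_gen M (Inr a)) = L (free_gen a))"
proof -
  let ?f = "case_sum (state_aut M) (\<lambda>a. L (free_gen a))"
  let ?F = "free_group (mealy_gens M)"
  have f: "?f \<in> mealy_gens M \<rightarrow> carrier (aut_group Tree)"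
    by (auto simp: mealy_gens_def state_aut_closed)
  interpret l: group_hom ?F "aut_group Tree" "free_lift (aut_group Tree) ?f"
    by unfold_locales (rule free_lift_hom[OF tree.Aut.is_group f])
  have gen: "free_lift (aut_group Tree) ?f (free_gen x) = ?f x" if "x \<in> mealy_gens M" for x
    using f that by (intro free_lift_gen[OF tree.Aut.is_group]) auto
  have rel: "free_lift (aut_group Tree) ?f r = \<one>\<^bsub>aut_group Tree\<^esub>" if r: "r \<in> mealy_relators M" for r
  proof -
    obtain q a where qa: "q \<in> Q" "a \<in> A" and r: "r = free_gen (Inl q) \<otimes>\<^bsub>?F\<^esub> free_gen (Inr a) \<otimes>\<^bsub>?F\<^esub>
         inv\<^bsub>?F\<^esub> (free_gen (Inr (outp M q a)) \<otimes>\<^bsub>?F\<^esub> free_gen (Inl (trans M q a)))"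
      using r by (auto simp: mealy_relators_def Let_def)
    have m: "Inl q \<in> mealy_gens M" "Inr a \<in> mealy_gens M" "Inr (outp M q a) \<in> mealy_gens M"
      "Inl (trans M q a) \<in> mealy_gens M" using qa by simp_all
    show ?thesis
      unfolding r
      using m state_aut_relation[OF qa] qa
      by (simp add: gen state_aut_closed)
  qed
  obtain h where "h \<in> hom \<pi> (aut_group Tree)"
    "\<And>x. x \<in> mealy_gens M \<Longrightarrow> h (pi1_gen M x) = ?f x"
    using pres.presented_lift[OF tree.Aut.is_group f rel] unfolding pi1_def pi1_gen_def by metis
  then show ?thesis by (intro exI[of _ h]) auto
qed

text \<open>
  The images of the generators determine the values on the carrier of \<open>\<pi>\<close>.
\<close>

definition tree_action ::
    "('q + 'a) fword set \<Rightarrow> ('a fword \<Rightarrow> 'a fword) \<times> ('a fword \<times> 'a \<Rightarrow> 'a fword \<times> 'a)" where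
  "tree_action = (SOME h. h \<in> hom \<pi> (aut_group Tree) \<and> (\<forall>q \<in> Q. h (S q) = state_aut M q) \<and>
     (\<forall>a \<in> A. h (pi1_gen M (Inr a)) = L (free_gen a)))"

lemma tree_action_hom: "tree_action \<in> hom \<pi> (aut_group Tree)"
  and tree_action_state: "q \<in> Q \<Longrightarrow> tree_action (S q) = state_aut M q"
  and tree_action_letter: "a \<in> A \<Longrightarrow> tree_action (pi1_gen M (Inr a)) = L (free_gen a)"
  using someI_ex[OF exists_tree_action] unfolding tree_action_def by auto

sublocale act: group_hom \<pi> "aut_group Tree" tree_action
  by unfold_locales (rule tree_action_hom)

lemma tree_action_emb:
  assumes "w \<in> reduced_words A" shows "tree_action (embA M w) = L w"
proof -
  let ?f = "\<lambda>a. L (free_gen a)"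
  have "(tree_action \<circ> embA M) w = free_lift (aut_group Tree) ?f w"
    by (rule free_lift_unique[OF tree.Aut.is_group hom_compose[OF embA_hom tree_action_hom] _ assms])
       (simp add: tree_action_letter)
  also have "\<dots> = L w"
    by (rule free_lift_unique[OF tree.Aut.is_group tree.translation_hom _ assms, symmetric]) simp
  finally show ?thesis by simp
qed

lemma FQ_subgroup: "subgroup (FQ M) \<pi>"
  unfolding FQ_def by (rule pi.generate_is_subgroup) auto

lemma FQ_closed: "h \<in> FQ M \<Longrightarrow> h \<in> carrier \<pi>"
  by (rule subgroup.mem_carrier[OF FQ_subgroup])

lemma state_in_FQ: "q \<in> Q \<Longrightarrow> S q \<in> FQ M"
  unfolding FQ_def by (auto intro: generate.incl)

lemma FQ_fixes_root:
  assumes "h \<in> FQ M" shows "fst (tree_action h) [] = []"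
proof -
  let ?P = "\<lambda>h. tree_action h \<in> aut_fixing Tree []"
  note sub = tree.stabilizer_subgroup[simplified]
  have s: "?P (S q)" if "q \<in> Q" for q
    using that by (auto simp: aut_fixing_def tree_action_state state_aut_closed)
  have "?P h"
    using assms unfolding FQ_def
  proof (induction rule: generate.induct)
    case one
    then show ?case using subgroup.one_closed[OF sub] by simp
  next
    case (incl h)
    then show ?case using s by auto
  next
    case (inv h)
    then obtain q where "q \<in> Q" "h = S q" by blast
    then show ?case using subgroup.m_inv_closed[OF sub s] by simp
  next
    case (eng h1 h2)
    then show ?case
      using subgroup.m_closed[OF sub eng(3,4)] FQ_closed[unfolded FQ_def] by simp
  qed
  then show ?thesis by (simp add: aut_fixing_def)
qed

text \<open>
  A state moved past a word becomes a state, the inverse of a state becomes the inverse of a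
  state, and a product becomes a product of what its factors become. So what comes out on
  the other side is confined to a finite set that does not depend on the word. The existence
  of normal forms and the finiteness of the set of sections both rest on this.
\<close>

lemma FQ_past_words:
  assumes "h \<in> FQ M"
  shows "\<exists>C. finite C \<and> C \<subseteq> FQ M \<and> (\<forall>w \<in> reduced_words A. \<exists>w' \<in> reduced_words A. \<exists>h' \<in> C.
    h \<otimes>\<^bsub>\<pi>\<^esub> embA M w = embA M w' \<otimes>\<^bsub>\<pi>\<^esub> h')"
    (is "\<exists>C. ?P h C")
  using assms unfolding FQ_def
proof (induction rule: generate.induct)
  case one
  have "?P \<one>\<^bsub>\<pi>\<^esub> {\<one>\<^bsub>\<pi>\<^esub>}" using subgroup.one_closed[OF FQ_subgroup] by auto
  then show ?case unfolding FQ_def by blast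
next
  case (incl h)
  then obtain q where q: "q \<in> Q" "h = S q" by blast
  have "?P (S q) (S ` Q)"
  proof (intro conjI ballI)
    fix w assume w: "w \<in> reduced_words A"
    show "\<exists>w' \<in> reduced_words A. \<exists>h' \<in> S ` Q. S q \<otimes>\<^bsub>\<pi>\<^esub> embA M w = embA M w' \<otimes>\<^bsub>\<pi>\<^esub> h'"
      using state_emb[OF q(1) w] q(1) w
      by (intro bexI[of _ "word_out M q w"] bexI[of _ "S (word_next M q w)"]) auto
  qed (use finite_Q state_in_FQ in auto)
  then show ?case unfolding q(2) FQ_def by blast
next
  case (inv h)
  then obtain q where q: "q \<in> Q" "h = S q" by blast
  have "?P (inv\<^bsub>\<pi>\<^esub> S q) ((\<lambda>q. inv\<^bsub>\<pi>\<^esub> S q) ` Q)"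
  proof (intro conjI ballI)
    fix w assume "w \<in> reduced_words A"
    then obtain v where v: "v \<in> reduced_words A" "w = word_out M q v"
      using word_out_surj[OF q(1)] by blast
    let ?r = "word_next M q v"
    have c: "S q \<in> carrier \<pi>" "S ?r \<in> carrier \<pi>" "embA M v \<in> carrier \<pi>" "embA M w \<in> carrier \<pi>"
      using q v by simp_all
    have "S q \<otimes>\<^bsub>\<pi>\<^esub> (embA M v \<otimes>\<^bsub>\<pi>\<^esub> inv\<^bsub>\<pi>\<^esub> S ?r) = embA M w"
      using state_emb[OF q(1) v(1)] v(2) c by (simp add: pi.m_assoc[symmetric] pi.inv_solve_right')
    then have "inv\<^bsub>\<pi>\<^esub> S q \<otimes>\<^bsub>\<pi>\<^esub> embA M w = embA M v \<otimes>\<^bsub>\<pi>\<^esub> inv\<^bsub>\<pi>\<^esub> S ?r"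
      using c by (metis pi.inv_solve_left pi.inv_closed pi.m_closed)
    then show "\<exists>w' \<in> reduced_words A. \<exists>h' \<in> (\<lambda>q. inv\<^bsub>\<pi>\<^esub> S q) ` Q.
        inv\<^bsub>\<pi>\<^esub> S q \<otimes>\<^bsub>\<pi>\<^esub> embA M w = embA M w' \<otimes>\<^bsub>\<pi>\<^esub> h'"
      using v(1) q(1) by (intro bexI[of _ v] bexI[of _ "inv\<^bsub>\<pi>\<^esub> S ?r"] imageI) simp_all
  qed (use finite_Q state_in_FQ subgroup.m_inv_closed[OF FQ_subgroup] in auto)
  then show ?case unfolding q(2) FQ_def by blast
next
  case (eng h1 h2)
  then obtain C1 C2 where C: "?P h1 C1" "?P h2 C2" unfolding FQ_def by blast
  have h: "h1 \<in> carrier \<pi>" "h2 \<in> carrier \<pi>" using eng(1,2) FQ_closed unfolding FQ_def by auto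
  have "?P (h1 \<otimes>\<^bsub>\<pi>\<^esub> h2) (C1 <#>\<^bsub>\<pi>\<^esub> C2)"
  proof (intro conjI ballI)
    fix w assume w: "w \<in> reduced_words A"
    obtain w2 d2 where 2: "w2 \<in> reduced_words A" "d2 \<in> C2" "h2 \<otimes>\<^bsub>\<pi>\<^esub> embA M w = embA M w2 \<otimes>\<^bsub>\<pi>\<^esub> d2"
      using C(2) w by blast
    obtain w1 d1 where 1: "w1 \<in> reduced_words A" "d1 \<in> C1" "h1 \<otimes>\<^bsub>\<pi>\<^esub> embA M w2 = embA M w1 \<otimes>\<^bsub>\<pi>\<^esub> d1"
      using C(1) 2(1) by blast
    have d: "d1 \<in> carrier \<pi>" "d2 \<in> carrier \<pi>" using 1 2 C FQ_closed by blast+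
    have "h1 \<otimes>\<^bsub>\<pi>\<^esub> h2 \<otimes>\<^bsub>\<pi>\<^esub> embA M w = h1 \<otimes>\<^bsub>\<pi>\<^esub> embA M w2 \<otimes>\<^bsub>\<pi>\<^esub> d2"
      using h w 2 d by (simp add: pi.m_assoc)
    also have "\<dots> = embA M w1 \<otimes>\<^bsub>\<pi>\<^esub> (d1 \<otimes>\<^bsub>\<pi>\<^esub> d2)"
      unfolding 1(3) using 1 d by (simp add: pi.m_assoc)
    finally show "\<exists>w' \<in> reduced_words A. \<exists>h' \<in> C1 <#>\<^bsub>\<pi>\<^esub> C2.
        h1 \<otimes>\<^bsub>\<pi>\<^esub> h2 \<otimes>\<^bsub>\<pi>\<^esub> embA M w = embA M w' \<otimes>\<^bsub>\<pi>\<^esub> h'"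
      using 1 2 by (auto simp: set_mult_def)
  qed (use C subgroup.m_closed[OF FQ_subgroup] in \<open>auto simp: set_mult_def subset_iff\<close>)
  then show ?case unfolding FQ_def by blast
qed

lemma normal_form:
  assumes "p \<in> carrier \<pi>"
  shows "\<exists>w \<in> reduced_words A. \<exists>h \<in> FQ M. p = embA M w \<otimes>\<^bsub>\<pi>\<^esub> h"
proof -
  let ?P = "\<lambda>p. \<exists>w \<in> reduced_words A. \<exists>h \<in> FQ M. p = embA M w \<otimes>\<^bsub>\<pi>\<^esub> h"
  have FQ: "?P (g \<otimes>\<^bsub>\<pi>\<^esub> p)" if g: "g \<in> FQ M" and p: "?P p" for g p
  proof -
    obtain w h where wh: "w \<in> reduced_words A" "h \<in> FQ M" "p = embA M w \<otimes>\<^bsub>\<pi>\<^esub> h" using p by blast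
    obtain w' h' where wh': "w' \<in> reduced_words A" "h' \<in> FQ M" "g \<otimes>\<^bsub>\<pi>\<^esub> embA M w = embA M w' \<otimes>\<^bsub>\<pi>\<^esub> h'"
      using FQ_past_words[OF g] wh(1) by blast
    have "g \<otimes>\<^bsub>\<pi>\<^esub> p = g \<otimes>\<^bsub>\<pi>\<^esub> embA M w \<otimes>\<^bsub>\<pi>\<^esub> h"
      using wh g FQ_closed by (simp add: pi.m_assoc)
    also have "\<dots> = embA M w' \<otimes>\<^bsub>\<pi>\<^esub> (h' \<otimes>\<^bsub>\<pi>\<^esub> h)"
      unfolding wh'(3) using wh wh' FQ_closed by (simp add: pi.m_assoc)
    finally show ?thesis using wh' wh subgroup.m_closed[OF FQ_subgroup] by blast
  qed
  have word: "?P (embA M u \<otimes>\<^bsub>\<pi>\<^esub> p)" if u: "u \<in> reduced_words A" and p: "?P p" for u p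
  proof -
    obtain w h where wh: "w \<in> reduced_words A" "h \<in> FQ M" "p = embA M w \<otimes>\<^bsub>\<pi>\<^esub> h" using p by blast
    have "embA M u \<otimes>\<^bsub>\<pi>\<^esub> p = embA M (u \<otimes>\<^bsub>free_group A\<^esub> w) \<otimes>\<^bsub>\<pi>\<^esub> h"
      using wh u FQ_closed by (simp add: pi.m_assoc)
    then show ?thesis using wh u free_group_closed(1) by blast
  qed
  show ?thesis
    using assms
  proof (induction rule: pi1_induct)
    case one
    show ?case
      using subgroup.one_closed[OF FQ_subgroup] emb.hom_one by (force intro!: bexI[of _ "[]"])
  next
    case (state q p)
    then show ?case using FQ state_in_FQ by blast
  next
    case (state_inv q p)
    then show ?case using FQ state_in_FQ subgroup.m_inv_closed[OF FQ_subgroup] by blast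
  next
    case (letter a p)
    then show ?case using word[of "free_gen a" p] by simp
  next
    case (letter_inv a p)
    then show ?case
      using word[of "inv\<^bsub>free_group A\<^esub> free_gen a" p] by simp
  qed
qed

text \<open>
  Acting on the root recovers the word in a normal form, which makes the normal form unique.
\<close>

lemma tree_action_root:
  assumes "w \<in> reduced_words A" "h \<in> FQ M"
  shows "fst (tree_action (embA M w \<otimes>\<^bsub>\<pi>\<^esub> h)) [] = w"
  using assms FQ_fixes_root[OF assms(2)] by (simp add: FQ_closed tree_action_emb)

lemma pi1_act_eq:
  assumes p: "p \<in> carrier \<pi>" and v: "v \<in> reduced_words A"
  shows "pi1_act M p v = fst (tree_action p) v"
proof -
  have *: "w = fst (tree_action p) v"
    if "w \<in> reduced_words A" "h \<in> FQ M" "p \<otimes>\<^bsub>\<pi>\<^esub> embA M v = embA M w \<otimes>\<^bsub>\<pi>\<^esub> h" for w h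
  proof -
    have "fst (tree_action (p \<otimes>\<^bsub>\<pi>\<^esub> embA M v)) [] = w" using that tree_action_root by simp
    then show ?thesis using p v by (simp add: tree_action_emb)
  qed
  obtain w h where "w \<in> reduced_words A" "h \<in> FQ M" "p \<otimes>\<^bsub>\<pi>\<^esub> embA M v = embA M w \<otimes>\<^bsub>\<pi>\<^esub> h"
    using normal_form[of "p \<otimes>\<^bsub>\<pi>\<^esub> embA M v"] p v by auto
  then show ?thesis
    unfolding pi1_act_def carrier_free_group using * by (intro the_equality) blast+
qed

text \<open>
  An element that acts trivially fixes the root, so the word in its normal form is empty and
  the element lies in \<open>FQ M\<close>. Conversely, a conjugate of an element \<open>n\<close> of a normal subgroup inside \<open>FQ M\<close> by a word \<open>v\<close> fixes
  the root, so \<open>n\<close> fixes \<open>v\<close>.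
\<close>

lemma NQ_eq_kernel: "NQ M = kernel \<pi> (aut_group Tree) tree_action"
  unfolding NQ_def
proof (rule Greatest_equality)
  let ?N = "kernel \<pi> (aut_group Tree) tree_action"
  have "?N \<subseteq> FQ M"
  proof
    fix p assume "p \<in> ?N"
    then have p: "p \<in> carrier \<pi>" "tree_action p = \<one>\<^bsub>aut_group Tree\<^esub>" by (auto simp: kernel_def)
    obtain w h where wh: "w \<in> reduced_words A" "h \<in> FQ M" "p = embA M w \<otimes>\<^bsub>\<pi>\<^esub> h"
      using normal_form[OF p(1)] by blast
    have "w = []" using tree_action_root[OF wh(1,2)] p(2) wh(3) by simp
    then have "embA M w = \<one>\<^bsub>\<pi>\<^esub>" using emb.hom_one by simp
    then show "p \<in> FQ M" using wh FQ_closed by simp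
  qed
  then show "?N \<lhd> \<pi> \<and> ?N \<subseteq> FQ M" using act.normal_kernel by blast
next
  fix N assume N: "N \<lhd> \<pi> \<and> N \<subseteq> FQ M"
  then interpret N: normal N \<pi> by blast
  show "N \<subseteq> kernel \<pi> (aut_group Tree) tree_action"
  proof
    fix n assume n: "n \<in> N"
    have "tree_action n = \<one>\<^bsub>aut_group Tree\<^esub>"
    proof (rule tree_aut_eqI[of _ A, unfolded free_tree_def])
      fix v assume v: "v \<in> reduced_words A"
      let ?h = "inv\<^bsub>\<pi>\<^esub> embA M v \<otimes>\<^bsub>\<pi>\<^esub> n \<otimes>\<^bsub>\<pi>\<^esub> embA M v"
      have h: "?h \<in> FQ M" using N.inv_op_closed1[of "embA M v" n] n v N by auto
      have "n \<otimes>\<^bsub>\<pi>\<^esub> embA M v = embA M v \<otimes>\<^bsub>\<pi>\<^esub> ?h"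
        using n v by (simp add: pi.m_assoc[symmetric])
      then have "fst (tree_action (n \<otimes>\<^bsub>\<pi>\<^esub> embA M v)) [] = v" using tree_action_root[OF v h] by simp
      then show "fst (tree_action n) v = fst \<one>\<^bsub>aut_group Tree\<^esub> v"
        using n v by (simp add: tree_action_emb)
    qed (use n in simp_all)
    then show "n \<in> kernel \<pi> (aut_group Tree) tree_action" using n by (simp add: kernel_def)
  qed
qed

lemma NQ_normal: "NQ M \<lhd> \<pi>"
  unfolding NQ_eq_kernel by (rule act.normal_kernel)

sublocale NQ: normal "NQ M" \<pi>
  by (rule NQ_normal)

lemma tree_action_coset:
  assumes "p \<in> carrier \<pi>" "g \<in> NQ M #>\<^bsub>\<pi>\<^esub> p"
  shows "tree_action g = tree_action p"
proof -
  obtain n where n: "n \<in> NQ M" "g = n \<otimes>\<^bsub>\<pi>\<^esub> p" using assms(2) by (auto simp: r_coset_def)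
  then have "n \<in> carrier \<pi>" "tree_action n = \<one>\<^bsub>aut_group Tree\<^esub>"
    unfolding NQ_eq_kernel kernel_def by blast+
  then show ?thesis using act.hom_mult[of n p] act.hom_closed[OF assms(1)] assms(1) n(2) by simp
qed

lemma psi_eq:
  assumes "g \<in> carrier \<pi>"
  shows "psi M (NQ M #>\<^bsub>\<pi>\<^esub> g) = tree_action g"
proof -
  have c: "p \<in> carrier \<pi>" if "p \<in> NQ M #>\<^bsub>\<pi>\<^esub> g" for p
    using that assms by (auto simp: r_coset_def)
  have g: "g \<in> NQ M #>\<^bsub>\<pi>\<^esub> g" by (rule pi.rcos_self[OF assms NQ.is_subgroup])
  show ?thesis
    unfolding psi_def
  proof (rule the_equality)
    show "tree_action g \<in> carrier (aut_group (free_tree A)) \<and>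
        (\<forall>p \<in> NQ M #>\<^bsub>\<pi>\<^esub> g. \<forall>v \<in> verts (free_tree A). fst (tree_action g) v = pi1_act M p v)"
      using c tree_action_coset[OF assms] assms by (simp add: free_tree_def pi1_act_eq)
  next
    fix k assume k: "k \<in> carrier (aut_group (free_tree A)) \<and>
        (\<forall>p \<in> NQ M #>\<^bsub>\<pi>\<^esub> g. \<forall>v \<in> verts (free_tree A). fst k v = pi1_act M p v)"
    show "k = tree_action g"
      by (rule tree_aut_eqI[of _ A]) (use k g assms in \<open>auto simp: free_tree_def pi1_act_eq\<close>)
  qed
qed

subsection \<open>Compatibility\<close>

text \<open>
  Normality is assumed modulo \<open>NQ M\<close>, which is the kernel of the action; it therefore becomes
  an exact statement about automorphisms of the tree.
\<close>

lemma compatible_conj: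
  assumes "compatible M G \<phi>" "p \<in> carrier \<pi>" "k \<in> kernel (free_group A) G \<phi>"
  shows "\<exists>k' \<in> kernel (free_group A) G \<phi>.
    tree_action p \<otimes>\<^bsub>aut_group Tree\<^esub> L k \<otimes>\<^bsub>aut_group Tree\<^esub> inv\<^bsub>aut_group Tree\<^esub> tree_action p = L k'"
proof -
  let ?K = "kernel (free_group A) G \<phi>"
  let ?c = "\<lambda>p. NQ M #>\<^bsub>\<pi>\<^esub> p"
  interpret K: normal "(\<lambda>w. ?c (embA M w)) ` ?K" "\<pi> Mod NQ M"
    using assms(1) unfolding compatible_def .
  interpret c: group_hom \<pi> "\<pi> Mod NQ M" ?c
    by (intro_locales; simp add: group_hom_axioms_def NQ.r_coset_hom_Mod)
  have k: "k \<in> reduced_words A" using assms(3) by (simp add: kernel_def)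
  let ?x = "p \<otimes>\<^bsub>\<pi>\<^esub> embA M k \<otimes>\<^bsub>\<pi>\<^esub> inv\<^bsub>\<pi>\<^esub> p"
  have "?c p \<otimes>\<^bsub>\<pi> Mod NQ M\<^esub> ?c (embA M k) \<otimes>\<^bsub>\<pi> Mod NQ M\<^esub> inv\<^bsub>\<pi> Mod NQ M\<^esub> ?c p = ?c ?x"
    using assms(2) k by (simp del: mult_FactGroup)
  moreover have "?c p \<otimes>\<^bsub>\<pi> Mod NQ M\<^esub> ?c (embA M k) \<otimes>\<^bsub>\<pi> Mod NQ M\<^esub> inv\<^bsub>\<pi> Mod NQ M\<^esub> ?c p
      \<in> (\<lambda>w. ?c (embA M w)) ` ?K"
    using K.inv_op_closed2[of "?c p" "?c (embA M k)"] c.hom_closed[OF assms(2)] assms(3) by blast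
  ultimately obtain k' where k': "k' \<in> ?K" "?c ?x = ?c (embA M k')" by auto
  have k'': "k' \<in> reduced_words A" using k'(1) by (simp add: kernel_def)
  have "?x \<in> ?c (embA M k')"
    unfolding k'(2)[symmetric] using assms(2) k by (intro pi.rcos_self NQ.is_subgroup) auto
  from tree_action_coset[OF _ this] have "tree_action ?x = L k'"
    using k'' by (simp add: tree_action_emb)
  then show ?thesis using k' assms(2) k by (auto simp: tree_action_emb)
qed

text \<open>
  By the hypotheses a state conjugates an element of the kernel of \<open>\<phi>\<close> into the kernel, since
  \<open>q k = q(k) q\<close>. The kernel is then normalised by all generators, already before
  \<open>NQ M\<close> is divided out. Surjectivity is what the inverses of the states require.
\<close>

lemma compatibleI:
  assumes normal: "kernel (free_group A) G \<phi> \<lhd> free_group A"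
    and out: "\<And>q k. q \<in> Q \<Longrightarrow> k \<in> kernel (free_group A) G \<phi> \<Longrightarrow> word_out M q k \<in> kernel (free_group A) G \<phi> \<and> word_next M q k = q"
    and surj: "\<And>q k. q \<in> Q \<Longrightarrow> k \<in> kernel (free_group A) G \<phi> \<Longrightarrow> \<exists>k' \<in> kernel (free_group A) G \<phi>. word_out M q k' = k"
  shows "compatible M G \<phi>"
proof -
  let ?K = "kernel (free_group A) G \<phi>"
  interpret K: normal ?K "free_group A" by fact
  have red: "k \<in> reduced_words A" if "k \<in> ?K" for k using that by (simp add: kernel_def)
  have step: "x \<otimes>\<^bsub>\<pi>\<^esub> p \<otimes>\<^bsub>\<pi>\<^esub> embA M k \<otimes>\<^bsub>\<pi>\<^esub> inv\<^bsub>\<pi>\<^esub> (x \<otimes>\<^bsub>\<pi>\<^esub> p) \<in> embA M ` ?K"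
    if x: "x \<in> carrier \<pi>" "\<And>k. k \<in> ?K \<Longrightarrow> x \<otimes>\<^bsub>\<pi>\<^esub> embA M k \<otimes>\<^bsub>\<pi>\<^esub> inv\<^bsub>\<pi>\<^esub> x \<in> embA M ` ?K"
      and p: "p \<in> carrier \<pi>" "p \<otimes>\<^bsub>\<pi>\<^esub> embA M k \<otimes>\<^bsub>\<pi>\<^esub> inv\<^bsub>\<pi>\<^esub> p \<in> embA M ` ?K"
      and k: "k \<in> ?K" for x p k
  proof -
    obtain k' where k': "k' \<in> ?K" "p \<otimes>\<^bsub>\<pi>\<^esub> embA M k \<otimes>\<^bsub>\<pi>\<^esub> inv\<^bsub>\<pi>\<^esub> p = embA M k'" using p(2) by blast
    have "x \<otimes>\<^bsub>\<pi>\<^esub> p \<otimes>\<^bsub>\<pi>\<^esub> embA M k \<otimes>\<^bsub>\<pi>\<^esub> inv\<^bsub>\<pi>\<^esub> (x \<otimes>\<^bsub>\<pi>\<^esub> p) =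
        x \<otimes>\<^bsub>\<pi>\<^esub> (p \<otimes>\<^bsub>\<pi>\<^esub> embA M k \<otimes>\<^bsub>\<pi>\<^esub> inv\<^bsub>\<pi>\<^esub> p) \<otimes>\<^bsub>\<pi>\<^esub> inv\<^bsub>\<pi>\<^esub> x"
      using x(1) p(1) red[OF k] by (simp add: pi.inv_mult_group pi.m_assoc)
    then show ?thesis using x(2)[OF k'(1)] k'(2) by simp
  qed
  have "embA M ` ?K \<lhd> \<pi>"
  proof (rule pi.normal_invI)
    show "subgroup (embA M ` ?K) \<pi>" by (rule emb.subgroup_img_is_subgroup[OF K.is_subgroup])
    fix p y assume "p \<in> carrier \<pi>" "y \<in> embA M ` ?K"
    then obtain k where p: "p \<in> carrier \<pi>" and k: "k \<in> ?K" "y = embA M k" by blast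
    from p k(1) have "p \<otimes>\<^bsub>\<pi>\<^esub> embA M k \<otimes>\<^bsub>\<pi>\<^esub> inv\<^bsub>\<pi>\<^esub> p \<in> embA M ` ?K"
    proof (induction rule: pi1_induct)
      case one
      then show ?case using red by simp
    next
      case (state q p)
      have "S q \<otimes>\<^bsub>\<pi>\<^esub> embA M k \<otimes>\<^bsub>\<pi>\<^esub> inv\<^bsub>\<pi>\<^esub> S q \<in> embA M ` ?K" if "k \<in> ?K" for k
      proof -
        have "S q \<otimes>\<^bsub>\<pi>\<^esub> embA M k \<otimes>\<^bsub>\<pi>\<^esub> inv\<^bsub>\<pi>\<^esub> S q = embA M (word_out M q k)"
          using state_emb[OF state(1) red[OF that]] out[OF state(1) that] red state(1)
          by (simp add: pi.m_assoc)
        then show ?thesis using out[OF state(1) that] by simp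
      qed
      then show ?case using step[of "S q" p k] state by simp
    next
      case (state_inv q p)
      have "inv\<^bsub>\<pi>\<^esub> S q \<otimes>\<^bsub>\<pi>\<^esub> embA M k \<otimes>\<^bsub>\<pi>\<^esub> inv\<^bsub>\<pi>\<^esub> (inv\<^bsub>\<pi>\<^esub> S q) \<in> embA M ` ?K" if k: "k \<in> ?K" for k
      proof -
        obtain k' where k': "k' \<in> ?K" "word_out M q k' = k" using surj[OF state_inv(1) k] by blast
        have eq: "embA M k \<otimes>\<^bsub>\<pi>\<^esub> S q = S q \<otimes>\<^bsub>\<pi>\<^esub> embA M k'"
          using state_emb[OF state_inv(1) red[OF k'(1)]] out[OF state_inv(1) k'(1)] k'(2) by simp
        have "inv\<^bsub>\<pi>\<^esub> S q \<otimes>\<^bsub>\<pi>\<^esub> embA M k \<otimes>\<^bsub>\<pi>\<^esub> inv\<^bsub>\<pi>\<^esub> (inv\<^bsub>\<pi>\<^esub> S q) =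
            inv\<^bsub>\<pi>\<^esub> S q \<otimes>\<^bsub>\<pi>\<^esub> (embA M k \<otimes>\<^bsub>\<pi>\<^esub> S q)"
          using state_inv(1) red[OF k] by (simp add: pi.m_assoc)
        also have "\<dots> = embA M k'"
          unfolding eq using state_inv(1) red[OF k'(1)] by (simp add: pi.m_assoc[symmetric])
        finally show ?thesis using k' by simp
      qed
      then show ?case using step[of "inv\<^bsub>\<pi>\<^esub> S q" p k] state_inv by simp
    next
      case (letter a p)
      have "pi1_gen M (Inr a) \<otimes>\<^bsub>\<pi>\<^esub> embA M k \<otimes>\<^bsub>\<pi>\<^esub> inv\<^bsub>\<pi>\<^esub> pi1_gen M (Inr a) \<in> embA M ` ?K"
        if "k \<in> ?K" for k
        using K.inv_op_closed2[of "free_gen a" k] that letter(1) red[OF that]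
        by (force intro!: image_eqI[of _ _ "free_gen a \<otimes>\<^bsub>free_group A\<^esub> k \<otimes>\<^bsub>free_group A\<^esub> inv\<^bsub>free_group A\<^esub> free_gen a"])
      then show ?case using step[of "pi1_gen M (Inr a)" p k] letter by simp
    next
      case (letter_inv a p)
      have "inv\<^bsub>\<pi>\<^esub> pi1_gen M (Inr a) \<otimes>\<^bsub>\<pi>\<^esub> embA M k \<otimes>\<^bsub>\<pi>\<^esub> inv\<^bsub>\<pi>\<^esub> (inv\<^bsub>\<pi>\<^esub> pi1_gen M (Inr a)) \<in> embA M ` ?K"
        if "k \<in> ?K" for k
        using K.inv_op_closed1[of "free_gen a" k] that letter_inv(1) red[OF that]
        by (force intro!: image_eqI[of _ _ "inv\<^bsub>free_group A\<^esub> free_gen a \<otimes>\<^bsub>free_group A\<^esub> k \<otimes>\<^bsub>free_group A\<^esub> free_gen a"])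
      then show ?case using step[of "inv\<^bsub>\<pi>\<^esub> pi1_gen M (Inr a)" p k] letter_inv by simp
    qed
    then show "p \<otimes>\<^bsub>\<pi>\<^esub> y \<otimes>\<^bsub>\<pi>\<^esub> inv\<^bsub>\<pi>\<^esub> p \<in> embA M ` ?K" using k(2) by simp
  qed
  then interpret E: normal "embA M ` ?K" \<pi> .
  have "(\<lambda>p. NQ M #>\<^bsub>\<pi>\<^esub> p) ` embA M ` ?K \<lhd> \<pi> Mod NQ M"
    by (rule E.surj_hom_normal_subgroup)
       (simp_all add: group_hom_def group_hom_axioms_def NQ.factorgroup_is_group NQ.r_coset_hom_Mod
          carrier_FactGroup)
  then show ?thesis by (simp add: compatible_def image_image)
qed

end

section \<open>Commensurators\<close>

lemma set_multI: "a \<in> U \<Longrightarrow> b \<in> V \<Longrightarrow> a \<otimes>\<^bsub>G\<^esub> b \<in> U <#>\<^bsub>G\<^esub> V"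
  by (auto simp: set_mult_def)

text \<open>
  Two elements of \<open>U\<close> lie in the same coset of \<open>U \<inter> L\<close> if and only if they lie in the same
  coset of \<open>L\<close>, so the index counts the cosets of \<open>L\<close> that meet \<open>U\<close>.
\<close>

lemma (in group) finite_index_Int_iff:
  assumes U: "subgroup U G" and L: "subgroup L G"
  shows "finite_index G U (U \<inter> L) \<longleftrightarrow> (\<exists>C. finite C \<and> C \<subseteq> carrier G \<and> U \<subseteq> L <#> C)"
proof -
  let ?R = "(\<lambda>u. (U \<inter> L) #> u) ` U"
  interpret U: subgroup U G by fact
  interpret L: subgroup L G by fact
  have UL: "subgroup (U \<inter> L) G" by (rule subgroups_Inter_pair[OF U L])
  have R: "rcosets\<^bsub>G\<lparr>carrier := U\<rparr>\<^esub> (U \<inter> L) = ?R"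
    by (auto simp: RCOSETS_def)
  have same: "(U \<inter> L) #> u = (U \<inter> L) #> v"
    if "u \<in> U" "v \<in> U" "L #> u = L #> v" for u v
  proof -
    have "u \<in> L #> v" using rcos_self[OF U.mem_carrier[OF that(1)] L] unfolding that(3) .
    then obtain l where l: "l \<in> L" "u = l \<otimes> v" by (auto simp: r_coset_def)
    then have "u \<otimes> inv v = l" using that U.mem_carrier L.mem_carrier by (simp add: m_assoc)
    moreover have "u \<otimes> inv v \<in> U" using that by simp
    ultimately have "l \<in> U \<inter> L" using l by simp
    then have "u \<in> (U \<inter> L) #> v" using l by (auto simp: r_coset_def)
    then show ?thesis using repr_independence[OF _ _ UL] that U.mem_carrier by metis
  qed
  show ?thesis
  proof
    assume "finite_index G U (U \<inter> L)"
    then have "finite ?R" by (simp add: finite_index_def R)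
    from finite_subset_image[OF this subset_refl]
    obtain C where C: "C \<subseteq> U" "finite C" "?R = (\<lambda>u. (U \<inter> L) #> u) ` C" by metis
    have "U \<subseteq> L <#> C"
    proof
      fix u assume u: "u \<in> U"
      then have "(U \<inter> L) #> u \<in> (\<lambda>u. (U \<inter> L) #> u) ` C" using C(3) by (metis imageI)
      then obtain c where c: "(U \<inter> L) #> u = (U \<inter> L) #> c" "c \<in> C" by (rule imageE)
      have "u \<in> (U \<inter> L) #> c"
        using rcos_self[OF U.mem_carrier[OF u] UL] unfolding c(1) .
      then obtain l where "l \<in> U \<inter> L" "u = l \<otimes> c" unfolding r_coset_def by blast
      then show "u \<in> L <#> C" using c(2) by (simp add: set_multI)
    qed
    then show "\<exists>C. finite C \<and> C \<subseteq> carrier G \<and> U \<subseteq> L <#> C"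
      using subset_trans[OF C(1) U.subset] C(2) by blast
  next
    assume "\<exists>C. finite C \<and> C \<subseteq> carrier G \<and> U \<subseteq> L <#> C"
    then obtain C where C: "finite C" "C \<subseteq> carrier G" "U \<subseteq> L <#> C" by blast
    have "L #> u \<in> (\<lambda>c. L #> c) ` C" if u: "u \<in> U" for u
    proof -
      obtain l c where lc: "l \<in> L" "c \<in> C" "u = l \<otimes> c" using C(3) u by (auto simp: set_mult_def)
      then have "u \<in> L #> c" by (auto simp: r_coset_def)
      then have "L #> c = L #> u" using repr_independence[OF _ _ L] lc(2) C(2) by blast
      then show ?thesis using lc(2) by auto
    qed
    then have "(\<lambda>u. L #> u) ` U \<subseteq> (\<lambda>c. L #> c) ` C" by blast
    then have fin: "finite ((\<lambda>u. L #> u) ` U)" using C(1) finite_subset by blast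
    let ?g = "\<lambda>D. (U \<inter> L) #> (SOME u. u \<in> U \<and> L #> u = D)"
    have "?R \<subseteq> ?g ` (\<lambda>u. L #> u) ` U"
    proof
      fix D assume "D \<in> ?R"
      then obtain u where u: "D = (U \<inter> L) #> u" "u \<in> U" by (rule imageE)
      let ?v = "SOME v. v \<in> U \<and> L #> v = L #> u"
      have "?v \<in> U \<and> L #> ?v = L #> u" by (rule someI[of _ u]) (simp add: u(2))
      then have D: "D = ?g (L #> u)" using same[of u ?v] u by simp
      show "D \<in> ?g ` (\<lambda>u. L #> u) ` U"
        by (rule image_eqI[of D ?g "L #> u"]) (rule D, rule imageI[OF u(2)])
    qed
    then have "finite ?R" by (rule finite_subset) (intro finite_imageI fin)
    then show "finite_index G U (U \<inter> L)" by (simp only: finite_index_def R)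
  qed
qed

text \<open>
  Both indices concern the conjugate of \<open>H\<close> by \<open>f\<close>. Multiplication by \<open>f\<close> or its inverse turns
  coverings by cosets of the conjugate into coverings by cosets of \<open>H\<close>: the two conditions
  say that the double cosets of \<open>inv f\<close> and of \<open>f\<close> consist of finitely many right cosets.
\<close>

lemma (in group) commensurator_iff:
  assumes H: "subgroup H G" and f: "f \<in> carrier G"
  shows "f \<in> commensurator G H \<longleftrightarrow>
    (\<exists>C. finite C \<and> C \<subseteq> carrier G \<and> (\<forall>h \<in> H. inv f \<otimes> h \<in> H <#> C)) \<and>
    (\<exists>C. finite C \<and> C \<subseteq> carrier G \<and> (\<forall>h \<in> H. f \<otimes> h \<in> H <#> C))"
proof -
  interpret H: subgroup H G by fact
  note Hc [simp] = H.mem_carrier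
  let ?H' = "f <# H #> inv f"
  have H'_iff: "x \<in> ?H' \<longleftrightarrow> x \<in> carrier G \<and> inv f \<otimes> x \<otimes> f \<in> H" for x
  proof
    assume "x \<in> ?H'"
    then obtain h where "h \<in> H" "x = f \<otimes> h \<otimes> inv f" by (auto simp: l_coset_def r_coset_def)
    moreover from this have "inv f \<otimes> x \<otimes> f = inv f \<otimes> f \<otimes> h \<otimes> (inv f \<otimes> f)"
      using f by (simp only: m_assoc Hc inv_closed m_closed)
    ultimately show "x \<in> carrier G \<and> inv f \<otimes> x \<otimes> f \<in> H" using f by simp
  next
    assume x: "x \<in> carrier G \<and> inv f \<otimes> x \<otimes> f \<in> H"
    then have "f \<otimes> (inv f \<otimes> x \<otimes> f) \<otimes> inv f = f \<otimes> inv f \<otimes> x \<otimes> (f \<otimes> inv f)"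
      using f by (simp only: m_assoc inv_closed m_closed)
    then have "x = f \<otimes> (inv f \<otimes> x \<otimes> f) \<otimes> inv f" using f x by simp
    then show "x \<in> ?H'" using x unfolding l_coset_def r_coset_def by blast
  qed
  have H': "subgroup ?H' G"
  proof (rule subgroupI)
    show "?H' \<subseteq> carrier G" using H'_iff by blast
    show "?H' \<noteq> {}" using H'_iff[of \<one>] f by auto
    fix x assume "x \<in> ?H'"
    then have x: "x \<in> carrier G" "inv f \<otimes> x \<otimes> f \<in> H" using H'_iff by auto
    have "inv (inv f \<otimes> x \<otimes> f) = inv f \<otimes> inv x \<otimes> f" using x f by (simp add: inv_mult_group m_assoc)
    then show "inv x \<in> ?H'" using H'_iff[of "inv x"] x H.m_inv_closed[OF x(2)] by simp
    fix y assume "y \<in> ?H'"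
    then have y: "y \<in> carrier G" "inv f \<otimes> y \<otimes> f \<in> H" using H'_iff by auto
    have "(inv f \<otimes> x \<otimes> f) \<otimes> (inv f \<otimes> y \<otimes> f) = inv f \<otimes> x \<otimes> (f \<otimes> inv f) \<otimes> y \<otimes> f"
      using x y f by (simp only: m_assoc inv_closed m_closed)
    also have "\<dots> = inv f \<otimes> (x \<otimes> y) \<otimes> f" using x y f by (simp add: m_assoc)
    finally show "x \<otimes> y \<in> ?H'" using H'_iff[of "x \<otimes> y"] x y H.m_closed[OF x(2) y(2)] by simp
  qed
  have 1: "finite_index G H (H \<inter> ?H') \<longleftrightarrow>
      (\<exists>C. finite C \<and> C \<subseteq> carrier G \<and> (\<forall>h \<in> H. inv f \<otimes> h \<in> H <#> C))"
    unfolding finite_index_Int_iff[OF H H']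
  proof (intro iffI; elim exE conjE)
    fix C assume C: "finite C" "C \<subseteq> carrier G" "H \<subseteq> ?H' <#> C"
    have "inv f \<otimes> h \<in> H <#> (\<lambda>c. inv f \<otimes> c) ` C" if h: "h \<in> H" for h
    proof -
      obtain x c where xc: "x \<in> ?H'" "c \<in> C" "h = x \<otimes> c" using C h by (auto simp: set_mult_def)
      have x: "x \<in> carrier G" "inv f \<otimes> x \<otimes> f \<in> H" "c \<in> carrier G" using xc C H'_iff by auto
      have "(inv f \<otimes> x \<otimes> f) \<otimes> (inv f \<otimes> c) = inv f \<otimes> x \<otimes> (f \<otimes> inv f) \<otimes> c"
        using x f by (simp only: m_assoc inv_closed m_closed)
      then have "inv f \<otimes> h = (inv f \<otimes> x \<otimes> f) \<otimes> (inv f \<otimes> c)" using x f xc by (simp add: m_assoc)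
      then show ?thesis using x xc unfolding set_mult_def by blast
    qed
    moreover have "(\<lambda>c. inv f \<otimes> c) ` C \<subseteq> carrier G" using C f by auto
    ultimately show "\<exists>C. finite C \<and> C \<subseteq> carrier G \<and> (\<forall>h \<in> H. inv f \<otimes> h \<in> H <#> C)"
      using C by blast
  next
    fix C assume C: "finite C" "C \<subseteq> carrier G" "\<forall>h \<in> H. inv f \<otimes> h \<in> H <#> C"
    have "H \<subseteq> ?H' <#> (\<lambda>c. f \<otimes> c) ` C"
    proof
      fix h assume h: "h \<in> H"
      obtain x c where xc: "x \<in> H" "c \<in> C" "inv f \<otimes> h = x \<otimes> c"
        using C h by (force simp: set_mult_def)
      have c: "c \<in> carrier G" using xc C by auto
      have "h = f \<otimes> (inv f \<otimes> h)" using h f by (simp add: m_assoc[symmetric])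
      also have "\<dots> = (f \<otimes> x \<otimes> inv f) \<otimes> (f \<otimes> c)"
        unfolding xc(3) using xc c f by (simp add: m_assoc) (simp add: m_assoc[symmetric])
      finally show "h \<in> ?H' <#> (\<lambda>c. f \<otimes> c) ` C"
        using xc unfolding set_mult_def l_coset_def r_coset_def by blast
    qed
    moreover have "(\<lambda>c. f \<otimes> c) ` C \<subseteq> carrier G" using C f by auto
    ultimately show "\<exists>C. finite C \<and> C \<subseteq> carrier G \<and> H \<subseteq> ?H' <#> C" using C by blast
  qed
  have 2: "finite_index G ?H' (H \<inter> ?H') \<longleftrightarrow>
      (\<exists>C. finite C \<and> C \<subseteq> carrier G \<and> (\<forall>h \<in> H. f \<otimes> h \<in> H <#> C))"
    unfolding finite_index_Int_iff[OF H' H, folded Int_commute[of H]]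
  proof (intro iffI; elim exE conjE)
    fix C assume C: "finite C" "C \<subseteq> carrier G" "?H' \<subseteq> H <#> C"
    have "f \<otimes> h \<in> H <#> (\<lambda>c. c \<otimes> f) ` C" if h: "h \<in> H" for h
    proof -
      have "f \<otimes> h \<otimes> inv f \<in> ?H'" using h unfolding l_coset_def r_coset_def by blast
      then obtain x c where xc: "x \<in> H" "c \<in> C" "f \<otimes> h \<otimes> inv f = x \<otimes> c"
        using C by (auto simp: set_mult_def)
      have c: "c \<in> carrier G" using xc C by auto
      have "f \<otimes> h = (f \<otimes> h \<otimes> inv f) \<otimes> f" using f h by (simp add: m_assoc)
      also have "\<dots> = x \<otimes> (c \<otimes> f)" unfolding xc(3) using xc c f by (simp add: m_assoc)
      finally show ?thesis using xc unfolding set_mult_def by blast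
    qed
    moreover have "(\<lambda>c. c \<otimes> f) ` C \<subseteq> carrier G" using C f by auto
    ultimately show "\<exists>C. finite C \<and> C \<subseteq> carrier G \<and> (\<forall>h \<in> H. f \<otimes> h \<in> H <#> C)"
      using C by blast
  next
    fix C assume C: "finite C" "C \<subseteq> carrier G" "\<forall>h \<in> H. f \<otimes> h \<in> H <#> C"
    have "?H' \<subseteq> H <#> (\<lambda>c. c \<otimes> inv f) ` C"
    proof
      fix y assume "y \<in> ?H'"
      then obtain h where h: "h \<in> H" "y = f \<otimes> h \<otimes> inv f" by (auto simp: l_coset_def r_coset_def)
      obtain x c where xc: "x \<in> H" "c \<in> C" "f \<otimes> h = x \<otimes> c"
        using C h by (force simp: set_mult_def)
      have c: "c \<in> carrier G" using xc C by auto
      have "y = x \<otimes> (c \<otimes> inv f)" unfolding h(2) xc(3) using xc c f by (simp add: m_assoc)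
      then show "y \<in> H <#> (\<lambda>c. c \<otimes> inv f) ` C" using xc unfolding set_mult_def by blast
    qed
    moreover have "(\<lambda>c. c \<otimes> inv f) ` C \<subseteq> carrier G" using C f by auto
    ultimately show "\<exists>C. finite C \<and> C \<subseteq> carrier G \<and> ?H' \<subseteq> H <#> C" using C by blast
  qed
  show ?thesis
    using f by (simp add: commensurator_def Let_def 1 2)
qed

context cayley
begin

text \<open>
  The section of \<open>k\<close> at \<open>x\<close> is what \<open>k\<close> does around the vertex \<open>x\<close>, transported back to the
  identity.
\<close>

definition section_at ::
    "('g \<Rightarrow> 'g) \<times> ('g \<times> 'b \<Rightarrow> 'g \<times> 'b) \<Rightarrow> 'g \<Rightarrow> ('g \<Rightarrow> 'g) \<times> ('g \<times> 'b \<Rightarrow> 'g \<times> 'b)" where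
  "section_at k x = inv\<^bsub>aut_group Cay\<^esub> T (fst k x) \<otimes>\<^bsub>aut_group Cay\<^esub> (k \<otimes>\<^bsub>aut_group Cay\<^esub> T x)"

abbreviation "Fix \<equiv> aut_fixing Cay \<one>"

lemma
  assumes k: "k \<in> Fix" and x: "x \<in> carrier \<Gamma>"
  shows section_at_fixing: "section_at k x \<in> Fix"
    and section_at_eq: "k \<otimes>\<^bsub>aut_group Cay\<^esub> T x = T (fst k x) \<otimes>\<^bsub>aut_group Cay\<^esub> section_at k x"
proof -
  note kc = aut_fixingD(1)[OF k]
  have kx: "fst k x \<in> carrier \<Gamma>" using Cay.aut_group_closed(1)[OF kc] x by simp
  have c: "k \<otimes>\<^bsub>aut_group Cay\<^esub> T x \<in> carrier (aut_group Cay)" using kc x by simp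
  show eq: "k \<otimes>\<^bsub>aut_group Cay\<^esub> T x = T (fst k x) \<otimes>\<^bsub>aut_group Cay\<^esub> section_at k x"
    unfolding section_at_def using translation_closed[OF kx] c
    by (simp add: Aut.m_assoc[symmetric])
  have sc: "section_at k x \<in> carrier (aut_group Cay)"
    unfolding section_at_def using translation_closed[OF kx] c by simp
  have "fst (k \<otimes>\<^bsub>aut_group Cay\<^esub> T x) \<one> = fst (T (fst k x) \<otimes>\<^bsub>aut_group Cay\<^esub> section_at k x) \<one>"
    using eq by simp
  then have "fst k x = fst k x \<otimes> fst (section_at k x) \<one>"
    using kc x sc kx Cay.aut_group_closed(1)[OF sc, of \<one>] by simp
  then have "fst (section_at k x) \<one> = \<one>"
    using kx Cay.aut_group_closed(1)[OF sc, of \<one>] by (metis cayley_simps(1) l_cancel_one one_closed)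
  then show "section_at k x \<in> Fix" using sc by (simp add: aut_fixing_def)
qed

text \<open>
  The double coset of \<open>k\<close> under the translations is the union of the translates of its
  sections. Since the translations are simply transitive, each right coset and each left coset
  contained in it has exactly one element that fixes the identity, and these elements
  are the sections in both cases. So the two indices are finite together.
\<close>

lemma commensurator_iff_finite_sections:
  assumes k: "k \<in> Fix"
  shows "k \<in> commensurator (aut_group Cay) (T ` carrier \<Gamma>) \<longleftrightarrow> finite (section_at k ` carrier \<Gamma>)"
proof -
  note kc = aut_fixingD(1)[OF k]
  let ?K = "aut_group Cay" and ?H = "T ` carrier \<Gamma>" and ?Z = "section_at k ` carrier \<Gamma>"
  have Z: "?Z \<subseteq> carrier ?K" using section_at_fixing[OF k] aut_fixingD(1) by blast
  have kx: "fst k x \<in> carrier \<Gamma>" if "x \<in> carrier \<Gamma>" for x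
    using Cay.aut_group_closed(1)[OF kc] that by simp
  show ?thesis
    unfolding Aut.commensurator_iff[OF translations_subgroup kc]
  proof
    assume "(\<exists>C. finite C \<and> C \<subseteq> carrier ?K \<and> (\<forall>h \<in> ?H. inv\<^bsub>?K\<^esub> k \<otimes>\<^bsub>?K\<^esub> h \<in> ?H <#>\<^bsub>?K\<^esub> C)) \<and>
      (\<exists>C. finite C \<and> C \<subseteq> carrier ?K \<and> (\<forall>h \<in> ?H. k \<otimes>\<^bsub>?K\<^esub> h \<in> ?H <#>\<^bsub>?K\<^esub> C))"
    then obtain C where C: "finite C" "C \<subseteq> carrier ?K"
      "\<And>x. x \<in> carrier \<Gamma> \<Longrightarrow> k \<otimes>\<^bsub>?K\<^esub> T x \<in> ?H <#>\<^bsub>?K\<^esub> C" by blast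
    have "?Z \<subseteq> (\<lambda>c. inv\<^bsub>?K\<^esub> T (fst c \<one>) \<otimes>\<^bsub>?K\<^esub> c) ` C"
    proof
      fix z assume "z \<in> ?Z"
      then obtain x where x: "x \<in> carrier \<Gamma>" "z = section_at k x" by (auto simp only: image_iff)
      obtain g c where gc: "g \<in> carrier \<Gamma>" "c \<in> C" "k \<otimes>\<^bsub>?K\<^esub> T x = T g \<otimes>\<^bsub>?K\<^esub> c"
        using C(3)[OF x(1)] by (auto simp: set_mult_def)
      have cc: "c \<in> carrier ?K" using gc C by blast
      have z: "z \<in> Fix" using section_at_fixing[OF k x(1)] x(2) by simp
      let ?y = "inv g \<otimes> fst k x"
      have "c = inv\<^bsub>?K\<^esub> T g \<otimes>\<^bsub>?K\<^esub> (T g \<otimes>\<^bsub>?K\<^esub> c)"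
        using cc gc(1) by (simp add: Aut.m_assoc[symmetric])
      also have "\<dots> = inv\<^bsub>?K\<^esub> T g \<otimes>\<^bsub>?K\<^esub> (T (fst k x) \<otimes>\<^bsub>?K\<^esub> z)"
        using gc(3) section_at_eq[OF k x(1)] x(2) by simp
      also have "\<dots> = T ?y \<otimes>\<^bsub>?K\<^esub> z"
        using gc(1) kx[OF x(1)] aut_fixingD(1)[OF z] by (simp add: Aut.m_assoc)
      finally have c: "c = T ?y \<otimes>\<^bsub>?K\<^esub> z" .
      have y: "?y \<in> carrier \<Gamma>" using gc(1) kx[OF x(1)] by simp
      have "fst c \<one> = ?y" using c y aut_fixingD[OF z] by simp
      then have "inv\<^bsub>?K\<^esub> T (fst c \<one>) \<otimes>\<^bsub>?K\<^esub> c = inv\<^bsub>?K\<^esub> T ?y \<otimes>\<^bsub>?K\<^esub> (T ?y \<otimes>\<^bsub>?K\<^esub> z)"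
        using c by simp
      also have "\<dots> = z"
        using translation_closed[OF y] aut_fixingD(1)[OF z] by (simp add: Aut.m_assoc[symmetric] del: T.hom_mult)
      finally show "z \<in> (\<lambda>c. inv\<^bsub>?K\<^esub> T (fst c \<one>) \<otimes>\<^bsub>?K\<^esub> c) ` C" using gc(2) by force
    qed
    then show "finite ?Z" using C(1) finite_subset by blast
  next
    assume fin: "finite ?Z"
    have right: "k \<otimes>\<^bsub>?K\<^esub> h \<in> ?H <#>\<^bsub>?K\<^esub> ?Z" if "h \<in> ?H" for h
    proof -
      from that obtain x where x: "h = T x" "x \<in> carrier \<Gamma>" by (rule imageE)
      show ?thesis
        unfolding x(1) section_at_eq[OF k x(2)] using x(2) kx[OF x(2)] by (intro set_multI imageI)
    qed
    have left: "inv\<^bsub>?K\<^esub> k \<otimes>\<^bsub>?K\<^esub> h \<in> ?H <#>\<^bsub>?K\<^esub> (\<lambda>z. inv\<^bsub>?K\<^esub> z) ` ?Z" if "h \<in> ?H" for h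
    proof -
      from that obtain y where y: "h = T y" "y \<in> carrier \<Gamma>" by (rule imageE)
      \<comment> \<open>Inverting \<open>k x = y z\<close>, with \<open>z\<close> the section at \<open>x\<close>, gives \<open>k\<inverse> y = x z\<inverse>\<close>.\<close>
      obtain x where x: "x \<in> carrier \<Gamma>" "y = fst k x"
        using Cay.aut_group_surj(1)[OF kc] y(2) by (auto simp: image_iff)
      let ?z = "section_at k x"
      have z: "?z \<in> carrier ?K" using Z x(1) by blast
      have ky: "T y \<in> carrier ?K" using y(2) by simp
      have "k \<otimes>\<^bsub>?K\<^esub> (T x \<otimes>\<^bsub>?K\<^esub> inv\<^bsub>?K\<^esub> ?z) = (k \<otimes>\<^bsub>?K\<^esub> T x) \<otimes>\<^bsub>?K\<^esub> inv\<^bsub>?K\<^esub> ?z"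
        using kc x(1) z by (simp add: Aut.m_assoc)
      also have "\<dots> = T y"
        unfolding section_at_eq[OF k x(1)] x(2)[symmetric] using ky z by (simp add: Aut.m_assoc)
      finally have "inv\<^bsub>?K\<^esub> k \<otimes>\<^bsub>?K\<^esub> T y = inv\<^bsub>?K\<^esub> k \<otimes>\<^bsub>?K\<^esub> (k \<otimes>\<^bsub>?K\<^esub> (T x \<otimes>\<^bsub>?K\<^esub> inv\<^bsub>?K\<^esub> ?z))" by simp
      also have "\<dots> = T x \<otimes>\<^bsub>?K\<^esub> inv\<^bsub>?K\<^esub> ?z"
        using kc x(1) z by (simp add: Aut.m_assoc[symmetric])
      finally show ?thesis unfolding y(1) using x(1) by (simp only:) (intro set_multI imageI)
    qed
    show "(\<exists>C. finite C \<and> C \<subseteq> carrier ?K \<and> (\<forall>h \<in> ?H. inv\<^bsub>?K\<^esub> k \<otimes>\<^bsub>?K\<^esub> h \<in> ?H <#>\<^bsub>?K\<^esub> C)) \<and>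
      (\<exists>C. finite C \<and> C \<subseteq> carrier ?K \<and> (\<forall>h \<in> ?H. k \<otimes>\<^bsub>?K\<^esub> h \<in> ?H <#>\<^bsub>?K\<^esub> C))"
    proof (intro conjI)
      show "\<exists>C. finite C \<and> C \<subseteq> carrier ?K \<and> (\<forall>h \<in> ?H. inv\<^bsub>?K\<^esub> k \<otimes>\<^bsub>?K\<^esub> h \<in> ?H <#>\<^bsub>?K\<^esub> C)"
        using fin Z left by (intro exI[of _ "(\<lambda>z. inv\<^bsub>?K\<^esub> z) ` ?Z"]) auto
      show "\<exists>C. finite C \<and> C \<subseteq> carrier ?K \<and> (\<forall>h \<in> ?H. k \<otimes>\<^bsub>?K\<^esub> h \<in> ?H <#>\<^bsub>?K\<^esub> C)"
        using fin Z right by (intro exI[of _ ?Z]) blast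
    qed
  qed
qed

lemma section_at_section:
  assumes k: "k \<in> Fix" and x: "x \<in> carrier \<Gamma>" and y: "y \<in> carrier \<Gamma>"
  shows "section_at (section_at k x) y = section_at k (x \<otimes> y)"
proof -
  let ?K = "aut_group Cay" and ?l = "section_at k x"
  note kc = aut_fixingD(1)[OF k]
  have l: "?l \<in> Fix" by (rule section_at_fixing[OF k x])
  note lc = aut_fixingD(1)[OF l]
  note lyF = section_at_fixing[OF l y]
  note lyc = aut_fixingD(1)[OF lyF]
  have xy: "x \<otimes> y \<in> carrier \<Gamma>" using x y by simp
  have cl: "fst k x \<in> carrier \<Gamma>" "fst ?l y \<in> carrier \<Gamma>" "fst k (x \<otimes> y) \<in> carrier \<Gamma>"
    using Cay.aut_group_closed(1)[OF kc] Cay.aut_group_closed(1)[OF lc] x y by simp_all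
  have "T (fst k (x \<otimes> y)) \<otimes>\<^bsub>?K\<^esub> section_at k (x \<otimes> y) = k \<otimes>\<^bsub>?K\<^esub> T x \<otimes>\<^bsub>?K\<^esub> T y"
    unfolding section_at_eq[OF k xy, symmetric] using kc x y by (simp add: Aut.m_assoc)
  also have "\<dots> = T (fst k x) \<otimes>\<^bsub>?K\<^esub> (?l \<otimes>\<^bsub>?K\<^esub> T y)"
    unfolding section_at_eq[OF k x] using lc y cl by (simp add: Aut.m_assoc)
  also have "\<dots> = T (fst k x \<otimes> fst ?l y) \<otimes>\<^bsub>?K\<^esub> section_at ?l y"
    unfolding section_at_eq[OF l y] using lyc cl by (simp add: Aut.m_assoc)
  finally show ?thesis
    by (rule translation_times_fixing_unique(2)[OF cl(3) m_closed[OF cl(1,2)]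
          section_at_fixing[OF k xy] lyF, symmetric])
qed

end

section \<open>Descending along the covering\<close>

context marked_group
begin

sublocale graph: cayley G A "\<lambda>a. \<phi> (free_gen a)"
  unfolding cayley_def cayley_axioms_def
  using is_group hom_in_carrier[OF phi_hom free_gen_closed[of _ A]] by auto

sublocale tree: cayley "free_group A" A free_gen
  by (rule cayley_free_group)

sublocale phi: group_hom "free_group A" G \<phi>
  by unfold_locales (rule phi_hom)

abbreviation "Graph \<equiv> cayley_graph G A (\<lambda>a. \<phi> (free_gen a))"
abbreviation "Tree \<equiv> cayley_graph (free_group A) A free_gen"
abbreviation "L \<equiv> left_translation (free_group A) A"
abbreviation "T \<equiv> left_translation G A"
abbreviation "Ker \<equiv> kernel (free_group A) G \<phi>"
abbreviation "N\<phi> \<equiv> kernel_normalizer G A \<phi>"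

lemma phi_closed [simp]: "w \<in> reduced_words A \<Longrightarrow> \<phi> w \<in> carrier G"
  using phi.hom_closed[of w] by simp

lemma phi_surj:
  assumes "x \<in> carrier G" obtains w where "w \<in> reduced_words A" "\<phi> w = x"
proof -
  have "x \<in> \<phi> ` reduced_words A" using assms epi by (simp add: epi_def)
  then show thesis using that by (metis imageE)
qed

definition induces ::
    "('a fword \<Rightarrow> 'a fword) \<times> ('a fword \<times> 'a \<Rightarrow> 'a fword \<times> 'a) \<Rightarrow>
     ('g \<Rightarrow> 'g) \<times> ('g \<times> 'a \<Rightarrow> 'g \<times> 'a) \<Rightarrow> bool" where
  "induces k f \<longleftrightarrow> (\<forall>w \<in> reduced_words A. \<phi> (fst k w) = fst f (\<phi> w)) \<and>
     (\<forall>w \<in> reduced_words A. \<forall>a \<in> A. proj_arcs \<phi> (snd k (w, a)) = snd f (\<phi> w, a))"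

lemma induces_unique:
  assumes "induces k f" "induces k f'" "f \<in> carrier (aut_group Graph)" "f' \<in> carrier (aut_group Graph)"
  shows "f = f'"
proof (rule graph.Cay.aut_group_eqI[OF assms(3,4)])
  fix x assume "x \<in> verts Graph"
  then obtain w where "w \<in> reduced_words A" "\<phi> w = x" using phi_surj by auto
  then show "fst f x = fst f' x" using assms(1,2) by (auto simp: induces_def)
next
  fix e assume "e \<in> arcs Graph"
  then obtain x a where e: "e = (x, a)" "x \<in> carrier G" "a \<in> A" by auto
  obtain w where w: "w \<in> reduced_words A" "\<phi> w = x" using phi_surj e(2) by blast
  show "snd f e = snd f' e"
    using assms(1,2) w e(3) unfolding e(1) induces_def by metis
qed

lemma induces_mult:
  assumes "induces k f" "induces k' f'"
    and c: "k \<in> carrier (aut_group Tree)" "k' \<in> carrier (aut_group Tree)"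
      "f \<in> carrier (aut_group Graph)" "f' \<in> carrier (aut_group Graph)"
  shows "induces (k \<otimes>\<^bsub>aut_group Tree\<^esub> k') (f \<otimes>\<^bsub>aut_group Graph\<^esub> f')"
  unfolding induces_def
proof (intro conjI ballI)
  fix w assume w: "w \<in> reduced_words A"
  have kw: "fst k' w \<in> reduced_words A"
    using tree.Cay.aut_group_closed(1)[OF c(2)] w by simp
  have fw: "fst f' (\<phi> w) = \<phi> (fst k' w)" using assms(2) w by (simp add: induces_def)
  show "\<phi> (fst (k \<otimes>\<^bsub>aut_group Tree\<^esub> k') w) = fst (f \<otimes>\<^bsub>aut_group Graph\<^esub> f') (\<phi> w)"
    using w kw c fw assms(1) by (simp add: induces_def)
  fix a assume a: "a \<in> A"
  obtain v b where vb: "snd k' (w, a) = (v, b)" by fastforce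
  have v: "v \<in> reduced_words A" "b \<in> A"
    using tree.Cay.aut_group_closed(2)[OF c(2), of "(w, a)"] w a vb by auto
  have "proj_arcs \<phi> (snd k' (w, a)) = snd f' (\<phi> w, a)"
    using assms(2) w a unfolding induces_def by blast
  then have fwa: "snd f' (\<phi> w, a) = (\<phi> v, b)" unfolding vb by (simp add: proj_arcs_def)
  show "proj_arcs \<phi> (snd (k \<otimes>\<^bsub>aut_group Tree\<^esub> k') (w, a)) = snd (f \<otimes>\<^bsub>aut_group Graph\<^esub> f') (\<phi> w, a)"
    using w a v c fwa vb assms(1) by (simp add: induces_def)
qed

lemma induces_translation:
  "w \<in> reduced_words A \<Longrightarrow> induces (L w) (T (\<phi> w))"
  by (auto simp: induces_def proj_arcs_def)

lemma Ker_closed: "k \<in> Ker \<Longrightarrow> k \<in> reduced_words A"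
  by (simp add: kernel_def)

lemma Ker_translations: "L ` Ker \<subseteq> carrier (aut_group Tree)"
  using Ker_closed by auto

lemma kernel_normalizer_subgroup: "subgroup N\<phi> (aut_group Tree)"
  unfolding kernel_normalizer_def free_tree_def
  by (rule tree.Aut.normalizer_imp_subgroup[OF Ker_translations])

lemma kernel_normalizer_closed: "k \<in> N\<phi> \<Longrightarrow> k \<in> carrier (aut_group Tree)"
  by (rule subgroup.mem_carrier[OF kernel_normalizer_subgroup])

lemma kernel_normalizer_iff:
  "k \<in> N\<phi> \<longleftrightarrow> k \<in> carrier (aut_group Tree) \<and>
     k <#\<^bsub>aut_group Tree\<^esub> L ` Ker #>\<^bsub>aut_group Tree\<^esub> inv\<^bsub>aut_group Tree\<^esub> k = L ` Ker"
  unfolding kernel_normalizer_def free_tree_def normalizer_def stabilizer_def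
  using Ker_translations by simp

lemma kernel_normalizerD:
  assumes "k \<in> N\<phi>" "n \<in> Ker"
  obtains n' where "n' \<in> Ker" "k \<otimes>\<^bsub>aut_group Tree\<^esub> L n = L n' \<otimes>\<^bsub>aut_group Tree\<^esub> k"
proof -
  note c = kernel_normalizer_closed[OF assms(1)] Ker_closed[OF assms(2)]
  have "k \<otimes>\<^bsub>aut_group Tree\<^esub> L n \<otimes>\<^bsub>aut_group Tree\<^esub> inv\<^bsub>aut_group Tree\<^esub> k \<in>
      k <#\<^bsub>aut_group Tree\<^esub> L ` Ker #>\<^bsub>aut_group Tree\<^esub> inv\<^bsub>aut_group Tree\<^esub> k"
    using assms(2) by (auto simp: l_coset_def r_coset_def)
  also have "\<dots> = L ` Ker" using assms(1) kernel_normalizer_iff by blast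
  finally obtain n' where n': "k \<otimes>\<^bsub>aut_group Tree\<^esub> L n \<otimes>\<^bsub>aut_group Tree\<^esub> inv\<^bsub>aut_group Tree\<^esub> k = L n'"
    "n' \<in> Ker" by (rule imageE)
  have "L n' \<otimes>\<^bsub>aut_group Tree\<^esub> k = k \<otimes>\<^bsub>aut_group Tree\<^esub> L n"
    unfolding n'(1)[symmetric] using c by (simp add: tree.Aut.m_assoc)
  then show ?thesis using that n'(2) by simp
qed

lemma kernel_normalizerI:
  assumes k: "k \<in> carrier (aut_group Tree)"
    and 1: "\<And>n. n \<in> Ker \<Longrightarrow> \<exists>n' \<in> Ker.
      k \<otimes>\<^bsub>aut_group Tree\<^esub> L n \<otimes>\<^bsub>aut_group Tree\<^esub> inv\<^bsub>aut_group Tree\<^esub> k = L n'"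
    and 2: "\<And>n. n \<in> Ker \<Longrightarrow> \<exists>n' \<in> Ker.
      inv\<^bsub>aut_group Tree\<^esub> k \<otimes>\<^bsub>aut_group Tree\<^esub> L n \<otimes>\<^bsub>aut_group Tree\<^esub> k = L n'"
  shows "k \<in> N\<phi>"
proof -
  let ?K = "aut_group Tree"
  have "k <#\<^bsub>?K\<^esub> L ` Ker #>\<^bsub>?K\<^esub> inv\<^bsub>?K\<^esub> k = L ` Ker"
  proof (intro equalityI subsetI)
    fix y assume "y \<in> k <#\<^bsub>?K\<^esub> L ` Ker #>\<^bsub>?K\<^esub> inv\<^bsub>?K\<^esub> k"
    then obtain n where "n \<in> Ker" "y = k \<otimes>\<^bsub>?K\<^esub> L n \<otimes>\<^bsub>?K\<^esub> inv\<^bsub>?K\<^esub> k"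
      by (auto simp: l_coset_def r_coset_def)
    then show "y \<in> L ` Ker" using 1[of n] by auto
  next
    fix y assume "y \<in> L ` Ker"
    then obtain n where n: "y = L n" "n \<in> Ker" by (rule imageE)
    obtain n' where n': "n' \<in> Ker" "inv\<^bsub>?K\<^esub> k \<otimes>\<^bsub>?K\<^esub> L n \<otimes>\<^bsub>?K\<^esub> k = L n'" using 2[OF n(2)] by blast
    have "k \<otimes>\<^bsub>?K\<^esub> L n' \<otimes>\<^bsub>?K\<^esub> inv\<^bsub>?K\<^esub> k = (k \<otimes>\<^bsub>?K\<^esub> inv\<^bsub>?K\<^esub> k) \<otimes>\<^bsub>?K\<^esub> L n \<otimes>\<^bsub>?K\<^esub> (k \<otimes>\<^bsub>?K\<^esub> inv\<^bsub>?K\<^esub> k)"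
      unfolding n'(2)[symmetric] using k Ker_closed[OF n(2)]
      by (simp only: tree.Aut.m_assoc tree.Aut.m_closed tree.Aut.inv_closed tree.translation_closed
            carrier_free_group)
    then have "y = k \<otimes>\<^bsub>?K\<^esub> L n' \<otimes>\<^bsub>?K\<^esub> inv\<^bsub>?K\<^esub> k"
      unfolding n(1) using k Ker_closed[OF n(2)] by simp
    then show "y \<in> k <#\<^bsub>?K\<^esub> L ` Ker #>\<^bsub>?K\<^esub> inv\<^bsub>?K\<^esub> k"
      using n'(1) by (auto simp: l_coset_def r_coset_def)
  qed
  then show ?thesis using k kernel_normalizer_iff by blast
qed

text \<open>
  An element of the normaliser permutes the orbits of the kernel, which are the fibres of
  the covering, so it acts on representatives of the fibres.
\<close>

lemma kernel_normalizer_fibres: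
  assumes k: "k \<in> N\<phi>" and v: "v \<in> reduced_words A" and w: "w \<in> reduced_words A" and eq: "\<phi> v = \<phi> w"
  shows "\<phi> (fst k v) = \<phi> (fst k w)"
    and "a \<in> A \<Longrightarrow> proj_arcs \<phi> (snd k (v, a)) = proj_arcs \<phi> (snd k (w, a))"
proof -
  note kc = kernel_normalizer_closed[OF k]
  obtain n where n: "n \<in> Ker" "w = n \<otimes>\<^bsub>free_group A\<^esub> v"
    using phi_fibre[of v w] v w eq by auto
  obtain n' where n': "n' \<in> Ker" "k \<otimes>\<^bsub>aut_group Tree\<^esub> L n = L n' \<otimes>\<^bsub>aut_group Tree\<^esub> k"
    using kernel_normalizerD[OF k n(1)] by blast
  note red = Ker_closed[OF n(1)] Ker_closed[OF n'(1)]
  have ker: "\<phi> (n' \<otimes>\<^bsub>free_group A\<^esub> u) = \<phi> u" if "u \<in> reduced_words A" for u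
    using n'(1) that by (simp add: kernel_def)
  have kv: "fst k v \<in> reduced_words A" using tree.Cay.aut_group_closed(1)[OF kc] v by simp
  have "fst (k \<otimes>\<^bsub>aut_group Tree\<^esub> L n) v = fst k w" using kc red v n(2) by simp
  moreover have "fst (L n' \<otimes>\<^bsub>aut_group Tree\<^esub> k) v = n' \<otimes>\<^bsub>free_group A\<^esub> fst k v" using kc red v kv by simp
  ultimately have "fst k w = n' \<otimes>\<^bsub>free_group A\<^esub> fst k v" using n'(2) by simp
  then show "\<phi> (fst k v) = \<phi> (fst k w)" using ker[OF kv] by simp
  show "proj_arcs \<phi> (snd k (v, a)) = proj_arcs \<phi> (snd k (w, a))" if a: "a \<in> A"
  proof -
    obtain u b where ub: "snd k (v, a) = (u, b)" by fastforce
    have u: "u \<in> reduced_words A" "b \<in> A"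
      using tree.Cay.aut_group_closed(2)[OF kc, of "(v, a)"] v a ub by auto
    have "snd (k \<otimes>\<^bsub>aut_group Tree\<^esub> L n) (v, a) = snd k (w, a)" using kc red v a n(2) by simp
    moreover have "snd (L n' \<otimes>\<^bsub>aut_group Tree\<^esub> k) (v, a) = (n' \<otimes>\<^bsub>free_group A\<^esub> u, b)"
      using kc red v a u ub by simp
    ultimately have "snd k (w, a) = (n' \<otimes>\<^bsub>free_group A\<^esub> u, b)" using n'(2) by simp
    then show ?thesis using ker[OF u(1)] ub by (simp add: proj_arcs_def)
  qed
qed

text \<open>
  The induced maps are defined through chosen representatives. They are bijective because the
  inverse of \<open>k\<close> also normalises the kernel and induces the inverse maps.
\<close>

lemma exists_induced:
  assumes k: "k \<in> N\<phi>"
  shows "\<exists>f \<in> carrier (aut_group Graph). induces k f"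
proof -
  define rep where "rep x = (SOME w. w \<in> reduced_words A \<and> \<phi> w = x)" for x
  have rep: "rep x \<in> reduced_words A" "\<phi> (rep x) = x" if "x \<in> carrier G" for x
    using someI_ex[of "\<lambda>w. w \<in> reduced_words A \<and> \<phi> w = x"] phi_surj[OF that]
    unfolding rep_def by blast+
  define V where "V k x = \<phi> (fst k (rep x))" for k :: "('a fword \<Rightarrow> 'a fword) \<times> ('a fword \<times> 'a \<Rightarrow> 'a fword \<times> 'a)" and x
  define E where "E k e = proj_arcs \<phi> (snd k (rep (fst e), snd e))"
    for k :: "('a fword \<Rightarrow> 'a fword) \<times> ('a fword \<times> 'a \<Rightarrow> 'a fword \<times> 'a)" and e
  have V: "V k (\<phi> w) = \<phi> (fst k w)" if "k \<in> N\<phi>" "w \<in> reduced_words A" for k w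
    unfolding V_def
    by (rule kernel_normalizer_fibres(1)[OF that(1) rep(1) that(2) rep(2)]) (use that in simp_all)
  have E: "E k (\<phi> w, a) = proj_arcs \<phi> (snd k (w, a))"
    if "k \<in> N\<phi>" "w \<in> reduced_words A" "a \<in> A" for k w a
    unfolding E_def fst_conv snd_conv
    by (rule kernel_normalizer_fibres(2)[OF that(1) rep(1) that(2) rep(2) that(3)]) (use that in simp_all)
  let ?i = "\<lambda>k. inv\<^bsub>aut_group Tree\<^esub> k"
  have inv: "?i k \<in> N\<phi>" "?i (?i k) = k" if "k \<in> N\<phi>" for k
    using subgroup.m_inv_closed[OF kernel_normalizer_subgroup that]
      tree.Aut.inv_inv[OF kernel_normalizer_closed[OF that]] by auto
  have Vi: "V (?i k) (V k x) = x" "V k x \<in> carrier G" if k: "k \<in> N\<phi>" and x: "x \<in> carrier G" for k x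
  proof -
    note kc = kernel_normalizer_closed[OF k]
    obtain w where w: "w \<in> reduced_words A" "\<phi> w = x" using phi_surj[OF x] by blast
    have kw: "fst k w \<in> reduced_words A" using tree.Cay.aut_group_closed(1)[OF kc] w by simp
    have "V (?i k) (V k x) = \<phi> (fst (?i k) (fst k w))"
      using V[OF k w(1)] V[OF inv(1)[OF k] kw] w(2) by simp
    then show "V (?i k) (V k x) = x" using tree.Cay.aut_group_inv_apply(1)[OF kc, of w] w by simp
    show "V k x \<in> carrier G" using V[OF k w(1)] kw w(2) by simp
  qed
  have Ei: "E (?i k) (E k e) = e" "E k e \<in> carrier G \<times> A" "fst (E k e) = V k (fst e)"
      "head Graph (E k e) = V k (head Graph e)"
    if k: "k \<in> N\<phi>" and e: "e \<in> carrier G \<times> A" for k e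
  proof -
    note kc = kernel_normalizer_closed[OF k]
    obtain x a where xa: "e = (x, a)" "x \<in> carrier G" "a \<in> A" using e by blast
    obtain w where w: "w \<in> reduced_words A" "\<phi> w = x" using phi_surj[OF xa(2)] by blast
    obtain u b where ub: "snd k (w, a) = (u, b)" by fastforce
    have wa: "(w, a) \<in> arcs Tree" using w xa by simp
    note cl = tree.Cay.aut_group_closed(2-4)[OF kc wa, unfolded ub]
    have u: "u \<in> reduced_words A" "b \<in> A" "u = fst k w"
      using cl(1,2) by auto
    have h: "u \<otimes>\<^bsub>free_group A\<^esub> free_gen b = fst k (w \<otimes>\<^bsub>free_group A\<^esub> free_gen a)"
      using cl(3) unfolding tree.cayley_simps .
    have Ek: "E k e = (\<phi> u, b)"
      using E[OF k w(1) xa(3)] w(2) xa(1) ub by (simp add: proj_arcs_def)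
    have "E (?i k) (E k e) = proj_arcs \<phi> (snd (?i k) (u, b))"
      unfolding Ek by (rule E[OF inv(1)[OF k] u(1,2)])
    also have "snd (?i k) (u, b) = (w, a)"
      using tree.Cay.aut_group_inv_apply(2)[OF kc wa] unfolding ub .
    finally show "E (?i k) (E k e) = e" using w xa by (simp add: proj_arcs_def)
    show "E k e \<in> carrier G \<times> A" using Ek u by simp
    show "fst (E k e) = V k (fst e)" using Ek u(3) V[OF k w(1)] w(2) xa(1) by simp
    have "head Graph (E k e) = \<phi> (u \<otimes>\<^bsub>free_group A\<^esub> free_gen b)" using Ek u by simp
    also have "\<dots> = V k (\<phi> (w \<otimes>\<^bsub>free_group A\<^esub> free_gen a))"
      unfolding h using V[OF k, of "w \<otimes>\<^bsub>free_group A\<^esub> free_gen a"] w xa by simp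
    also have "\<phi> (w \<otimes>\<^bsub>free_group A\<^esub> free_gen a) = head Graph e" using w xa by simp
    finally show "head Graph (E k e) = V k (head Graph e)" .
  qed
  let ?f = "(restrict (V k) (verts Graph), restrict (E k) (arcs Graph))"
  have "?f \<in> carrier (aut_group Graph)"
  proof (rule aut_groupI)
    show "bij_betw (V k) (verts Graph) (verts Graph)"
      by (rule bij_betw_byWitness[where f' = "V (?i k)"])
         (use Vi[OF k] Vi[OF inv(1)[OF k]] inv(2)[OF k] in auto)
    show "bij_betw (E k) (arcs Graph) (arcs Graph)"
    proof (rule bij_betw_byWitness[where f' = "E (?i k)"])
      show "\<forall>e \<in> arcs Graph. E (?i k) (E k e) = e" using Ei(1)[OF k] by simp
      show "\<forall>e \<in> arcs Graph. E k (E (?i k) e) = e"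
        using Ei(1)[OF inv(1)[OF k]] unfolding inv(2)[OF k] by simp
      show "E k ` arcs Graph \<subseteq> arcs Graph" using Ei(2)[OF k] unfolding graph.cayley_simps by blast
      show "E (?i k) ` arcs Graph \<subseteq> arcs Graph"
        using Ei(2)[OF inv(1)[OF k]] unfolding graph.cayley_simps by blast
    qed
    fix e assume "e \<in> arcs Graph"
    then show "tail Graph (E k e) = V k (tail Graph e) \<and> head Graph (E k e) = V k (head Graph e)"
      using Ei(3,4)[OF k, of e] by simp
  qed auto
  moreover have "induces k ?f"
    using V[OF k] E[OF k] by (simp add: induces_def)
  ultimately show ?thesis by blast
qed

text \<open>
  Each \<open>k\<close> induces exactly one automorphism, so the intertwining condition alone fixes the values of
  \<open>zeta\<close>, and it is multiplicative because \<open>induces\<close> is. Being extensional, \<open>zeta\<close> is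
  then unique as a function.
\<close>

lemma zeta_induces:
  assumes "k \<in> N\<phi>"
  shows zeta_closed: "zeta G A \<phi> k \<in> carrier (aut_group Graph)"
    and induces_zeta: "induces k (zeta G A \<phi> k)"
proof -
  let ?P = "\<lambda>z. z \<in> extensional N\<phi> \<and>
     z \<in> hom (aut_group (free_tree A)\<lparr>carrier := N\<phi>\<rparr>) (aut_group (marked_graph G A \<phi>)) \<and>
     (\<forall>k \<in> N\<phi>.
       (\<forall>v \<in> verts (free_tree A). proj_verts \<phi> (fst k v) = fst (z k) (proj_verts \<phi> v)) \<and>
       (\<forall>e \<in> arcs (free_tree A). proj_arcs \<phi> (snd k e) = snd (z k) (proj_arcs \<phi> e)))"
  let ?Q = "\<lambda>z. z \<in> extensional N\<phi> \<and>
     z \<in> hom (aut_group Tree\<lparr>carrier := N\<phi>\<rparr>) (aut_group Graph) \<and> (\<forall>k \<in> N\<phi>. induces k (z k))"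
  have PQ: "?P = ?Q"
    by (intro ext) (auto simp: induces_def free_tree_def marked_graph_def proj_verts_def proj_arcs_def)
  define z where "z = restrict (\<lambda>k. SOME f. f \<in> carrier (aut_group Graph) \<and> induces k f) N\<phi>"
  have z: "z k \<in> carrier (aut_group Graph)" "induces k (z k)" if "k \<in> N\<phi>" for k
    using someI_ex[of "\<lambda>f. f \<in> carrier (aut_group Graph) \<and> induces k f"] exists_induced[OF that] that
    unfolding z_def by auto
  have "?Q z"
  proof (intro conjI ballI homI)
    show "z \<in> extensional N\<phi>" by (simp add: z_def)
    fix k l assume "k \<in> carrier (aut_group Tree\<lparr>carrier := N\<phi>\<rparr>)" "l \<in> carrier (aut_group Tree\<lparr>carrier := N\<phi>\<rparr>)"
    then have kl: "k \<in> N\<phi>" "l \<in> N\<phi>" by simp_all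
    have m: "k \<otimes>\<^bsub>aut_group Tree\<^esub> l \<in> N\<phi>" by (rule subgroup.m_closed[OF kernel_normalizer_subgroup kl])
    have "induces (k \<otimes>\<^bsub>aut_group Tree\<^esub> l) (z k \<otimes>\<^bsub>aut_group Graph\<^esub> z l)"
      using induces_mult z kl kernel_normalizer_closed by blast
    then have "z (k \<otimes>\<^bsub>aut_group Tree\<^esub> l) = z k \<otimes>\<^bsub>aut_group Graph\<^esub> z l"
      using induces_unique[OF z(2)[OF m] _ z(1)[OF m]] z(1) kl by blast
    then show "z (k \<otimes>\<^bsub>aut_group Tree\<lparr>carrier := N\<phi>\<rparr>\<^esub> l) = z k \<otimes>\<^bsub>aut_group Graph\<^esub> z l" by simp
  qed (use z in simp_all)
  moreover have "y = z" if "?Q y" for y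
  proof (rule extensionalityI[of y N\<phi> z])
    fix k assume k: "k \<in> N\<phi>"
    have "y k \<in> carrier (aut_group Graph)" using that k by (auto simp: hom_def)
    then show "y k = z k" using induces_unique z k that by blast
  qed (use that z_def in auto)
  ultimately have "zeta G A \<phi> = z"
    unfolding zeta_def PQ by (intro the_equality)
  then show "zeta G A \<phi> k \<in> carrier (aut_group Graph)" "induces k (zeta G A \<phi> k)"
    using z[OF assms] by simp_all
qed

lemma zeta_eqI:
  "k \<in> N\<phi> \<Longrightarrow> f \<in> carrier (aut_group Graph) \<Longrightarrow> induces k f \<Longrightarrow> zeta G A \<phi> k = f"
  using induces_unique zeta_closed induces_zeta by blast

end

section \<open>The automaton of sections\<close>

context cayley
begin

abbreviation label :: "('g \<Rightarrow> 'g) \<times> ('g \<times> 'b \<Rightarrow> 'g \<times> 'b) \<Rightarrow> 'b \<Rightarrow> 'b" where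
  "label k b \<equiv> snd (snd k (\<one>, b))"

lemma label:
  assumes "k \<in> Fix" "b \<in> B"
  shows label_closed: "label k b \<in> B" and snd_label: "snd k (\<one>, b) = (\<one>, label k b)"
    and gen_label: "fst k (s b) = s (label k b)"
  using aut_fixing_head[OF assms] by (metis snd_conv)+

lemma section_at_one:
  assumes k: "k \<in> Fix" shows "section_at k \<one> = k"
proof -
  note kc = aut_fixingD[OF k]
  have "T \<one> \<otimes>\<^bsub>aut_group Cay\<^esub> section_at k \<one> = T \<one> \<otimes>\<^bsub>aut_group Cay\<^esub> k"
    using section_at_eq[OF k one_closed] kc T.hom_one by simp
  then show ?thesis
    by (rule translation_times_fixing_unique(2)[OF one_closed one_closed section_at_fixing[OF k one_closed] k])
qed

text \<open>
  The section at \<open>x\<close> and \<open>k\<close> differ by translations on both sides, and the factor on the left is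
  determined by the condition that \<open>k\<close> fixes the identity.
\<close>

lemma section_at_inj:
  assumes k: "k \<in> Fix" and l: "l \<in> Fix" and x: "x \<in> carrier \<Gamma>"
    and eq: "section_at k x = section_at l x"
  shows "k = l"
proof -
  let ?K = "aut_group Cay" and ?z = "section_at l x"
  note kc = aut_fixingD(1)[OF k] and lc = aut_fixingD(1)[OF l]
  have z: "?z \<in> carrier ?K" using section_at_fixing[OF l x] aut_fixingD(1) by blast
  have kx: "fst k x \<in> carrier \<Gamma>" "fst l x \<in> carrier \<Gamma>"
    using Cay.aut_group_closed(1)[OF kc] Cay.aut_group_closed(1)[OF lc] x by simp_all
  have move: "T (inv (fst m x)) \<otimes>\<^bsub>?K\<^esub> m = ?z \<otimes>\<^bsub>?K\<^esub> inv\<^bsub>?K\<^esub> T x"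
    if m: "m \<in> Fix" "section_at m x = ?z" for m
  proof -
    note mc = aut_fixingD(1)[OF m(1)]
    have mx: "fst m x \<in> carrier \<Gamma>" using Cay.aut_group_closed(1)[OF mc] x by simp
    have "?z \<otimes>\<^bsub>?K\<^esub> inv\<^bsub>?K\<^esub> T x = inv\<^bsub>?K\<^esub> T (fst m x) \<otimes>\<^bsub>?K\<^esub> (m \<otimes>\<^bsub>?K\<^esub> T x) \<otimes>\<^bsub>?K\<^esub> inv\<^bsub>?K\<^esub> T x"
      using m(2) unfolding section_at_def[of m] by (simp only:)
    also have "\<dots> = inv\<^bsub>?K\<^esub> T (fst m x) \<otimes>\<^bsub>?K\<^esub> m"
      using mc translation_closed[OF x] translation_closed[OF mx]
      by (simp add: Aut.m_assoc del: T.hom_mult)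
    finally show ?thesis using mx by simp
  qed
  have "T (inv (fst k x)) \<otimes>\<^bsub>?K\<^esub> k = T (inv (fst l x)) \<otimes>\<^bsub>?K\<^esub> l"
    using move[OF k eq] move[OF l refl] by simp
  then show ?thesis
    by (rule translation_times_fixing_unique(2)[OF inv_closed[OF kx(1)] inv_closed[OF kx(2)] k l])
qed

text \<open>
  The hypotheses say that \<open>k\<close> after translation by \<open>s b\<close> and \<open>l\<close> after translation by \<open>s c\<close> are
  the same automorphism. The arc at the identity with the common image label has one
  preimage under it, and the label of this preimage is both \<open>b\<close> and \<open>c\<close>.
\<close>

lemma label_section_inj:
  assumes k: "k \<in> Fix" and l: "l \<in> Fix" and b: "b \<in> B" and c: "c \<in> B"
    and label: "label k b = label l c" and sec: "section_at k (s b) = section_at l (s c)"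
  shows "k = l \<and> b = c"
proof -
  let ?K = "aut_group Cay"
  note kc = aut_fixingD(1)[OF k] and lc = aut_fixingD(1)[OF l]
  have eq: "k \<otimes>\<^bsub>?K\<^esub> T (s b) = l \<otimes>\<^bsub>?K\<^esub> T (s c)"
    using section_at_eq[OF k gen_closed[OF b]] section_at_eq[OF l gen_closed[OF c]]
      gen_label[OF k b] gen_label[OF l c] label sec by simp
  have at: "snd (m \<otimes>\<^bsub>?K\<^esub> T (s d)) (inv (s d), d) = (\<one>, label m d)"
    if "m \<in> Fix" "d \<in> B" for m d
    using that snd_label[OF that] aut_fixingD(1)[OF that(1)] by simp
  have m: "k \<otimes>\<^bsub>?K\<^esub> T (s b) \<in> carrier ?K" using kc b by simp
  have "snd (k \<otimes>\<^bsub>?K\<^esub> T (s b)) (inv (s b), b) = snd (k \<otimes>\<^bsub>?K\<^esub> T (s b)) (inv (s c), c)"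
    using at[OF k b] at[OF l c] label eq by simp
  then have "(inv (s b), b) = (inv (s c), c)"
    by (rule inj_onD[OF Cay.aut_group_inj(2)[OF m]]) (use b c in auto)
  then have "b = c" by simp
  then show ?thesis using section_at_inj[OF k l gen_closed[OF b]] sec by simp
qed

text \<open>
  The states only name automorphisms, by means of \<open>\<iota>\<close>, so that they can be taken from any type
  with sufficiently many elements. Output and transition are chosen so that the relation
  \<open>q b = \<lambda>(q, b) \<rho>(q, b)\<close> of the automaton becomes \<open>section_at_eq\<close> at the vertex \<open>s b\<close>.
\<close>

definition section_automaton ::
    "'q set \<Rightarrow> ('q \<Rightarrow> ('g \<Rightarrow> 'g) \<times> ('g \<times> 'b \<Rightarrow> 'g \<times> 'b)) \<Rightarrow> ('b, 'q) mealy" where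
  "section_automaton Q \<iota> = \<lparr>alphabet = B, states = Q, outp = (\<lambda>q b. label (\<iota> q) b),
     trans = (\<lambda>q b. inv_into Q \<iota> (section_at (\<iota> q) (s b)))\<rparr>"

lemma section_automaton_simps [simp]:
  "alphabet (section_automaton Q \<iota>) = B" "states (section_automaton Q \<iota>) = Q"
  "outp (section_automaton Q \<iota>) q b = label (\<iota> q) b"
  by (simp_all add: section_automaton_def)

lemma section_automaton_trans:
  assumes "bij_betw \<iota> Q Z" "\<forall>k \<in> Z. \<forall>b \<in> B. section_at k (s b) \<in> Z" "q \<in> Q" "b \<in> B"
  shows "trans (section_automaton Q \<iota>) q b \<in> Q"
    and "\<iota> (trans (section_automaton Q \<iota>) q b) = section_at (\<iota> q) (s b)"
proof -
  have Z: "\<iota> ` Q = Z" using assms(1) by (simp add: bij_betw_def)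
  then have "section_at (\<iota> q) (s b) \<in> \<iota> ` Q" using assms(2-4) by blast
  then show "trans (section_automaton Q \<iota>) q b \<in> Q"
    and "\<iota> (trans (section_automaton Q \<iota>) q b) = section_at (\<iota> q) (s b)"
    by (simp_all add: section_automaton_def inv_into_into f_inv_into_f)
qed

text \<open>
  All sets involved are finite, so the three bijectivity conditions reduce to injectivity: that
  of an automorphism on the arcs leaving the identity, that of taking sections, and
  \<open>label_section_inj\<close>.
\<close>

lemma section_automaton_bireversible:
  assumes "finite B" "finite Q" and \<iota>: "bij_betw \<iota> Q Z" and Z: "Z \<subseteq> Fix"
    and closed: "\<forall>k \<in> Z. \<forall>b \<in> B. section_at k (s b) \<in> Z"
  shows "bireversible (section_automaton Q \<iota>)" (is "bireversible ?M")
proof -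
  note tr = section_automaton_trans[OF \<iota> closed]
  have F: "\<iota> q \<in> Fix" if "q \<in> Q" for q using \<iota> Z that by (auto simp: bij_betw_def)
  have inj: "q = r" if "\<iota> q = \<iota> r" "q \<in> Q" "r \<in> Q" for q r
    using \<iota> that by (auto simp: bij_betw_def dest: inj_onD)
  have bij: "bij_betw f U U" if "inj_on f U" "f ` U \<subseteq> U" "finite U" for f :: "'x \<Rightarrow> 'x" and U
    using that by (simp add: bij_betw_def endo_inj_surj)
  have "bij_betw (outp ?M q) B B" if q: "q \<in> Q" for q
  proof -
    note k = aut_fixingD(1)[OF F[OF q]]
    have "inj_on (outp ?M q) B"
    proof (rule inj_onI)
      fix b c assume bc: "b \<in> B" "c \<in> B" "outp ?M q b = outp ?M q c"
      then have "snd (\<iota> q) (\<one>, b) = snd (\<iota> q) (\<one>, c)"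
        using snd_label[OF F[OF q] bc(1)] snd_label[OF F[OF q] bc(2)] by (metis section_automaton_simps(3))
      then have "(\<one>, b) = (\<one>, c)"
        by (rule inj_onD[OF Cay.aut_group_inj(2)[OF k]]) (use bc in auto)
      then show "b = c" by simp
    qed
    then show ?thesis
      using label_closed[OF F[OF q]] \<open>finite B\<close>
      by (intro bij) auto
  qed
  moreover have "bij_betw (\<lambda>q. trans ?M q b) Q Q" if b: "b \<in> B" for b
  proof (rule bij)
    show "inj_on (\<lambda>q. trans ?M q b) Q"
    proof (rule inj_onI)
      fix q r assume qr: "q \<in> Q" "r \<in> Q" "trans ?M q b = trans ?M r b"
      then have "section_at (\<iota> q) (s b) = section_at (\<iota> r) (s b)"
        using tr(2)[OF qr(1) b] tr(2)[OF qr(2) b] by simp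
      then show "q = r" using section_at_inj[OF F F gen_closed[OF b]] inj qr by blast
    qed
    show "(\<lambda>q. trans ?M q b) ` Q \<subseteq> Q" using tr(1) b by auto
  qed fact
  moreover have "bij_betw (\<lambda>(q, b). (outp ?M q b, trans ?M q b)) (Q \<times> B) (B \<times> Q)"
  proof -
    let ?f = "\<lambda>(q, b). (outp ?M q b, trans ?M q b)"
    have into: "?f ` (Q \<times> B) \<subseteq> B \<times> Q" using tr(1) label_closed[OF F] by auto
    have "inj_on ?f (Q \<times> B)"
    proof (rule inj_onI, clarify)
      fix q b r c assume qb: "q \<in> Q" "b \<in> B" "r \<in> Q" "c \<in> B"
        and eq: "outp ?M q b = outp ?M r c" "trans ?M q b = trans ?M r c"
      have "section_at (\<iota> q) (s b) = section_at (\<iota> r) (s c)"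
        using tr(2)[OF qb(1,2)] tr(2)[OF qb(3,4)] eq(2) by simp
      then have "\<iota> q = \<iota> r \<and> b = c"
        using label_section_inj[OF F[OF qb(1)] F[OF qb(3)] qb(2,4)] eq(1) by simp
      then show "q = r \<and> b = c" using inj qb by blast
    qed
    moreover from this have "?f ` (Q \<times> B) = B \<times> Q"
      using into \<open>finite B\<close> \<open>finite Q\<close>
      by (intro card_subset_eq) (auto simp: card_image card_cartesian_product)
    ultimately show ?thesis by (simp add: bij_betw_def)
  qed
  ultimately show ?thesis
    using assms(1,2) tr(1) label_closed[OF F] by (auto simp: bireversible_def mealy_automaton_def)
qed

end

section \<open>Bireversible automorphisms are the commensurating ones\<close>

context birev
begin

lemma tree_action_normalizes:
  assumes "marked_group G A \<phi>" "compatible M G \<phi>" "p \<in> carrier \<pi>"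
  shows "tree_action p \<in> kernel_normalizer G A \<phi>"
proof -
  interpret mg: marked_group G A \<phi> by fact
  show ?thesis
  proof (rule mg.kernel_normalizerI)
    fix n assume n: "n \<in> kernel (free_group A) G \<phi>"
    show "\<exists>n' \<in> kernel (free_group A) G \<phi>. tree_action p \<otimes>\<^bsub>aut_group Tree\<^esub> L n
        \<otimes>\<^bsub>aut_group Tree\<^esub> inv\<^bsub>aut_group Tree\<^esub> tree_action p = L n'"
      by (rule compatible_conj[OF assms(2,3) n])
    show "\<exists>n' \<in> kernel (free_group A) G \<phi>. inv\<^bsub>aut_group Tree\<^esub> tree_action p \<otimes>\<^bsub>aut_group Tree\<^esub> L n
        \<otimes>\<^bsub>aut_group Tree\<^esub> tree_action p = L n'"
      using compatible_conj[OF assms(2) pi.inv_closed[OF assms(3)] n] assms(3) by simp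
  qed (use assms(3) in simp)
qed

text \<open>
  The equation \<open>g w = w' h\<close> in the fundamental group projects to the graph, where it exhibits the
  automorphism induced by \<open>h\<close> as the section at \<open>\<phi> w\<close>.
\<close>

lemma finite_sections_of_generated:
  assumes mg: "marked_group G A \<phi>" and comp: "compatible M G \<phi>" and g: "g \<in> FQ M"
    and f: "zeta G A \<phi> (tree_action g) \<in> aut_fixing (cayley_graph G A (\<lambda>a. \<phi> (free_gen a))) \<one>\<^bsub>G\<^esub>"
  shows "finite (cayley.section_at G A (\<lambda>a. \<phi> (free_gen a)) (zeta G A \<phi> (tree_action g)) ` carrier G)"
proof -
  interpret mg: marked_group G A \<phi> by fact
  let ?K = "aut_group mg.Graph" and ?z = "\<lambda>p. zeta G A \<phi> (tree_action p)"
  note norm = tree_action_normalizes[OF mg comp]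
  note zc = mg.zeta_closed[OF norm] and zi = mg.induces_zeta[OF norm]
  obtain C where C: "finite C" "C \<subseteq> FQ M" "\<And>w. w \<in> reduced_words A \<Longrightarrow>
      \<exists>w' \<in> reduced_words A. \<exists>h' \<in> C. g \<otimes>\<^bsub>\<pi>\<^esub> embA M w = embA M w' \<otimes>\<^bsub>\<pi>\<^esub> h'"
    using FQ_past_words[OF g] by metis
  note gc = FQ_closed[OF g]
  have root: "?z h \<in> mg.graph.Fix" if h: "h \<in> FQ M" for h
  proof -
    have "\<phi> (fst (tree_action h) []) = fst (?z h) (\<phi> [])"
      using zi[OF FQ_closed[OF h]] by (simp add: mg.induces_def)
    moreover have "\<phi> [] = \<one>\<^bsub>G\<^esub>" using mg.phi.hom_one by simp
    ultimately have "fst (?z h) \<one>\<^bsub>G\<^esub> = \<one>\<^bsub>G\<^esub>" using FQ_fixes_root[OF h] by simp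
    then show ?thesis using zc[OF FQ_closed[OF h]] by (simp add: aut_fixing_def)
  qed
  have "mg.graph.section_at (?z g) ` carrier G \<subseteq> ?z ` C"
  proof
    fix k assume "k \<in> mg.graph.section_at (?z g) ` carrier G"
    then obtain x where x: "k = mg.graph.section_at (?z g) x" "x \<in> carrier G" by (rule imageE)
    obtain w where w: "w \<in> reduced_words A" "\<phi> w = x" using mg.phi_surj[OF x(2)] by blast
    obtain w' h where wh: "w' \<in> reduced_words A" "h \<in> C" "g \<otimes>\<^bsub>\<pi>\<^esub> embA M w = embA M w' \<otimes>\<^bsub>\<pi>\<^esub> h"
      using C(3)[OF w(1)] by blast
    have h: "h \<in> FQ M" using wh(2) C(2) by blast
    note hc = FQ_closed[OF h]
    have "tree_action g \<otimes>\<^bsub>aut_group Tree\<^esub> L w = L w' \<otimes>\<^bsub>aut_group Tree\<^esub> tree_action h"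
      using arg_cong[OF wh(3), of tree_action] gc hc w(1) wh(1) by (simp add: tree_action_emb)
    moreover have "mg.induces (tree_action g \<otimes>\<^bsub>aut_group Tree\<^esub> L w) (?z g \<otimes>\<^bsub>?K\<^esub> mg.T x)"
      using mg.induces_mult[OF zi[OF gc] mg.induces_translation[OF w(1)]] zc[OF gc] gc w
        mg.graph.translation_closed[OF x(2)] by simp
    moreover have "mg.induces (L w' \<otimes>\<^bsub>aut_group Tree\<^esub> tree_action h) (mg.T (\<phi> w') \<otimes>\<^bsub>?K\<^esub> ?z h)"
      using mg.induces_mult[OF mg.induces_translation[OF wh(1)] zi[OF hc]] zc[OF hc] hc wh(1) by simp
    ultimately have "?z g \<otimes>\<^bsub>?K\<^esub> mg.T x = mg.T (\<phi> w') \<otimes>\<^bsub>?K\<^esub> ?z h"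
      using mg.induces_unique zc[OF gc] zc[OF hc] x(2) wh(1) by (simp add: mg.induces_unique)
    then have eq: "mg.T (fst (?z g) x) \<otimes>\<^bsub>?K\<^esub> k = mg.T (\<phi> w') \<otimes>\<^bsub>?K\<^esub> ?z h"
      using mg.graph.section_at_eq[OF f x(2)] x(1) by simp
    have gx: "fst (?z g) x \<in> carrier G" using mg.graph.Cay.aut_group_closed(1)[OF zc[OF gc]] x(2) by simp
    have kF: "k \<in> mg.graph.Fix" unfolding x(1) by (rule mg.graph.section_at_fixing[OF f x(2)])
    have "k = ?z h"
      by (rule mg.graph.translation_times_fixing_unique(2)[OF gx mg.phi_closed[OF wh(1)] kF root[OF h] eq])
    then show "k \<in> ?z ` C" using wh(2) by (rule image_eqI)
  qed
  then show ?thesis using C(1) finite_subset by blast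
qed

end

context marked_group
begin

text \<open>
  The automaton of all sections of \<open>f\<close> does the job; \<open>f\<close> is one of its states, being its own
  section at the identity. Its relations hold among automorphisms of the graph, so
  \<open>state_past_word\<close> compares the action on words with the action on the graph.
\<close>

lemma finite_sections_imp_bireversible:
  assumes f: "f \<in> graph.Fix" and fin: "finite (graph.section_at f ` carrier G)"
  shows "f \<in> bireversible_auts G A \<phi>"
proof -
  let ?K = "aut_group Graph"
  define Z where "Z = graph.section_at f ` carrier G"
  obtain \<iota> where \<iota>: "bij_betw \<iota> {0..<card Z} Z"
    using ex_bij_betw_nat_finite fin unfolding Z_def by blast
  define Q where "Q = {0..<card Z}"
  note \<iota> = \<iota>[folded Q_def]
  have Z: "Z \<subseteq> graph.Fix" using graph.section_at_fixing[OF f] unfolding Z_def by auto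
  have closed: "\<forall>k \<in> Z. \<forall>a \<in> A. graph.section_at k (\<phi> (free_gen a)) \<in> Z"
  proof (intro ballI)
    fix k a assume ka: "k \<in> Z" "a \<in> A"
    obtain x where x: "k = graph.section_at f x" "x \<in> carrier G" using \<open>k \<in> Z\<close> unfolding Z_def by (rule imageE)
    have "graph.section_at k (\<phi> (free_gen a)) = graph.section_at f (x \<otimes> \<phi> (free_gen a))"
      unfolding x(1) by (rule graph.section_at_section[OF f x(2)]) (use ka in simp)
    then show "graph.section_at k (\<phi> (free_gen a)) \<in> Z" unfolding Z_def using x(2) ka(2) by simp
  qed
  define M where "M = graph.section_automaton Q \<iota>"
  have M_simps [simp]: "alphabet M = A" "states M = Q" "outp M q a = graph.label (\<iota> q) a" for q a
    by (simp_all add: M_def)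
  have bi: "bireversible M"
    unfolding M_def
    by (rule graph.section_automaton_bireversible[OF finite_A _ \<iota> Z closed]) (auto simp: Q_def)
  interpret M: birev M by unfold_locales (rule bi)
  note tr = graph.section_automaton_trans[OF \<iota> closed, folded M_def]
  have F: "\<iota> q \<in> graph.Fix" if "q \<in> Q" for q using \<iota> Z that by (auto simp: bij_betw_def)
  note Fc = graph.aut_fixingD[OF F]
  have inj: "q = r" if "\<iota> q = \<iota> r" "q \<in> Q" "r \<in> Q" for q r
    using \<iota> that by (auto simp: bij_betw_def dest: inj_onD)
  have lift: "free_lift ?K (\<lambda>a. T (\<phi> (free_gen a))) w = T (\<phi> w)" if "w \<in> reduced_words A" for w
  proof -
    have "(T \<circ> \<phi>) w = free_lift ?K (\<lambda>a. T (\<phi> (free_gen a))) w"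
      by (rule free_lift_unique[OF graph.Aut.is_group Group.hom_compose[OF phi_hom graph.translation_hom] _ that])
         simp
    then show ?thesis by simp
  qed
  have key: "\<iota> q \<otimes>\<^bsub>?K\<^esub> T (\<phi> w) = T (\<phi> (word_out M q w)) \<otimes>\<^bsub>?K\<^esub> \<iota> (word_next M q w)"
    if q: "q \<in> Q" and w: "w \<in> reduced_words A" for q w
  proof -
    have "\<iota> q \<otimes>\<^bsub>?K\<^esub> free_lift ?K (\<lambda>a. T (\<phi> (free_gen a))) w =
        free_lift ?K (\<lambda>a. T (\<phi> (free_gen a))) (word_out M q w) \<otimes>\<^bsub>?K\<^esub> \<iota> (word_next M q w)"
    proof (rule M.state_past_word[OF graph.Aut.is_group])
      fix q a assume "q \<in> M.Q" "a \<in> M.A"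
      then have qa: "q \<in> Q" "a \<in> A" by simp_all
      show "\<iota> q \<otimes>\<^bsub>?K\<^esub> T (\<phi> (free_gen a)) = T (\<phi> (free_gen (outp M q a))) \<otimes>\<^bsub>?K\<^esub> \<iota> (trans M q a)"
        using graph.section_at_eq[OF F[OF qa(1)], of "\<phi> (free_gen a)"] graph.gen_label[OF F[OF qa(1)] qa(2)]
          tr(2)[OF qa] qa(2) by simp
    qed (use q w Fc in auto)
    then show ?thesis using lift[OF w] lift[of "word_out M q w"] M.word_out_closed[of q w] q w by simp
  qed
  have out [simp]: "word_out M q w \<in> reduced_words A" "word_next M q w \<in> Q"
    if "q \<in> Q" "w \<in> reduced_words A" for q w
    using M.word_out_closed[of q w] M.word_next_reduced[of q w] that by simp_all
  have vert: "fst (\<iota> q) (\<phi> w) = \<phi> (word_out M q w)" if q: "q \<in> Q" and w: "w \<in> reduced_words A" for q w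
  proof -
    have "fst (\<iota> q \<otimes>\<^bsub>?K\<^esub> T (\<phi> w)) \<one> = fst (T (\<phi> (word_out M q w)) \<otimes>\<^bsub>?K\<^esub> \<iota> (word_next M q w)) \<one>"
      using key[OF q w] by simp
    then show ?thesis using Fc q w by simp
  qed
  have induces: "induces (state_aut M q) (\<iota> q)" if q: "q \<in> Q" for q
    unfolding induces_def
  proof (intro conjI ballI)
    fix w assume w: "w \<in> reduced_words A"
    show "\<phi> (fst (state_aut M q) w) = fst (\<iota> q) (\<phi> w)"
      using vert[OF q w] M.state_aut_simps(1)[of w q] w by simp
    fix a assume a: "a \<in> A"
    let ?r = "word_next M q w"
    have r: "?r \<in> Q" using q w by simp
    obtain c where c: "c = graph.label (\<iota> ?r) a" by blast
    have lab: "snd (\<iota> ?r) (\<one>, a) = (\<one>, c)" "c \<in> A"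
      unfolding c using graph.snd_label[OF F[OF r] a] graph.label_closed[OF F[OF r] a] .
    have "snd (\<iota> q \<otimes>\<^bsub>?K\<^esub> T (\<phi> w)) (\<one>, a) = snd (T (\<phi> (word_out M q w)) \<otimes>\<^bsub>?K\<^esub> \<iota> ?r) (\<one>, a)"
      using key[OF q w] by simp
    then have "snd (\<iota> q) (\<phi> w, a) = (\<phi> (word_out M q w), c)"
      using Fc[OF q] Fc[OF r] q w a lab by simp
    then show "proj_arcs \<phi> (snd (state_aut M q) (w, a)) = snd (\<iota> q) (\<phi> w, a)"
      using M.state_aut_simps(2)[of w a q] w a lab(1) by (simp add: proj_arcs_def)
  qed
  have comp: "compatible M G \<phi>"
  proof (rule M.compatibleI)
    show "kernel (free_group M.A) G \<phi> \<lhd> free_group M.A" using phi.normal_kernel by simp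
  next
    fix q k assume "q \<in> M.Q" "k \<in> kernel (free_group M.A) G \<phi>"
    then have q: "q \<in> Q" and k: "k \<in> reduced_words A" "\<phi> k = \<one>" by (auto simp: kernel_def)
    (* Since k and its image both project to the identity, the relation leaves the same
       automorphism on both sides: q is its own section along the kernel. *)
    have o: "\<phi> (word_out M q k) = \<one>" using vert[OF q k(1)] k(2) Fc[OF q] by simp
    have "T \<one> \<otimes>\<^bsub>?K\<^esub> \<iota> (word_next M q k) = T \<one> \<otimes>\<^bsub>?K\<^esub> \<iota> q"
      using key[OF q k(1)] k(2) o Fc[OF q] graph.T.hom_one by simp
    then have "\<iota> (word_next M q k) = \<iota> q"
      using Fc[OF q] Fc(1)[OF out(2)[OF q k(1)]] graph.T.hom_one by simp
    then have "word_next M q k = q" using inj q k by simp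
    then show "word_out M q k \<in> kernel (free_group M.A) G \<phi> \<and> word_next M q k = q"
      using o q k by (simp add: kernel_def)
    obtain w where w: "w \<in> reduced_words A" "word_out M q w = k"
      using M.word_out_surj[of q k] q k by auto
    have "fst (\<iota> q) (\<phi> w) = fst (\<iota> q) \<one>" using vert[OF q w(1)] w(2) k(2) Fc[OF q] by simp
    then have "\<phi> w = \<one>"
      by (rule inj_onD[OF graph.Cay.aut_group_inj(1)[OF Fc(1)[OF q]]]) (use w in simp_all)
    then show "\<exists>k' \<in> kernel (free_group M.A) G \<phi>. word_out M q k' = k"
      using w by (auto simp: kernel_def)
  qed
  have "f \<in> Z"
    unfolding Z_def using graph.section_at_one[OF f] by (metis imageI one_closed)
  then obtain q where q: "q \<in> Q" "f = \<iota> q" using \<iota> by (auto simp: bij_betw_def)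
  let ?g = "pi1_gen M (Inl q)"
  have g: "?g \<in> FQ M" using M.state_in_FQ[of q] q(1) by simp
  have act: "M.tree_action ?g = state_aut M q" using M.tree_action_state[of q] q(1) by simp
  have psi: "psi M (NQ M #>\<^bsub>pi1 M\<^esub> ?g) = state_aut M q"
    using M.psi_eq[OF M.FQ_closed[OF g]] act by simp
  have mg: "marked_group G M.A \<phi>" using marked_group_axioms by simp
  have "state_aut M q \<in> N\<phi>"
    using M.tree_action_normalizes[OF mg comp M.FQ_closed[OF g]] act by simp
  then have "f = zeta G A \<phi> (psi M (NQ M #>\<^bsub>pi1 M\<^esub> ?g))"
    unfolding psi q(2) by (rule zeta_eqI[symmetric]) (use Fc[OF q(1)] induces[OF q(1)] in simp_all)
  moreover have "NQ M #>\<^bsub>pi1 M\<^esub> ?g \<in> automaton_group M"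
    unfolding automaton_group_def using g by (rule imageI)
  ultimately have "f \<in> zeta G A \<phi> ` psi M ` automaton_group M" by blast
  then show ?thesis
    unfolding bireversible_auts_def marked_graph_def
    using f bi comp M_simps(1) by blast
qed

lemma bireversible_imp_finite_sections:
  assumes "f \<in> bireversible_auts G A \<phi>"
  shows "f \<in> graph.Fix" and "finite (graph.section_at f ` carrier G)"
proof -
  obtain M :: "('a, nat) mealy" where M: "alphabet M = A" "bireversible M" "compatible M G \<phi>"
    and f: "f \<in> graph.Fix" "f \<in> zeta G A \<phi> ` psi M ` automaton_group M"
    using assms unfolding bireversible_auts_def marked_graph_def by blast
  interpret M: birev M by unfold_locales (rule M(2))
  obtain g where g: "g \<in> FQ M" "f = zeta G A \<phi> (psi M (NQ M #>\<^bsub>pi1 M\<^esub> g))"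
    using f(2) unfolding automaton_group_def by blast
  have fz: "f = zeta G A \<phi> (M.tree_action g)" using g(2) M.psi_eq[OF M.FQ_closed[OF g(1)]] by simp
  show "f \<in> graph.Fix" by (rule f(1))
  show "finite (graph.section_at f ` carrier G)"
    using M.finite_sections_of_generated[of G \<phi> g] marked_group_axioms M(1,3) g(1) f(1) fz by simp
qed

end

theorem theorem3p4:
  fixes G :: "('g, 'm) monoid_scheme" and A :: "'a set" and \<phi> :: "'a fword \<Rightarrow> 'g"
  assumes "marked_group G A \<phi>"
  shows "commensurator (aut_group (marked_graph G A \<phi>)) (left_translation G A ` carrier G)
           \<inter> aut_fixing (marked_graph G A \<phi>) \<one>\<^bsub>G\<^esub>
         = bireversible_auts G A \<phi>"
proof -
  interpret marked_group G A \<phi> by fact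
  show ?thesis
    unfolding marked_graph_def
    using graph.commensurator_iff_finite_sections finite_sections_imp_bireversible
      bireversible_imp_finite_sections by blast
qed

end
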